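(* Let $q\ge3$ be an integer. For every $\underline{a}\in\mathcal{A}_q$, every $i\in\{1,\dots,\kappa_q\}$ and each choice of sign (the same sign in both places): $$\Pi_2(\underline{a})\in\pm[\psi_{\kappa_q-i+1},R_q]\quad\text{if}\quad\Pi_1(\underline{a})\in\pm[\phi_{i-1},\phi_i].$$ Hence the set $\Omega_q\subset I_q\times I_{R_q}$ of pairs $(x,y)$ whose combined two-sided digit sequence lies in $\mathcal{A}_q$ is given by $$\Omega_q=\bigcup_{i=1}^{\kappa_q}\Big([\phi_{i-1},\phi_i]\times[\psi_{\kappa_q-i+1},R_q]\Big)\cup\Big([-\phi_i,-\phi_{i-1}]\times[-R_q,-\psi_{\kappa_q-i+1}]\Big).$$
   Context: Let $\lambda_q=2\cos(\pi/q)$. Put $h_q=\frac{q-2}{2}$ for $q$ even and $h_q=\frac{q-3}{2}$ for $q$ odd; $\kappa_q=h_q$ for $q$ even and $\kappa_q=2h_q+1$ for $q$ odd. In sequences, $(a)^k$ means $a$ repeated $k$ times (absent if $k=0$), and an overline marks a period. The set $\mathcal{B}_q$ of forbidden blocks (same sign throughout each block) is: for $q=3$: $(\pm1)$ and $(\pm2,\pm m)$, $m\ge1$; for $q$ even: $((\pm1)^{h_q+1})$ and $((\pm1)^{h_q},\pm m)$, $m\ge1$; for $q\ge5$ odd: $((\pm1)^{h_q+1})$ and $((\pm1)^{h_q},\pm2,(\pm1)^{h_q},\pm m)$, $m\ge1$. $\mathcal{A}_q$ is the set of two-sided infinite sequences $\underline{a}=(a_i)_{i\in\mathbb{Z}}$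 of nonzero integers such that $(a_l,a_{l+1},\dots,a_{l+k})\notin\mathcal{B}_q$ for all $l\in\mathbb{Z}$, $k\ge0$. A $\lambda_q$-CF is an expansion $[a_0;a_1,a_2,\dots]=a_0\lambda_q+\cfrac{-1}{a_1\lambda_q+\cfrac{-1}{a_2\lambda_q+\cdots}}$, infinite ones being limits of their truncations. It is regular if no block of consecutive digits of $(a_1,a_2,\dots)$ lies in $\mathcal{B}_q$, and dual regular if no such block read in reversed order lies in $\mathcal{B}_q$; regular and dual regular $\lambda_q$-CF's converge. For $\underline{a}\in\mathcal{A}_q$ put $\Pi_1(\underline{a})=[0;a_1,a_2,a_3,\dots]$ (a regular $\lambda_q$-CF) and $\Pi_2(\underline{a})=[0;a_0,a_{-1},a_{-2},\dots]$ (a dual regular $\lambda_q$-CF). Let $r_3=[0;\overline{3}]$, $r_q=[0;\overline{(1)^{h_q-1},2}]$ for $q$ even, $r_q=[0;\overline{(1)^{h_q},2,(1)^{h_q-1},2}]$ for $q\ge5$ odd, and $R_q=\lambda_q+r_q$. Let $I_q=[-\lambda_q/2,\lambda_q/2]$ and $I_{R_q}=[-R_q,R_q]$. $\Omega_q$ denotes the set of pairs $(x,y)$ with regular respectively dual regular $\lambda_q$-CF $x=[0;a_1,a_2,a_3,\dots]$ and $y=[0;a_0,a_{-1},a_{-2},\dots]$ such that the two-sided sequence $\underline{a}=(a_i)_{i\in\mathbb{Z}}$ belongs to $\mathcal{A}_q$. (It is the domain of the natural extension, which shifts $\underline a$ by one place.) The points $\phi_0,\dots,\phi_{\kappa_q}$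 and $\psi_0,\dots,\psi_{\kappa_q}$ are as follows. $q$ even: $\phi_i=[0;(1)^{h_q-i}]$ and $\psi_i=[0;(1)^{h_q-i},\overline{2,(1)^{h_q-1}}]$ for $0\le i\le h_q$. $q\ge5$ odd: $\phi_{2i}=[0;(1)^{h_q-i},2,(1)^{h_q}]$, $\phi_{2i+1}=[0;(1)^{h_q-i}]$, $\psi_{2i}=[0;(1)^{h_q-i},\overline{2,(1)^{h_q},2,(1)^{h_q-1}}]$, $\psi_{2i+1}=[0;(1)^{h_q-i},\overline{2,(1)^{h_q-1},2,(1)^{h_q}}]$ for $0\le i\le h_q$. $q=3$: $\phi_0=-\tfrac12$, $\phi_1=0$, $\psi_0=-R_3$, $\psi_1=r_3$. For a set $A\subset\mathbb{R}$, $+A=A$ and $-A=\{-a:a\in A\}$.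
   Formalization: The equality for Ω_q fails for bi-infinite sequences (x=0 is never attained); it is proved with finite (dual) regular expansions also admitted, and for the literal Ω_q as the union of rectangles intersected with the values of infinite regular and infinite dual regular expansions. *)

theory Defs
  imports "HOL-Analysis.Analysis" "HOL-Library.Extended_Nat"
begin

definition lam :: "nat \<Rightarrow> real" where
  "lam q = 2 * cos (pi / real q)"

definition hq :: "nat \<Rightarrow> nat" where
  "hq q = (if even q then (q - 2) div 2 else (q - 3) div 2)"

definition kappa :: "nat \<Rightarrow> nat" where
  "kappa q = (if even q then hq q else 2 * hq q + 1)"

definition forbidden :: "nat \<Rightarrow> int list set" where
  "forbidden q =
     (if q = 3 then
        {[s] |s. s \<in> {1, -1}} \<union>
        {[2 * s, s * m] |s m. s \<in> {1, -1} \<and> 1 \<le> m}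
      else if even q then
        {replicate (hq q + 1) s |s. s \<in> {1, -1}} \<union>
        {replicate (hq q) s @ [s * m] |s m. s \<in> {1, -1} \<and> 1 \<le> m}
      else
        {replicate (hq q + 1) s |s. s \<in> {1, -1}} \<union>
        {replicate (hq q) s @ [2 * s] @ replicate (hq q) s @ [s * m]
          |s m. s \<in> {1, -1} \<and> 1 \<le> m})"

definition Aq :: "nat \<Rightarrow> (int \<Rightarrow> int) set" where
  "Aq q = {a. (\<forall>i. a i \<noteq> 0) \<and>
     (\<forall>l. \<forall>k::nat. map a [l..l + int k] \<notin> forbidden q)}"

(* The value of the finite expansion [0; d1, ..., dn]; the integer part is 0 in every
   expansion below, R_q = lam q + r_q being written out. *)
fun cf_list :: "nat \<Rightarrow> int list \<Rightarrow> real" where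
  "cf_list q [] = 0"
| "cf_list q (d # ds) = - 1 / (of_int d * lam q + cf_list q ds)"

(* The value of [0; d 0, d 1, d 2, ...]. *)
definition cf_inf :: "nat \<Rightarrow> (nat \<Rightarrow> int) \<Rightarrow> real" where
  "cf_inf q d = lim (\<lambda>n. cf_list q (map d [0..<n]))"

(* An expansion with N digits d 0, d 1, ...; it is infinite iff N is infinite.
   Values of d at positions not below N are irrelevant. *)
definition cf :: "nat \<Rightarrow> enat \<Rightarrow> (nat \<Rightarrow> int) \<Rightarrow> real" where
  "cf q N d = (case N of enat n \<Rightarrow> cf_list q (map d [0..<n]) | \<infinity> \<Rightarrow> cf_inf q d)"

definition regular :: "nat \<Rightarrow> enat \<Rightarrow> (nat \<Rightarrow> int) \<Rightarrow> bool" where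
  "regular q N d \<longleftrightarrow> (\<forall>i. enat i < N \<longrightarrow> d i \<noteq> 0) \<and>
     (\<forall>l k. enat (l + k) < N \<longrightarrow> map d [l..<l + k + 1] \<notin> forbidden q)"

definition dual_regular :: "nat \<Rightarrow> enat \<Rightarrow> (nat \<Rightarrow> int) \<Rightarrow> bool" where
  "dual_regular q N d \<longleftrightarrow> (\<forall>i. enat i < N \<longrightarrow> d i \<noteq> 0) \<and>
     (\<forall>l k. enat (l + k) < N \<longrightarrow> rev (map d [l..<l + k + 1]) \<notin> forbidden q)"

definition right_digits :: "(int \<Rightarrow> int) \<Rightarrow> nat \<Rightarrow> int" where
  "right_digits a n = a (int n + 1)"

definition left_digits :: "(int \<Rightarrow> int) \<Rightarrow> nat \<Rightarrow> int" where
  "left_digits a n = a (- int n)"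

definition Pi1 :: "nat \<Rightarrow> (int \<Rightarrow> int) \<Rightarrow> real" where
  "Pi1 q a = cf_inf q (right_digits a)"

definition Pi2 :: "nat \<Rightarrow> (int \<Rightarrow> int) \<Rightarrow> real" where
  "Pi2 q a = cf_inf q (left_digits a)"

(* The digit sequence w p p p ... *)
definition ev_periodic :: "int list \<Rightarrow> int list \<Rightarrow> nat \<Rightarrow> int" where
  "ev_periodic w p n =
     (if n < length w then w ! n else p ! ((n - length w) mod length p))"

definition cf_per :: "nat \<Rightarrow> int list \<Rightarrow> int list \<Rightarrow> real" where
  "cf_per q w p = cf_inf q (ev_periodic w p)"

definition rq :: "nat \<Rightarrow> real" where
  "rq q =
     (if q = 3 then cf_per q [] [3]
      else if even q then cf_per q [] (replicate (hq q - 1) 1 @ [2])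
      else cf_per q [] (replicate (hq q) 1 @ [2] @ replicate (hq q - 1) 1 @ [2]))"

definition Rq :: "nat \<Rightarrow> real" where
  "Rq q = lam q + rq q"

definition Iq :: "nat \<Rightarrow> real set" where
  "Iq q = {- lam q / 2 .. lam q / 2}"

definition IRq :: "nat \<Rightarrow> real set" where
  "IRq q = {- Rq q .. Rq q}"

definition phi :: "nat \<Rightarrow> nat \<Rightarrow> real" where
  "phi q j =
     (if q = 3 then (if j = 0 then - 1 / 2 else 0)
      else if even q then cf_list q (replicate (hq q - j) 1)
      else if even j
        then cf_list q (replicate (hq q - j div 2) 1 @ [2] @ replicate (hq q) 1)
        else cf_list q (replicate (hq q - j div 2) 1))"

definition psi :: "nat \<Rightarrow> nat \<Rightarrow> real" where
  "psi q j =
     (if q = 3 then (if j = 0 then - Rq q else rq q)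
      else if even q
        then cf_per q (replicate (hq q - j) 1) ([2] @ replicate (hq q - 1) 1)
      else if even j
        then cf_per q (replicate (hq q - j div 2) 1)
               ([2] @ replicate (hq q) 1 @ [2] @ replicate (hq q - 1) 1)
        else cf_per q (replicate (hq q - j div 2) 1)
               ([2] @ replicate (hq q - 1) 1 @ [2] @ replicate (hq q) 1))"

(* Omega q only uses digit sequences that are infinite in both directions. *)
definition Omega :: "nat \<Rightarrow> (real \<times> real) set" where
  "Omega q = {(x, y). \<exists>a \<in> Aq q.
     regular q \<infinity> (right_digits a) \<and> x = cf q \<infinity> (right_digits a) \<and>
     dual_regular q \<infinity> (left_digits a) \<and> y = cf q \<infinity> (left_digits a)}"

(* The positions i of the digits of a sequence with M digits a 0, a (-1), ... and
   N digits a 1, a 2, .... *)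
definition positions :: "enat \<Rightarrow> enat \<Rightarrow> int set" where
  "positions M N = {i. i \<le> 0 \<and> enat (nat (- i)) < M \<or> 1 \<le> i \<and> enat (nat (i - 1)) < N}"

(* The analogue of Aq for sequences that may terminate on either side;
   Aq_term q \<infinity> \<infinity> = Aq q. *)
definition Aq_term :: "nat \<Rightarrow> enat \<Rightarrow> enat \<Rightarrow> (int \<Rightarrow> int) set" where
  "Aq_term q M N = {a. (\<forall>i \<in> positions M N. a i \<noteq> 0) \<and>
     (\<forall>l. \<forall>k::nat. {l..l + int k} \<subseteq> positions M N \<longrightarrow>
        map a [l..l + int k] \<notin> forbidden q)}"

(* A finite expansion has no infinite regular companion with the same value: 0, for
   instance, is the first coordinate of no point of Omega q. The closed rectangles contain
   such points, so the equality of sets needs finite regular and dual regular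
   expansions as well. *)
definition Omega_full :: "nat \<Rightarrow> (real \<times> real) set" where
  "Omega_full q = {(x, y). \<exists>M N. \<exists>a \<in> Aq_term q M N.
     regular q N (right_digits a) \<and> x = cf q N (right_digits a) \<and>
     dual_regular q M (left_digits a) \<and> y = cf q M (left_digits a)}"

definition reg_inf_values :: "nat \<Rightarrow> real set" where
  "reg_inf_values q = {cf q \<infinity> d |d. regular q \<infinity> d}"

definition dual_inf_values :: "nat \<Rightarrow> real set" where
  "dual_inf_values q = {cf q \<infinity> d |d. dual_regular q \<infinity> d}"

end

(* Proof idea. A pair (x, y) is moved by the map (x, y) -> (x', -1/(a lam + y)), where
   x = -1/(a lam + x'), so one digit a passes from the right half of the sequence to the left half.
   The union D of rectangles is mapped into itself by every such step with |x'| <= lam/2, because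
   the step carries the boundary points phi and psi to each other; and, conversely, every point of D
   with y <> 0 has a preimage in D. A word is regular as soon as all its tails lie in
   [-lam/2, lam/2], and regular words have all their tails there. Starting from (x, 0) and moving
   digits to the left, the forward invariance puts every pair of a two-sided word into D, first for
   finite words and then by closedness for infinite ones. Backward orbits in D and nearest-integer
   expansions realize every point of D. An infinite regular expansion never takes a value phi_j, and
   an infinite expansion never has the value of a finite one, which gives the statements on Pi_2 and
   on infinite sequences. *)

theory Submission
  imports Defs
begin

section \<open>The points of the partition\<close>

text \<open>The numbers \<open>Rq\<close> and \<open>psi\<close> are limits, and the bounds that
  make these limits exist come out of the very domain whose corners they are. The circle is broken
  by algebraic closed forms \<open>Rc\<close> and \<open>psc\<close>: the domain, its invariance and
  the bounds for finite words use only these, and once convergence is available the limits are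
  identified with them. The closed forms make up one orbit under t -> -1/t - lam for even q and two
  interleaved orbits for odd q, so that a digit 1 shifts the index of a rectangle by one or by two;
  a digit 2 or 3 leads from the end of an orbit back to its beginning, and \<open>Rc\<close> is the
  number for which the orbits close up in this way. Two further obstacles: for even q one has
  \<open>Rc q = 1\<close>, so that a single step need not contract and convergence has to be drawn
  from pairs of steps; and neighbouring closed rectangles share boundary points, at which the
  smaller of the two fibres can be claimed only because infinite expansions avoid these
  points.\<close>

text \<open>The values \<open>sn q k\<close> at integers satisfy the recurrence of the entries of the powers of
  \<open>t \<mapsto> - 1 / (lam q + t)\<close>; real arguments avoid truncated subtraction at \<open>k = 0\<close>.\<close>

definition sn :: "nat \<Rightarrow> real \<Rightarrow> real" where
  "sn q x = sin (x * pi / real q) / sin (pi / real q)"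

lemma sin_pi_div_pos: "3 \<le> q \<Longrightarrow> 0 < sin (pi / real q)"
  by (rule sin_gt_zero) (auto simp: field_simps)

lemma sn_0 [simp]: "sn q 0 = 0"
  by (simp add: sn_def)

lemma sn_1: "3 \<le> q \<Longrightarrow> sn q 1 = 1"
  using sin_pi_div_pos[of q] by (simp add: sn_def)

lemma sn_rec: "sn q (x + 1) + sn q (x - 1) = lam q * sn q x"
proof -
  have "sin ((x + 1) * pi / q) + sin ((x - 1) * pi / q) = 2 * sin (x * pi / q) * cos (pi / q)"
    by (simp add: ring_distribs add_divide_distrib diff_divide_distrib sin_add sin_diff)
  then show ?thesis
    by (simp add: sn_def lam_def flip: add_divide_distrib)
qed

lemma sn_sym: "3 \<le> q \<Longrightarrow> sn q (real q - x) = sn q x"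
proof -
  assume "3 \<le> q"
  then have "(real q - x) * pi / q = pi - x * pi / q"
    by (simp add: field_simps)
  then show ?thesis
    by (simp add: sn_def)
qed

lemma sn_strict_mono:
  assumes "3 \<le> q" "0 \<le> x" "x < y" "2 * y \<le> real q"
  shows "sn q x < sn q y"
proof -
  have "sin (x * pi / q) < sin (y * pi / q)"
  proof (rule sin_monotone_2pi)
    have "0 \<le> x * pi / q" using assms by simp
    then show "- (pi / 2) \<le> x * pi / q"
      using pi_gt_zero by linarith
    show "x * pi / q < y * pi / q"
      using assms by (simp add: field_simps)
    show "y * pi / q \<le> pi / 2"
      using assms by (simp add: field_simps)
  qed
  then show ?thesis
    using sin_pi_div_pos[OF assms(1)] by (simp add: sn_def divide_strict_right_mono)
qed

lemma sn_pos:
  assumes "3 \<le> q" "0 < x" "x < real q"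
  shows "0 < sn q x"
proof -
  have "0 < sin (x * pi / q)"
    using assms by (intro sin_gt_zero) (auto simp: field_simps)
  then show ?thesis
    using sin_pi_div_pos[OF assms(1)] by (simp add: sn_def)
qed

lemma lam_less_2:
  assumes "3 \<le> q" shows "lam q < 2"
proof -
  have "cos (pi / q) < cos 0"
    using assms by (intro cos_monotone_0_pi) (auto simp: field_simps)
  then show ?thesis by (simp add: lam_def)
qed

lemma lam_ge_1:
  assumes "3 \<le> q" shows "1 \<le> lam q"
proof -
  have "cos (pi / 3) \<le> cos (pi / q)"
    using assms by (intro cos_monotone_0_pi_le) (auto simp: field_simps)
  then show ?thesis by (simp add: lam_def cos_60)
qed

lemma lam_sq_ge_2:
  assumes "4 \<le> q" shows "2 \<le> lam q * lam q" "1 < lam q"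
proof -
  have "cos (pi / 4) \<le> cos (pi / q)"
    using assms by (intro cos_monotone_0_pi_le) (auto simp: field_simps)
  then have *: "sqrt 2 \<le> lam q" by (simp add: lam_def cos_45)
  then have "sqrt 2 * sqrt 2 \<le> lam q * lam q" by (intro mult_mono) (auto intro: order_trans[OF _ *])
  then show "2 \<le> lam q * lam q" by simp
  have "1 < sqrt 2" by simp
  then show "1 < lam q" using * by linarith
qed

lemma lam_3: "lam 3 = 1"
  by (simp add: lam_def cos_60)

lemma even_hq: "3 \<le> q \<Longrightarrow> even q \<Longrightarrow> q = 2 * hq q + 2 \<and> 1 \<le> hq q \<and> kappa q = hq q"
  unfolding hq_def kappa_def by presburger

lemma odd_hq: "3 \<le> q \<Longrightarrow> odd q \<Longrightarrow> q = 2 * hq q + 3 \<and> kappa q = 2 * hq q + 1"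
  unfolding hq_def kappa_def by presburger

text \<open>The ratio of consecutive values of \<open>sn\<close> reproduces itself under a digit 1
  because of the three-term recurrence; the condition on k keeps the denominators positive.\<close>

lemma cf_list_ones:
  assumes "3 \<le> q" "k + 1 < q"
  shows "cf_list q (replicate k 1) = - sn q k / sn q (k + 1)"
  using assms(2)
proof (induction k)
  case (Suc k)
  have p: "0 < sn q (real k + 1)" "0 < sn q (real k + 2)"
    using assms(1) Suc.prems by (auto intro!: sn_pos)
  have "lam q + cf_list q (replicate k 1) = (lam q * sn q (k + 1) - sn q k) / sn q (k + 1)"
    using Suc p by (simp add: field_simps)
  also have "lam q * sn q (k + 1) - sn q k = sn q (k + 2)"
    using sn_rec[of q "k + 1"] by (simp add: algebra_simps)
  finally show ?case
    using p by (simp add: algebra_simps)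
qed simp

text \<open>Closed form of \<open>Rq\<close>; for odd \<open>q\<close> it is the positive root of \<open>R\<^sup>2 + (2 - lam q) R = 1\<close>.\<close>

definition Rc :: "nat \<Rightarrow> real" where
  "Rc q = (if even q then 1 else (lam q - 2 + sqrt ((2 - lam q)\<^sup>2 + 4)) / 2)"

lemma Rc_odd: "odd q \<Longrightarrow> Rc q * Rc q + (2 - lam q) * Rc q = 1"
proof -
  assume o: "odd q"
  define w where "w = sqrt ((2 - lam q)\<^sup>2 + 4)"
  have "w * w = (2 - lam q)\<^sup>2 + 4"
    by (simp add: w_def)
  then show ?thesis
    using o unfolding Rc_def w_def[symmetric] by (simp add: field_simps power2_eq_square)
qed

lemma Rc_bounds:
  assumes "3 \<le> q"
  shows "lam q / 2 < Rc q" "Rc q \<le> 1" "odd q \<Longrightarrow> Rc q < 1" "Rc q < lam q"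
proof -
  note l = lam_less_2[OF assms] lam_ge_1[OF assms]
  have *: "lam q / 2 < Rc q \<and> Rc q < 1" if o: "odd q"
  proof -
    have "(2 - lam q) ^ 2 + 4 < (4 - lam q)^2"
      using l by (simp add: power2_eq_square algebra_simps)
    then have "sqrt ((2 - lam q) ^ 2 + 4) < 4 - lam q"
      using l by (intro real_less_lsqrt) auto
    moreover have "2 < sqrt ((2 - lam q) ^ 2 + 4)"
      using l by (intro real_less_rsqrt) auto
    ultimately show ?thesis using o l by (simp add: Rc_def)
  qed
  show "lam q / 2 < Rc q" "Rc q \<le> 1" "odd q \<Longrightarrow> Rc q < 1"
    using * l by (auto simp: Rc_def)
  show "Rc q < lam q"
  proof (cases "even q")
    case True
    then have "4 \<le> q" using assms by presburger
    then show ?thesis using lam_sq_ge_2(2)[of q] True by (simp add: Rc_def)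
  qed (use * l in fastforce)
qed

text \<open>The solution of u(x) + u(x+2) = lam u(x+1) with u(0) = 1 and u(1) = Rc, so that its
  first ratio -u(1)/u(0) is -Rc.\<close>

definition ec :: "nat \<Rightarrow> real \<Rightarrow> real" where
  "ec q x = sn q x * Rc q - sn q (x - 1)"

text \<open>The solution of the same recurrence with values 1 and lam - Rc at 0 and 1, so that its
  first ratio is Rc - lam.\<close>

definition fc :: "nat \<Rightarrow> real \<Rightarrow> real" where
  "fc q x = sn q (x + 1) - sn q x * Rc q"

lemma ec_rec: "lam q * ec q (x + 1) - ec q (x + 2) = ec q x"
proof -
  have "sn q (x + 2) = lam q * sn q (x + 1) - sn q x" "sn q (x - 1) = lam q * sn q x - sn q (x + 1)"
       "x + 1 - 1 = x" "x + 2 - 1 = x + 1"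
    using sn_rec[of q "x + 1"] sn_rec[of q x] by (simp_all add: add.commute)
  then show ?thesis
    unfolding ec_def by (simp only:) (simp add: algebra_simps)
qed

lemma fc_rec: "lam q * fc q (x + 1) - fc q (x + 2) = fc q x"
proof -
  have "sn q (x + 3) = lam q * sn q (x + 2) - sn q (x + 1)" "sn q x = lam q * sn q (x + 1) - sn q (x + 2)"
       "x + 1 + 1 = x + 2" "x + 2 + 1 = x + 3"
    using sn_rec[of q "x + 1"] sn_rec[of q "x + 2"] by (simp_all add: add.commute)
  then show ?thesis
    unfolding fc_def by (simp only:) (simp add: algebra_simps)
qed

text \<open>Closed form of \<open>psi\<close>: the orbit of \<open>- Rc q\<close> (and, for odd \<open>q\<close>, also that of \<open>Rc q - lam q\<close>)
  under \<open>t \<mapsto> - 1 / t - lam q\<close>, so that no limit is involved.\<close>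

definition psc :: "nat \<Rightarrow> nat \<Rightarrow> real" where
  "psc q j = (if even q then - ec q (j + 1) / ec q j
     else if even j then - ec q (j div 2 + 1) / ec q (j div 2)
     else - fc q (j div 2 + 1) / fc q (j div 2))"


text \<open>For even q the axis q/2 = h + 1 of the reflection is an integer, so its two neighbours
  have equal values and the recurrence halves their sum.\<close>

lemma sn_even_mid:
  assumes "3 \<le> q" "even q"
  shows "sn q (hq q) = lam q / 2 * sn q (hq q + 1)" "0 < sn q (hq q + 1)"
proof -
  have "real q - real (hq q) = real (hq q) + 2"
    using even_hq[OF assms] by linarith
  then have "sn q (real (hq q) + 2) = sn q (hq q)"
    using sn_sym[OF assms(1), of "hq q"] by metis
  then show "sn q (hq q) = lam q / 2 * sn q (hq q + 1)"
    using sn_rec[of q "hq q + 1"] by (simp add: add.commute)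
  show "0 < sn q (hq q + 1)"
    using even_hq[OF assms] assms(1) by (intro sn_pos) auto
qed

text \<open>For odd q the axis h + 3/2 lies between two integers, whose values therefore agree; the
  recurrence then produces the factor lam - 1.\<close>

lemma sn_odd_mid:
  assumes "3 \<le> q" "odd q"
  shows "sn q (hq q + 2) = sn q (hq q + 1)" "sn q (hq q) = (lam q - 1) * sn q (hq q + 1)"
    "0 < sn q (hq q + 1)"
proof -
  have "real q - real (hq q + 1) = real (hq q + 2)"
    using odd_hq[OF assms] by linarith
  then show *: "sn q (hq q + 2) = sn q (hq q + 1)"
    using sn_sym[OF assms(1), of "hq q + 1"] by metis
  then show "sn q (hq q) = (lam q - 1) * sn q (hq q + 1)"
    using sn_rec[of q "hq q + 1"] by (simp add: algebra_simps)
  show "0 < sn q (hq q + 1)"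
    using odd_hq[OF assms] assms(1) by (intro sn_pos) auto
qed

section \<open>Recursion, sign and order of the points phi\<close>

lemma phi_even: "even q \<Longrightarrow> phi q j = cf_list q (replicate (hq q - j) 1)"
  by (auto simp: phi_def)

lemma phi_odd_even_index:
  assumes "odd q" "2 * i \<le> kappa q"
  shows "phi q (2 * i) = cf_list q (replicate (hq q - i) 1 @ 2 # replicate (hq q) 1)"
  using assms by (auto simp: phi_def hq_def lam_3 kappa_def)

lemma phi_odd_odd_index: "odd q \<Longrightarrow> phi q (2 * i + 1) = cf_list q (replicate (hq q - i) 1)"
  by (auto simp: phi_def hq_def)

lemma phi_kappa: "3 \<le> q \<Longrightarrow> phi q (kappa q) = 0"
  using even_hq[of q] odd_hq[of q] phi_odd_odd_index[of q "hq q"] phi_even[of q "hq q"]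
  by (cases "even q") auto

lemma phi_rec_even:
  assumes "3 \<le> q" "even q" "j < kappa q"
  shows "phi q j = - 1 / (lam q + phi q (j + 1))"
proof -
  have "hq q - j = Suc (hq q - (j + 1))" using even_hq assms by simp
  then show ?thesis using assms by (simp add: phi_even)
qed

lemma phi_rec_odd:
  assumes "3 \<le> q" "odd q" "j + 2 \<le> kappa q"
  shows "phi q j = - 1 / (lam q + phi q (j + 2))"
proof -
  have h: "hq q - j div 2 = Suc (hq q - (j div 2 + 1))"
    using odd_hq assms by fastforce
  show ?thesis
  proof (cases "even j")
    case True
    then show ?thesis
      using assms(2,3) h phi_odd_even_index[of q "j div 2"] phi_odd_even_index[of q "j div 2 + 1"]
      by simp
  next
    case False
    then have "2 * (j div 2) + 1 = j" "2 * (j div 2 + 1) + 1 = j + 2" by presburger+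
    then show ?thesis
      using assms(2) h phi_odd_odd_index[of q "j div 2"] phi_odd_odd_index[of q "j div 2 + 1"]
      by simp
  qed
qed

lemma phi_odd_penultimate:
  assumes "3 \<le> q" "odd q"
  shows "phi q (kappa q - 1) = - 1 / (2 * lam q + phi q 1)"
  using odd_hq[OF assms] phi_odd_even_index[OF assms(2), of "hq q"] phi_odd_odd_index[OF assms(2), of 0]
  by simp

lemma phi_odd_1:
  assumes "3 \<le> q" "odd q"
  shows "phi q 1 = 1 - lam q"
proof -
  have "phi q 1 = - sn q (hq q) / sn q (hq q + 1)"
    using phi_odd_odd_index[OF assms(2), of 0] cf_list_ones[OF assms(1), of "hq q"] odd_hq[OF assms]
    by simp
  then show ?thesis
    using sn_odd_mid[OF assms] by simp
qed

text \<open>Sums of two consecutive values of \<open>sn\<close> satisfy the recurrence of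
  \<open>sn\<close>. The start k = 0 is [0; 2, 1^h] = -1/(1 + lam), which rests on [0; 1^h] = 1 -
  lam.\<close>

lemma cf_list_ones_two_ones:
  assumes "3 \<le> q" "odd q" "k \<le> hq q"
  shows "cf_list q (replicate k 1 @ 2 # replicate (hq q) 1) =
    - (sn q k + sn q (k + 1)) / (sn q (k + 1) + sn q (k + 2))"
  using assms(3)
proof (induction k)
  case 0
  have "2 * lam q + phi q 1 = 1 + lam q"
    using phi_odd_1[OF assms(1,2)] by simp
  moreover have "sn q 2 = lam q"
    using sn_rec[of q 1] sn_1[OF assms(1)] by simp
  ultimately show ?case
    using sn_1[OF assms(1)] phi_odd_odd_index[OF assms(2), of 0] by simp
next
  case (Suc k)
  have p: "0 < sn q (real k + 1)" "0 < sn q (real k + 2)" "0 < sn q (real k + 3)"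
    using assms Suc.prems odd_hq[OF assms(1,2)] by (auto intro!: sn_pos)
  have "lam q * sn q (real k + 1) + lam q * sn q (real k + 2)
      = sn q k + sn q (real k + 1) + (sn q (real k + 2) + sn q (real k + 3))"
    using sn_rec[of q "k + 1"] sn_rec[of q "k + 2"] by (simp add: add.commute)
  then have "lam q + cf_list q (replicate k 1 @ 2 # replicate (hq q) 1) =
      (sn q (real k + 2) + sn q (real k + 3)) / (sn q (real k + 1) + sn q (real k + 2))"
    using Suc p by (simp add: field_simps)
  then show ?case
    using p by (simp add: algebra_simps)
qed

text \<open>The symmetry of \<open>sn\<close> about q/2 turns the ratio for the longest word into
  -lam/2. This ties the lengths of the forbidden blocks to the interval [-lam/2, lam/2].\<close>

lemma phi_0:
  assumes "3 \<le> q"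
  shows "phi q 0 = - lam q / 2"
proof (cases "even q")
  case True
  have "hq q + 1 < q" using even_hq[OF assms True] by linarith
  then show ?thesis
    using True cf_list_ones[OF assms, of "hq q"] sn_even_mid[OF assms True]
    by (simp add: phi_even)
next
  case False
  have "phi q 0 = - (sn q (hq q) + sn q (hq q + 1)) / (sn q (hq q + 1) + sn q (hq q + 2))"
    using phi_odd_even_index[OF False, of 0] cf_list_ones_two_ones[OF assms False, of "hq q"] by simp
  also have "\<dots> = - (lam q * sn q (hq q + 1)) / (2 * sn q (hq q + 1))"
    unfolding sn_odd_mid[OF assms False] by (simp add: algebra_simps)
  also have "\<dots> = - lam q / 2"
    using sn_odd_mid(3)[OF assms False] by simp
  finally show ?thesis .
qed

lemma phi_neg:
  assumes "3 \<le> q" "j < kappa q"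
  shows "phi q j < 0"
proof -
  have ones: "cf_list q (replicate k 1) < 0" if "0 < k" "k + 1 < q" for k
  proof -
    have "0 < sn q k" "0 < sn q (k + 1)"
      using that assms(1) by (auto intro!: sn_pos)
    then show ?thesis using cf_list_ones[OF assms(1) that(2)] by (simp add: divide_neg_pos)
  qed
  consider "even q" | "odd q" "even j" | "odd q" "odd j" by blast
  then show ?thesis
  proof cases
    case 1
    have "hq q - j + 1 < q" using even_hq[OF assms(1) 1] by linarith
    then show ?thesis
      using 1 assms even_hq[OF assms(1) 1] ones[of "hq q - j"] by (simp add: phi_even)
  next
    case 2
    define k where "k = hq q - j div 2"
    have "k \<le> hq q" by (simp add: k_def)
    moreover have "0 \<le> sn q k"
      using assms(1) \<open>k \<le> hq q\<close> odd_hq[OF assms(1) 2(1)]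
      by (cases "k = 0") (auto intro!: less_imp_le[OF sn_pos])
    moreover have "0 < sn q (k + 1)" "0 < sn q (k + 2)"
      using assms(1) \<open>k \<le> hq q\<close> odd_hq[OF assms(1) 2(1)] by (auto intro!: sn_pos)
    ultimately show ?thesis
      using phi_odd_even_index[OF 2(1), of "j div 2"] cf_list_ones_two_ones[OF assms(1) 2(1), of k] 2(2) assms(2)
      by (simp add: k_def[symmetric] divide_neg_pos)
  next
    case 3
    then have "2 * (j div 2) + 1 = j" by presburger
    then show ?thesis
      using phi_odd_odd_index[OF 3(1), of "j div 2"] ones[of "hq q - j div 2"]
        odd_hq[OF assms(1) 3(1)] assms(2) by fastforce
  qed
qed

lemma eq_neg_inverse_imp: "x = - 1 / (l + y) \<Longrightarrow> y = - 1 / x - (l::real)"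
  by (cases "l + y = 0") auto

lemma neg_inverse_less: "x < y \<Longrightarrow> y < 0 \<Longrightarrow> - 1 / x < - 1 / (y::real)"
  by (simp add: divide_simps)

text \<open>The map t -> -1/t - lam increases on the negative reals and raises the index by one or
  two, so the order propagates from the first one or two inequalities; these hold because lam <
  2.\<close>

lemma phi_step_less:
  assumes "3 \<le> q" "j < kappa q"
  shows "phi q j < phi q (j + 1)"
proof -
  note l = lam_less_2[OF assms(1)] lam_ge_1[OF assms(1)]
  have b: "- lam q / 2 < - 1 / phi q 0 - lam q"
    using l mult_strict_mono[of "lam q" 2 "lam q" 2] by (simp add: phi_0[OF assms(1)] field_simps)
  consider "even q" | "odd q" by blast
  then show ?thesis
    using assms(2)
  proof cases
    case 1
    have r: "phi q (j + 1) = - 1 / phi q j - lam q" if "j < kappa q" for j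
      using phi_rec_even[OF assms(1) 1 that] phi_neg[OF assms(1) that] by (simp add: eq_neg_inverse_imp)
    show ?thesis using assms(2)
    proof (induction j)
      case 0
      then show ?case using b r[of 0] phi_0[OF assms(1)] by simp
    next
      case (Suc j)
      then show ?case
        using r[of j] r[of "Suc j"] neg_inverse_less[of "phi q j" "phi q (Suc j)"]
          phi_neg[OF assms(1), of "Suc j"] by simp
    qed
  next
    case 2
    have r: "phi q (j + 2) = - 1 / phi q j - lam q" if "j + 2 \<le> kappa q" for j
      using phi_rec_odd[OF assms(1) 2 that] phi_neg[OF assms(1), of j] that by (simp add: eq_neg_inverse_imp)
    show ?thesis using assms(2)
    proof (induction j rule: less_induct)
      case (less j)
      consider "j = 0" | "j = 1" | i where "j = i + 2"
        by (metis One_nat_def add_2_eq_Suc' not0_implies_Suc)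
      then show ?case
      proof cases
        case 1
        then show ?thesis using l phi_0[OF assms(1)] phi_odd_1[OF assms(1) 2] by simp
      next
        case j: 2
        have "1 - lam q < - 1 / phi q 0 - lam q"
          using l by (simp add: phi_0[OF assms(1)] field_simps)
        then show ?thesis using j r[of 0] less.prems phi_odd_1[OF assms(1) 2]
          by (simp add: numeral_2_eq_2)
      next
        case (3 i)
        then show ?thesis
          using r[of i] r[of "i + 1"] less neg_inverse_less[of "phi q i" "phi q (i + 1)"]
            phi_neg[OF assms(1), of "i + 1"] by simp
      qed
    qed
  qed
qed

lemma phi_less: "3 \<le> q \<Longrightarrow> i < j \<Longrightarrow> j \<le> kappa q \<Longrightarrow> phi q i < phi q j"
proof (induction j)
  case (Suc j)
  then show ?case
    using phi_step_less[of q j] by (cases "i = j") auto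
qed simp

lemma phi_le: "3 \<le> q \<Longrightarrow> i \<le> j \<Longrightarrow> j \<le> kappa q \<Longrightarrow> phi q i \<le> phi q j"
  using phi_less[of q i j] by (cases "i = j") auto

section \<open>Recursion, sign and order of the closed forms of psi\<close>

lemma ec_pos:
  assumes "3 \<le> q" "i \<le> hq q + 1"
  shows "0 < ec q i"
proof (cases "i = 0")
  case True
  have "sn q (- 1) = - 1"
    using sn_1[OF assms(1)] by (simp add: sn_def)
  then show ?thesis using True by (simp add: ec_def)
next
  case False
  show ?thesis
  proof (cases "even q")
    case True
    then have "sn q (real i - 1) < sn q i"
      using even_hq[OF assms(1) True] assms False by (intro sn_strict_mono) auto
    then show ?thesis using True by (simp add: ec_def Rc_def)
  next
    case o: False
    have p: "0 < sn q i"
      using odd_hq[OF assms(1) o] assms False by (intro sn_pos) auto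
    \<comment> \<open>The two neighbours add up to lam times the middle value, so this comparison
      bounds the left neighbour by lam/2 times the middle value, and lam/2 < Rc finishes the odd
      case.\<close>
    have "sn q (real i - 1) < sn q (real i + 1)"
    proof (cases "i \<le> hq q")
      case True
      then show ?thesis
        using odd_hq[OF assms(1) o] assms False by (intro sn_strict_mono) auto
    next
      case f: False
      have "sn q (hq q) < sn q (hq q + 1)"
        using odd_hq[OF assms(1) o] assms by (intro sn_strict_mono) auto
      moreover have "i = hq q + 1" using f assms by simp
      ultimately show ?thesis
        using sn_odd_mid(1)[OF assms(1) o] by (simp add: add.commute)
    qed
    then have "sn q (real i - 1) < lam q / 2 * sn q i"
      using sn_rec[of q i] by simp
    also have "\<dots> < Rc q * sn q i"
      using p Rc_bounds(1)[OF assms(1)] by simp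
    finally show ?thesis by (simp add: ec_def mult.commute)
  qed
qed

text \<open>Up to i = h + 1 the values of \<open>sn\<close> do not decrease from i to i + 1, the
  last step being the equality at the axis of symmetry; Rc < 1 makes the difference
  positive.\<close>

lemma fc_pos:
  assumes "3 \<le> q" "odd q" "i \<le> hq q + 1"
  shows "0 < fc q i"
proof (cases "i = 0")
  case True
  then show ?thesis using sn_1[OF assms(1)] by (simp add: fc_def)
next
  case False
  have p: "0 < sn q i"
    using odd_hq[OF assms(1,2)] assms False by (intro sn_pos) auto
  have "sn q i * Rc q < sn q i * 1"
    using p Rc_bounds(3)[OF assms(1,2)] by (intro mult_strict_left_mono) auto
  also have "sn q i \<le> sn q (i + 1)"
  proof (cases "i \<le> hq q")
    case True
    then show ?thesis
      using odd_hq[OF assms(1,2)] assms by (intro less_imp_le[OF sn_strict_mono]) auto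
  next
    case f: False
    then have "i = hq q + 1" using assms by simp
    then show ?thesis
      using sn_odd_mid(1)[OF assms(1,2)] by (simp add: add.commute)
  qed
  finally show ?thesis by (simp add: fc_def add.commute)
qed

lemma psc_0: "3 \<le> q \<Longrightarrow> psc q 0 = - Rc q"
  using sn_1[of q] by (simp add: psc_def ec_def sn_def)

lemma psc_1: "3 \<le> q \<Longrightarrow> psc q 1 = Rc q - lam q"
proof -
  assume q: "3 \<le> q"
  have "sn q 2 = lam q" using sn_rec[of q 1] sn_1[OF q] by simp
  then show ?thesis
    using sn_1[OF q] by (simp add: psc_def ec_def fc_def Rc_def)
qed

lemma psc_rec_even:
  assumes "3 \<le> q" "even q" "j < kappa q"
  shows "psc q j = - 1 / (lam q + psc q (j + 1))"
proof -
  have "0 < ec q (j + 1)" "0 < ec q j"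
    using ec_pos[OF assms(1), of j] ec_pos[OF assms(1), of "j + 1"] even_hq[OF assms(1,2)] assms(3)
    by auto
  then have "lam q + psc q (j + 1) = ec q j / ec q (j + 1)"
    using ec_rec[of q j] assms(2) by (simp add: psc_def field_simps)
  then show ?thesis using assms(2) by (simp add: psc_def)
qed

lemma psc_rec_odd:
  assumes "3 \<le> q" "odd q" "j + 2 \<le> kappa q"
  shows "psc q j = - 1 / (lam q + psc q (j + 2))"
proof -
  define i where "i = j div 2"
  have i: "(j + 2) div 2 = i + 1" "i + 1 \<le> hq q + 1"
    using odd_hq[OF assms(1,2)] assms(3) by (auto simp: i_def)
  have p: "0 < ec q (i + 1)" "0 < ec q i" "0 < fc q (i + 1)" "0 < fc q i"
    using ec_pos[OF assms(1), of i] ec_pos[OF assms(1), of "i + 1"]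
      fc_pos[OF assms(1,2), of i] fc_pos[OF assms(1,2), of "i + 1"] i by auto
  have "lam q + psc q (j + 2) = (if even j then ec q i / ec q (i + 1) else fc q i / fc q (i + 1))"
    using ec_rec[of q i] fc_rec[of q i] assms(2) p unfolding psc_def i(1)
    by (simp add: field_simps)
  then show ?thesis using assms(2) by (simp add: psc_def i_def)
qed

text \<open>Since Rc = 1, the right side is -1/(2 lam + \<open>psc q 1\<close>): a digit 2 leads
  from the end of the orbit back to index 1.\<close>

lemma psc_even_kappa:
  assumes "3 \<le> q" "even q"
  shows "psc q (kappa q) = - 1 / (lam q + 1)"
proof -
  define h where "h = hq q"
  define s where "s = sn q (h + 1)"
  have s: "0 < s" "sn q h = lam q / 2 * s" using sn_even_mid[OF assms] by (auto simp: s_def h_def)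
  have "sn q (real h - 1) = lam q * (lam q / 2 * s) - s"
    using sn_rec[of q h] s by (simp add: s_def add.commute)
  then have "ec q h = lam q / 2 * s - (lam q * (lam q / 2 * s) - s)" "ec q (h + 1) = s - lam q / 2 * s"
    using s(2) assms(2) by (simp_all add: ec_def Rc_def s_def add.commute)
  note e = this
  have "ec q h = (1 + lam q) * ec q (h + 1)"
    unfolding e by (simp add: field_simps)
  moreover have "0 < ec q (h + 1)" using ec_pos[OF assms(1), of "h + 1"] by (simp add: h_def)
  moreover have "kappa q = h" using even_hq[OF assms] by (simp add: h_def)
  ultimately show ?thesis
    using assms(2) lam_ge_1[OF assms(1)] by (simp add: psc_def add.commute)
qed

text \<open>The right side is -1/(2 lam + \<open>psc q 1\<close>): a digit 2 leads from the even
  indices to the odd ones. The two sides agree exactly when R^2 + (2 - lam) R = 1, which is where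
  the quadratic equation for \<open>Rc\<close> comes from.\<close>

lemma psc_odd_penultimate:
  assumes "3 \<le> q" "odd q"
  shows "psc q (kappa q - 1) = - 1 / (lam q + Rc q)"
proof -
  define h where "h = hq q"
  define s where "s = sn q (h + 1)"
  define R where "R = Rc q"
  have s: "0 < s" "sn q h = (lam q - 1) * s" using sn_odd_mid[OF assms] by (auto simp: s_def h_def)
  have m: "sn q (real h - 1) = lam q * ((lam q - 1) * s) - s"
    using sn_rec[of q h] s by (simp add: s_def add.commute)
  have "ec q (h + 1) * (lam q + R) - ec q h = s * (R * R + (2 - lam q) * R - 1)"
  proof -
    have "ec q h = (lam q - 1) * s * R - (lam q * ((lam q - 1) * s) - s)"
         "ec q (h + 1) = s * R - (lam q - 1) * s"
      using s(2) m by (simp_all add: ec_def R_def s_def add.commute)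
    note e = this
    show ?thesis unfolding e by (simp add: algebra_simps)
  qed
  then have "ec q h = (lam q + R) * ec q (h + 1)"
    using Rc_odd[OF assms(2)] by (simp add: R_def mult.commute)
  moreover have "0 < ec q (h + 1)" using ec_pos[OF assms(1), of "h + 1"] by (simp add: h_def)
  moreover have "kappa q - 1 = 2 * h" using odd_hq[OF assms] by (simp add: h_def)
  ultimately show ?thesis
    using assms(2) by (simp add: psc_def R_def add.commute)
qed

text \<open>Where index 2 exists, 1/Rc = lam + \<open>psc q 2\<close>, and a digit 2 leads from the
  odd indices back to the even ones; the same quadratic equation decides it. For q = 3 one has 1/Rc
  = 1 + Rc instead, and the relation becomes a digit 3 leading to index 1.\<close>

lemma psc_odd_kappa:
  assumes "3 \<le> q" "odd q"
  shows "psc q (kappa q) = - 1 / (lam q + 1 / Rc q)"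
proof -
  define h where "h = hq q"
  define s where "s = sn q (h + 1)"
  define R where "R = Rc q"
  have R: "0 < R" using Rc_bounds(1)[OF assms(1)] lam_ge_1[OF assms(1)] by (simp add: R_def)
  have s: "0 < s" "sn q h = (lam q - 1) * s" "sn q (h + 2) = s"
    using sn_odd_mid[OF assms] by (auto simp: s_def h_def)
  have "fc q (h + 1) * (lam q * R + 1) - fc q h * R = s * (1 - (R * R + (2 - lam q) * R))"
  proof -
    have "fc q h = s - (lam q - 1) * s * R" "fc q (h + 1) = s - s * R"
      using s(2,3) by (simp_all add: fc_def R_def s_def add.commute)
    note e = this
    show ?thesis unfolding e by (simp add: algebra_simps)
  qed
  then have "fc q h * R = (lam q * R + 1) * fc q (h + 1)"
    using Rc_odd[OF assms(2)] by (simp add: R_def mult.commute)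
  moreover have "0 < fc q (h + 1)" "0 < fc q h"
    using fc_pos[OF assms, of "h + 1"] fc_pos[OF assms, of h] by (simp_all add: h_def)
  moreover have "0 < lam q * R + 1"
    using R lam_ge_1[OF assms(1)] by (simp add: add_nonneg_pos)
  ultimately have "fc q (h + 1) / fc q h = R / (lam q * R + 1)"
    by (simp add: field_simps)
  moreover have k: "kappa q = 2 * h + 1" using odd_hq[OF assms] by (simp add: h_def)
  ultimately have "psc q (kappa q) = - (R / (lam q * R + 1))"
    using assms(2) k by (simp add: psc_def add.commute)
  also have "R / (lam q * R + 1) = 1 / (lam q + 1 / R)"
    using R by (simp add: field_simps)
  finally show ?thesis by (simp add: R_def)
qed

lemma psc_neg:
  assumes "3 \<le> q" "j \<le> kappa q"
  shows "psc q j < 0"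
proof (cases "even q")
  case True
  then show ?thesis
    using ec_pos[OF assms(1), of j] ec_pos[OF assms(1), of "j + 1"] even_hq[OF assms(1) True] assms(2)
    by (simp add: psc_def add.commute)
next
  case False
  define i where "i = j div 2"
  have i: "i + 1 \<le> hq q + 1"
    using odd_hq[OF assms(1) False] assms(2) by (auto simp: i_def)
  then show ?thesis
    using ec_pos[OF assms(1), of i] ec_pos[OF assms(1), of "i + 1"]
      fc_pos[OF assms(1) False, of i] fc_pos[OF assms(1) False, of "i + 1"] False
    by (simp add: psc_def i_def[symmetric] add.commute)
qed

text \<open>Propagation as for \<open>phi\<close>. The starting inequalities are lam/2 < Rc for the
  indices 0 and 1 and, for odd q, Rc < 1 for the indices 1 and 2.\<close>

lemma psc_step_less:
  assumes "3 \<le> q" "j < kappa q"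
  shows "psc q j < psc q (j + 1)"
proof -
  note l = lam_less_2[OF assms(1)] lam_ge_1[OF assms(1)]
  note R = Rc_bounds[OF assms(1)]
  have b: "psc q 0 < psc q 1"
    using R l by (simp add: psc_0[OF assms(1)] psc_1[OF assms(1), simplified])
  consider "even q" | "odd q" by blast
  then show ?thesis
    using assms(2)
  proof cases
    case 1
    have r: "psc q (j + 1) = - 1 / psc q j - lam q" if "j < kappa q" for j
      using psc_rec_even[OF assms(1) 1 that] psc_neg[OF assms(1), of j] that by (simp add: eq_neg_inverse_imp)
    show ?thesis using assms(2)
    proof (induction j)
      case 0
      then show ?case using b by simp
    next
      case (Suc j)
      then show ?case
        using r[of j] r[of "Suc j"] neg_inverse_less[of "psc q j" "psc q (Suc j)"]
          psc_neg[OF assms(1), of "Suc j"] by simp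
    qed
  next
    case 2
    have r: "psc q (j + 2) = - 1 / psc q j - lam q" if "j + 2 \<le> kappa q" for j
      using psc_rec_odd[OF assms(1) 2 that] psc_neg[OF assms(1), of j] that by (simp add: eq_neg_inverse_imp)
    show ?thesis using assms(2)
    proof (induction j rule: less_induct)
      case (less j)
      consider "j = 0" | "j = 1" | i where "j = i + 2"
        by (metis One_nat_def add_2_eq_Suc' not0_implies_Suc)
      then show ?case
      proof cases
        case 1
        then show ?thesis using b by simp
      next
        case j: 2
        have "Rc q * Rc q < 1 * 1"
          using R l 2 by (intro mult_strict_mono) auto
        then have "Rc q < 1 / Rc q"
          using R(1) l by (simp add: field_simps)
        then show ?thesis
          using j r[of 0] less.prems psc_0[OF assms(1)] psc_1[OF assms(1)]
          by (simp add: numeral_2_eq_2)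
      next
        case (3 i)
        then show ?thesis
          using r[of i] r[of "i + 1"] less neg_inverse_less[of "psc q i" "psc q (i + 1)"]
            psc_neg[OF assms(1), of "i + 1"] by simp
      qed
    qed
  qed
qed

lemma psc_less: "3 \<le> q \<Longrightarrow> i < j \<Longrightarrow> j \<le> kappa q \<Longrightarrow> psc q i < psc q j"
proof (induction j)
  case (Suc j)
  then show ?case
    using psc_step_less[of q j] by (cases "i = j") auto
qed simp

lemma psc_le: "3 \<le> q \<Longrightarrow> i \<le> j \<Longrightarrow> j \<le> kappa q \<Longrightarrow> psc q i \<le> psc q j"
  using psc_less[of q i j] by (cases "i = j") auto

section \<open>The domain and its invariance\<close>

text \<open>The half over x \<le> 0. As the index of \<open>psc\<close> falls with i, the fibres
  grow from left to right.\<close>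

definition negD :: "nat \<Rightarrow> (real \<times> real) set" where
  "negD q = {(x, y). \<exists>i\<in>{1..kappa q}. phi q (i - 1) \<le> x \<and> x \<le> phi q i \<and>
     psc q (kappa q - i + 1) \<le> y \<and> y \<le> Rc q}"

definition Dc :: "nat \<Rightarrow> (real \<times> real) set" where
  "Dc q = {(x, y). (x, y) \<in> negD q \<or> (- x, - y) \<in> negD q}"

lemma negDI:
  "\<lbrakk>1 \<le> i; i \<le> kappa q; phi q (i - 1) \<le> x; x \<le> phi q i; psc q (kappa q - i + 1) \<le> y; y \<le> Rc q\<rbrakk>
    \<Longrightarrow> (x, y) \<in> negD q"
  by (auto simp: negD_def)

lemma negDE:
  assumes "(x, y) \<in> negD q"
  obtains i where "1 \<le> i" "i \<le> kappa q" "phi q (i - 1) \<le> x" "x \<le> phi q i"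
    "psc q (kappa q - i + 1) \<le> y" "y \<le> Rc q"
  using assms by (auto simp: negD_def)

lemma kappa_ge_1: "3 \<le> q \<Longrightarrow> 1 \<le> kappa q"
  using even_hq[of q] odd_hq[of q] by (cases "even q") auto

lemma phi_bounds:
  assumes "3 \<le> q" "j \<le> kappa q"
  shows "- lam q / 2 \<le> phi q j" "phi q j \<le> 0"
  using phi_le[OF assms(1), of 0 j] phi_le[OF assms(1), of j "kappa q"] assms
  by (auto simp: phi_0 phi_kappa)

lemma psc_ge: "3 \<le> q \<Longrightarrow> j \<le> kappa q \<Longrightarrow> - Rc q \<le> psc q j"
  using psc_le[of q 0 j] by (simp add: psc_0)

text \<open>The bound Rc - lam is \<open>psc q 1\<close>, the lowest corner over x \<le> 0. It keeps
  a lam + y positive for a \<ge> 1 and confines y to an interval of length lam, which is what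
  determines digits later.\<close>

lemma negD_bounds:
  assumes "3 \<le> q" "(x, y) \<in> negD q"
  shows "- lam q / 2 \<le> x" "x \<le> 0" "Rc q - lam q \<le> y" "- Rc q \<le> y" "y \<le> Rc q"
proof -
  from assms(2) obtain i where i: "1 \<le> i" "i \<le> kappa q" "phi q (i - 1) \<le> x" "x \<le> phi q i"
    "psc q (kappa q - i + 1) \<le> y" "y \<le> Rc q" by (rule negDE)
  show "- lam q / 2 \<le> x" "x \<le> 0" "y \<le> Rc q"
    using phi_bounds[OF assms(1) i(2)] phi_bounds[OF assms(1) le_trans[OF diff_le_self i(2)], of 1] i
    by auto
  have k: "kappa q - i + 1 \<le> kappa q" using i by simp
  show "Rc q - lam q \<le> y"
    using k psc_le[OF assms(1), of 1 "kappa q - i + 1"] i psc_1[OF assms(1)] by auto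
  show "- Rc q \<le> y"
    using k psc_ge[OF assms(1), of "kappa q - i + 1"] i by auto
qed

lemma Dc_bounds:
  assumes "3 \<le> q" "(x, y) \<in> Dc q"
  shows "\<bar>x\<bar> \<le> lam q / 2" "\<bar>y\<bar> \<le> Rc q"
proof -
  have l: "0 < lam q" using lam_ge_1[OF assms(1)] by simp
  show "\<bar>x\<bar> \<le> lam q / 2" "\<bar>y\<bar> \<le> Rc q"
    using l assms(2) negD_bounds[OF assms(1), of x y] negD_bounds[OF assms(1), of "- x" "- y"]
    unfolding Dc_def by (auto simp: abs_le_iff)
qed

lemma Dc_uminus: "(- x, - y) \<in> Dc q \<longleftrightarrow> (x, y) \<in> Dc q"
  by (auto simp: Dc_def)

lemma Dc_negD: "3 \<le> q \<Longrightarrow> (x, y) \<in> Dc q \<Longrightarrow> x < 0 \<Longrightarrow> (x, y) \<in> negD q"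
  using negD_bounds(2)[of q "- x" "- y"] by (auto simp: Dc_def)

lemma phi_locate:
  assumes "3 \<le> q" "- lam q / 2 \<le> x" "x \<le> 0"
  obtains i where "1 \<le> i" "i \<le> kappa q" "phi q (i - 1) \<le> x" "x \<le> phi q i"
proof -
  define i where "i = (LEAST i. x \<le> phi q i)"
  have ex: "x \<le> phi q (kappa q)" using assms by (simp add: phi_kappa)
  have i: "x \<le> phi q i" "i \<le> kappa q"
    unfolding i_def using LeastI[of "\<lambda>i. x \<le> phi q i", OF ex] Least_le[of "\<lambda>i. x \<le> phi q i", OF ex] by auto
  show ?thesis
  proof (cases "i = 0")
    case True
    then show ?thesis
      using that[of 1] i kappa_ge_1[OF assms(1)] phi_le[OF assms(1), of 0 1] assms
      by (auto simp: phi_0)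
  next
    case False
    then have "\<not> x \<le> phi q (i - 1)"
      unfolding i_def by (intro not_less_Least) (auto simp: i_def)
    then show ?thesis using that[of i] i False by auto
  qed
qed

text \<open>The fibre over the first interval is the smallest one, so its lower end is admissible
  over every x of the left half.\<close>

lemma negD_left:
  assumes "3 \<le> q" "- lam q / 2 \<le> x" "x \<le> 0" "psc q (kappa q) \<le> y" "y \<le> Rc q"
  shows "(x, y) \<in> negD q"
proof -
  obtain i where i: "1 \<le> i" "i \<le> kappa q" "phi q (i - 1) \<le> x" "x \<le> phi q i"
    using phi_locate assms by blast
  then have "psc q (kappa q - i + 1) \<le> psc q (kappa q)"
    by (intro psc_le assms) auto
  then show ?thesis using i assms by (intro negDI) auto
qed

lemma negD_Dc: "(x, y) \<in> negD q \<Longrightarrow> (x, y) \<in> Dc q"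
  by (simp add: Dc_def)

text \<open>After reflection y becomes nonnegative and thus lies above every
  \<open>psc\<close>.\<close>

lemma Dc_right:
  assumes "3 \<le> q" "0 \<le> x" "x \<le> lam q / 2" "- Rc q \<le> y" "y \<le> 0"
  shows "(x, y) \<in> Dc q"
  using negD_left[of q "- x" "- y"] psc_neg[OF assms(1), of "kappa q"] assms by (simp add: Dc_def)

lemma Dc_zero:
  assumes "3 \<le> q" "\<bar>x\<bar> \<le> lam q / 2"
  shows "(x, 0) \<in> Dc q"
proof -
  have r: "0 < Rc q" using Rc_bounds(1)[OF assms(1)] lam_ge_1[OF assms(1)] by simp
  show ?thesis
  proof (cases "0 \<le> x")
    case True
    then show ?thesis using assms r by (intro Dc_right) auto
  next
    case False
    then have "(x, 0) \<in> negD q"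
      using assms r psc_neg[OF assms(1), of "kappa q"] by (intro negD_left) auto
    then show ?thesis by (rule negD_Dc)
  qed
qed

section \<open>Forward invariance of the domain\<close>

lemma neg_inverse_le_iff: "0 < u \<Longrightarrow> 0 < v \<Longrightarrow> - 1 / u \<le> - 1 / v \<longleftrightarrow> u \<le> (v::real)"
  by (simp add: field_simps)

lemma lam_phi_pos: "3 \<le> q \<Longrightarrow> j \<le> kappa q \<Longrightarrow> 0 < lam q + phi q j"
  using phi_bounds[of q j] lam_ge_1[of q] by simp

lemma lam_psc_pos: "3 \<le> q \<Longrightarrow> j \<le> kappa q \<Longrightarrow> 0 < lam q + psc q j"
  using psc_ge[of q j] Rc_bounds(4)[of q] by simp

lemma mult_lam_ge: "3 \<le> q \<Longrightarrow> n \<le> a \<Longrightarrow> of_int n * lam q \<le> of_int a * lam q"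
  using lam_ge_1[of q] by (intro mult_right_mono) auto

text \<open>For a = 1 the recursions of \<open>phi\<close> and \<open>psc\<close> move rectangle i
  to rectangle i + 1, and the last rectangle to x \<ge> 0, where every y in [-Rc, 0] is allowed. For
  a \<ge> 2 the new y is so close to 0 that it reaches even the largest lower end.\<close>

lemma Dc_forward_pos_even:
  assumes q: "3 \<le> q" "even q" and a: "1 \<le> a" and x: "\<bar>x\<bar> \<le> lam q / 2"
    and D: "(- 1 / (of_int a * lam q + x), y) \<in> negD q"
  shows "(x, - 1 / (of_int a * lam q + y)) \<in> Dc q"
proof -
  note l = lam_ge_1[OF q(1)]
  have R: "Rc q = 1" using q by (simp add: Rc_def)
  define K where "K = kappa q"
  from D obtain i where i: "1 \<le> i" "i \<le> K" "phi q (i - 1) \<le> - 1 / (of_int a * lam q + x)"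
    "- 1 / (of_int a * lam q + x) \<le> phi q i" "psc q (K - i + 1) \<le> y" "y \<le> Rc q"
    unfolding K_def by (rule negDE)
  note yb = negD_bounds[OF q(1) D]
  have al: "lam q \<le> of_int a * lam q" using mult_lam_ge[OF q(1) a] by simp
  have pos: "0 < of_int a * lam q + x" "0 < of_int a * lam q + y"
    using al yb x l R by linarith+
  have y0: "- 1 / (of_int a * lam q + y) \<le> 0" using pos by simp
  then have yR: "- 1 / (of_int a * lam q + y) \<le> Rc q" using R l by linarith
  consider "a = 1" "i < K" | "a = 1" "i = K" | "2 \<le> a" using a i by linarith
  then show ?thesis
  proof cases
    case 1
    have "- 1 / (lam q + phi q i) \<le> - 1 / (lam q + x)"
      using i(1-3) 1 phi_rec_even[OF q, of "i - 1"] by (simp add: K_def)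
    then have "phi q i \<le> x"
      using 1 pos lam_phi_pos[OF q(1), of i] by (subst (asm) neg_inverse_le_iff) (auto simp: K_def)
    moreover have "- 1 / (lam q + x) \<le> - 1 / (lam q + phi q (i + 1))"
      using i(4) 1 phi_rec_even[OF q, of i] by (simp add: K_def)
    then have "x \<le> phi q (i + 1)"
      using 1 pos lam_phi_pos[OF q(1), of "i + 1"]
      by (subst (asm) neg_inverse_le_iff) (auto simp: K_def)
    moreover have "psc q (K - i) = - 1 / (lam q + psc q (K - i + 1))"
      using 1 i psc_rec_even[OF q, of "K - i"] by (simp add: K_def)
    moreover have "- 1 / (lam q + psc q (K - i + 1)) \<le> - 1 / (lam q + y)"
      using lam_psc_pos[OF q(1), of "K - i + 1"] pos i 1
      by (subst neg_inverse_le_iff) (auto simp: K_def)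
    ultimately have "(x, - 1 / (of_int a * lam q + y)) \<in> negD q"
      using 1 i yR by (intro negDI[of "i + 1"]) (auto simp: K_def Suc_diff_Suc)
    then show ?thesis by (rule negD_Dc)
  next
    case 2
    have "- 1 / (lam q + 0) \<le> - 1 / (lam q + x)"
      using i(1-3) 2 phi_rec_even[OF q, of "K - 1"] phi_kappa[OF q(1)] by (simp add: K_def)
    then have "0 \<le> x"
      using 2 pos l by (subst (asm) neg_inverse_le_iff) auto
    moreover have "- Rc q = - 1 / (lam q + psc q 1)"
      using psc_rec_even[OF q, of 0] i by (simp add: K_def psc_0[OF q(1)])
    moreover have "- 1 / (lam q + psc q 1) \<le> - 1 / (lam q + y)"
      using lam_psc_pos[OF q(1), of 1] pos i 2
      by (subst neg_inverse_le_iff) (auto simp: K_def)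
    ultimately show ?thesis
      using x y0 2 by (intro Dc_right q) auto
  next
    case 3
    \<comment> \<open>The least denominator is 2 lam + (Rc - lam) with Rc = 1, which is that of
      \<open>psc q K\<close>.\<close>
    have "lam q + 1 \<le> of_int a * lam q + y"
      using yb R mult_lam_ge[OF q(1) 3] by simp
    then have "psc q K \<le> - 1 / (of_int a * lam q + y)"
      using psc_even_kappa[OF q] l pos
      unfolding K_def by (simp only:) (subst neg_inverse_le_iff, auto)
    moreover have "- Rc q \<le> psc q K" unfolding K_def by (rule psc_ge[OF q(1) order_refl])
    ultimately show ?thesis
      using x y0 yR Dc_right[OF q(1), of x "- 1 / (of_int a * lam q + y)"]
        negD_Dc[OF negD_left[OF q(1), of x "- 1 / (of_int a * lam q + y)"]]
      by (cases "0 \<le> x") (auto simp: K_def)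
  qed
qed

lemma psc_2_odd:
  assumes "3 \<le> q" "odd q" "2 \<le> kappa q"
  shows "psc q 2 = 1 / Rc q - lam q"
proof -
  have "psc q 0 = - 1 / (lam q + psc q 2)"
    using psc_rec_odd[OF assms(1,2), of 0] assms(3) by (simp add: numeral_2_eq_2)
  then show ?thesis using psc_0[OF assms(1)] by (simp add: eq_neg_inverse_imp)
qed

text \<open>Among the odd q only q = 3 has no index 2. The golden-ratio identity for 1/Rc then takes
  over the role of the estimate 1/Rc \<le> lam, which for larger odd q follows from
  \<open>psc q 2\<close> \<le> 0.\<close>

lemma odd_h0:
  assumes "3 \<le> q" "odd q" "kappa q < 3"
  shows "q = 3" "lam q = 1" "kappa q = 1" "1 / Rc q = 1 + Rc q"
proof -
  show q3: "q = 3" "kappa q = 1" using odd_hq[OF assms(1,2)] assms(3) by auto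
  then show l: "lam q = 1" using lam_3 by simp
  have "Rc q * Rc q + Rc q = 1" using Rc_odd[OF assms(2)] l by simp
  moreover have "0 < Rc q" using Rc_bounds(1)[OF assms(1)] l by simp
  ultimately show "1 / Rc q = 1 + Rc q" by (simp add: field_simps)
qed

lemma Rc_inverse:
  assumes "3 \<le> q" shows "0 < Rc q" "1 \<le> 1 / Rc q"
proof -
  show "0 < Rc q" using Rc_bounds(1)[OF assms] lam_ge_1[OF assms] by simp
  then show "1 \<le> 1 / Rc q" using Rc_bounds(2)[OF assms] by (simp add: field_simps)
qed

text \<open>A digit 1 raises the index by two and cannot occur in the last rectangle. For a digit 2
  the demand on the new y changes at x = phi_1, and only for x < phi_1 does it matter in which
  rectangle the old point lies.\<close>

lemma Dc_forward_pos_odd: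
  assumes q: "3 \<le> q" "odd q" and a: "1 \<le> a" and x: "\<bar>x\<bar> \<le> lam q / 2"
    and D: "(- 1 / (of_int a * lam q + x), y) \<in> negD q"
  shows "(x, - 1 / (of_int a * lam q + y)) \<in> Dc q"
proof -
  note l = lam_ge_1[OF q(1)] lam_less_2[OF q(1)]
  note R = Rc_bounds[OF q(1)] Rc_inverse[OF q(1)]
  define K where "K = kappa q"
  have K1: "1 \<le> K" and K3: "K = 1 \<or> 3 \<le> K" using odd_hq[OF q] by (auto simp: K_def)
  from D obtain i where i: "1 \<le> i" "i \<le> K" "phi q (i - 1) \<le> - 1 / (of_int a * lam q + x)"
    "- 1 / (of_int a * lam q + x) \<le> phi q i" "psc q (K - i + 1) \<le> y" "y \<le> Rc q"
    unfolding K_def by (rule negDE)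
  note yb = negD_bounds[OF q(1) D]
  have al: "lam q \<le> of_int a * lam q" using mult_lam_ge[OF q(1) a] by simp
  have pos: "0 < of_int a * lam q + x" "0 < of_int a * lam q + y"
    using al yb x l R by linarith+
  have y0: "- 1 / (of_int a * lam q + y) \<le> 0" using pos by simp
  then have yR: "- 1 / (of_int a * lam q + y) \<le> Rc q" using R l by linarith
  have phi1: "phi q 1 = 1 - lam q" using phi_odd_1[OF q] .
  have pen: "phi q (K - 1) = - 1 / (2 * lam q + phi q 1)"
    unfolding K_def by (rule phi_odd_penultimate[OF q])
  have max: "(x, - 1 / (of_int a * lam q + y)) \<in> Dc q" if "psc q K \<le> - 1 / (of_int a * lam q + y)"
  proof -
    have "- Rc q \<le> psc q K" unfolding K_def by (rule psc_ge[OF q(1) order_refl])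
    then show ?thesis
      using x y0 yR Dc_right[OF q(1), of x "- 1 / (of_int a * lam q + y)"] that
        negD_Dc[OF negD_left[OF q(1), of x "- 1 / (of_int a * lam q + y)"]]
      by (cases "0 \<le> x") (auto simp: K_def)
  qed
  consider "a = 1" "i + 2 \<le> K" | "a = 1" "i + 1 = K" | "a = 1" "i = K" | "a = 2" | "3 \<le> a" using a i by linarith
  then show ?thesis
  proof cases
    case 1
    have "- 1 / (lam q + phi q (i + 1)) \<le> - 1 / (lam q + x)"
      using i(1-3) 1 phi_rec_odd[OF q, of "i - 1"] by (simp add: K_def)
    then have "phi q (i + 1) \<le> x"
      using 1 pos lam_phi_pos[OF q(1), of "i + 1"] by (subst (asm) neg_inverse_le_iff) (auto simp: K_def)
    moreover have "- 1 / (lam q + x) \<le> - 1 / (lam q + phi q (i + 2))"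
      using i(4) 1 phi_rec_odd[OF q, of i] by (simp add: K_def)
    then have "x \<le> phi q (i + 2)"
      using 1 pos lam_phi_pos[OF q(1), of "i + 2"]
      by (subst (asm) neg_inverse_le_iff) (auto simp: K_def)
    moreover have "K - i - 1 + 2 = K - i + 1" using 1 by simp
    then have "psc q (K - i - 1) = - 1 / (lam q + psc q (K - i + 1))"
      using 1 i psc_rec_odd[OF q, of "K - i - 1"] by (simp add: K_def)
    moreover have "- 1 / (lam q + psc q (K - i + 1)) \<le> - 1 / (lam q + y)"
      using lam_psc_pos[OF q(1), of "K - i + 1"] pos i 1
      by (subst neg_inverse_le_iff) (auto simp: K_def)
    moreover have "K - (i + 2) + 1 = K - i - 1" using 1 by linarith
    ultimately have "(x, - 1 / (of_int a * lam q + y)) \<in> negD q"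
      using 1 i yR by (intro negDI[of "i + 2"]) (auto simp: K_def)
    then show ?thesis by (rule negD_Dc)
  next
    case 2
    have "- 1 / (lam q + phi q K) \<le> - 1 / (lam q + x)"
      using i(1-3) 2 phi_rec_odd[OF q, of "i - 1"] by (simp add: K_def)
    then have "0 \<le> x"
      using 2 pos l phi_kappa[OF q(1)] by (subst (asm) neg_inverse_le_iff) (auto simp: K_def)
    moreover have "- Rc q = - 1 / (lam q + psc q 2)"
      using psc_rec_odd[OF q, of 0] i 2 by (simp add: K_def psc_0[OF q(1)] numeral_2_eq_2)
    moreover have "K - i + 1 = 2" using 2 by simp
    then have "psc q 2 \<le> y" using i(5) by (simp only:)
    then have "- 1 / (lam q + psc q 2) \<le> - 1 / (lam q + y)"
      using lam_psc_pos[OF q(1), of 2] pos i 2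
      by (subst neg_inverse_le_iff) (auto simp: K_def)
    ultimately show ?thesis
      using x y0 2 by (intro Dc_right q) auto
  next
    case 3
    \<comment> \<open>The last interval begins at -1/(2 lam + phi_1) = -1/(lam + 1), so the digit 1
      would need x \<ge> 1 > lam/2.\<close>
    have "- 1 / (2 * lam q + phi q 1) \<le> - 1 / (lam q + x)"
      using i(3) 3 pen by simp
    then have "2 * lam q + phi q 1 \<le> lam q + x"
      using 3 pos l phi1 by (subst (asm) neg_inverse_le_iff) auto
    then show ?thesis using phi1 x l by auto
  next
    case 4
    show ?thesis
    proof (cases "phi q 1 \<le> x")
      case True
      have p: "psc q (K - 1) \<le> - 1 / (of_int a * lam q + y)"
        using psc_odd_penultimate[OF q] l yb R pos 4
        unfolding K_def by (simp only:) (subst neg_inverse_le_iff, auto)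
      show ?thesis
      proof (cases "0 \<le> x")
        case True
        have "- Rc q \<le> psc q (K - 1)" unfolding K_def by (rule psc_ge[OF q(1)]) simp
        then show ?thesis using True p x y0 by (intro Dc_right q) auto
      next
        case False
        obtain j where j: "1 \<le> j" "j \<le> K" "phi q (j - 1) \<le> x" "x \<le> phi q j"
          using phi_locate[OF q(1), of x] x False unfolding K_def by auto
        show ?thesis
        \<comment> \<open>The point x = phi_1 may have been located in the first interval, whose
          lower end \<open>psc q K\<close> is not known to be reached; it belongs to the second
          interval as well.\<close>
        proof (cases "j = 1")
          case j1: True
          then have "x = phi q 1" using True j by simp
          then have "1 < K" using False K1 phi_kappa[OF q(1)] by (cases "K = 1") (auto simp: K_def)
          then have "(x, - 1 / (of_int a * lam q + y)) \<in> negD q"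
            using \<open>x = phi q 1\<close> p yR phi_le[OF q(1), of 1 2]
            by (intro negDI[of 2]) (auto simp: K_def numeral_2_eq_2 Suc_diff_Suc)
          then show ?thesis by (rule negD_Dc)
        next
          case j1: False
          have "psc q (K - j + 1) \<le> psc q (K - 1)"
            using j j1 by (intro psc_le q) (auto simp: K_def)
          then have "(x, - 1 / (of_int a * lam q + y)) \<in> negD q"
            using j p yR by (intro negDI[of j]) (auto simp: K_def)
          then show ?thesis by (rule negD_Dc)
        qed
      qed
    next
      case False
      \<comment> \<open>For x < phi_1 a digit 2 gives a value below phi_(K-1), hence outside the
        last interval. The old fibre therefore starts at \<open>psc q 2\<close> or higher.\<close>
      have "i \<noteq> K"
      proof
        assume "i = K"
        then have "- 1 / (2 * lam q + phi q 1) \<le> - 1 / (2 * lam q + x)"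
          using i(3) 4 pen by simp
        then have "2 * lam q + phi q 1 \<le> 2 * lam q + x"
          using 4 pos l phi1 by (subst (asm) neg_inverse_le_iff) auto
        then show False using False by simp
      qed
      then have i2: "i < K" using i by simp
      then have "2 \<le> K" using i by simp
      moreover have "K - i + 1 \<le> K" "2 \<le> K - i + 1" using i i2 by simp_all
      ultimately have "psc q 2 \<le> y"
        using i i2 psc_le[OF q(1), of 2 "K - i + 1"] by (simp add: K_def)
      then have "1 / Rc q - lam q \<le> y" using psc_2_odd[OF q] \<open>2 \<le> K\<close> by (simp add: K_def)
      moreover have "0 < lam q + 1 / Rc q" using l R by (intro add_pos_pos) auto
      ultimately have "- 1 / (lam q + 1 / Rc q) \<le> - 1 / (of_int a * lam q + y)"
        using pos 4 by (subst neg_inverse_le_iff) auto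
      then show ?thesis
        using psc_odd_kappa[OF q] by (intro max) (simp add: K_def)
    qed
  next
    case 5
    \<comment> \<open>The least denominator for a = 3 has to reach lam + 1/Rc, the denominator of
      \<open>psc q K\<close>. For q = 3 the two are equal.\<close>
    have "lam q + 1 / Rc q \<le> 3 * lam q + (Rc q - lam q)"
    proof (cases "3 \<le> K")
      case True
      then have "psc q 2 \<le> 0" using psc_neg[OF q(1), of 2] by (simp add: K_def)
      then have "1 / Rc q \<le> lam q" using psc_2_odd[OF q] True by (simp add: K_def)
      then show ?thesis using R by simp
    next
      case False
      then show ?thesis using odd_h0[OF q] by (simp add: K_def)
    qed
    also have "3 * lam q + (Rc q - lam q) \<le> of_int a * lam q + y"
      using yb mult_lam_ge[OF q(1) 5] by simp
    finally have "lam q + 1 / Rc q \<le> of_int a * lam q + y" .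
    moreover have "0 < lam q + 1 / Rc q" using l R by (intro add_pos_pos) auto
    ultimately have "- 1 / (lam q + 1 / Rc q) \<le> - 1 / (of_int a * lam q + y)"
      using pos by (subst neg_inverse_le_iff) auto
    then show ?thesis
      using psc_odd_kappa[OF q] by (intro max) (simp add: K_def)
  qed
qed

lemma Dc_forward:
  assumes q: "3 \<le> q" and a: "a \<noteq> 0" and x: "\<bar>x\<bar> \<le> lam q / 2"
    and D: "(- 1 / (of_int a * lam q + x), y) \<in> Dc q"
  shows "(x, - 1 / (of_int a * lam q + y)) \<in> Dc q"
proof -
  have *: "(x, - 1 / (of_int a * lam q + y)) \<in> Dc q"
    if "1 \<le> a" "\<bar>x\<bar> \<le> lam q / 2" "(- 1 / (of_int a * lam q + x), y) \<in> Dc q" for a x y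
  proof -
    have "0 < of_int a * lam q + x"
      using that(2) mult_lam_ge[OF q that(1)] lam_ge_1[OF q] by linarith
    then have "(- 1 / (of_int a * lam q + x), y) \<in> negD q"
      using that(3) by (intro Dc_negD q) auto
    then show ?thesis
      using Dc_forward_pos_even[OF q _ that(1,2)] Dc_forward_pos_odd[OF q _ that(1,2)] by blast
  qed
  show ?thesis
  proof (cases "1 \<le> a")
    case True
    then show ?thesis using * x D by blast
  next
    case False
    have e: "- 1 / (of_int (- a) * lam q + - z) = - (- 1 / (of_int a * lam q + z))" for z :: real
      using divide_minus_right[of 1 "of_int a * lam q + z"] by simp
    have "(- 1 / (of_int (- a) * lam q + - x), - y) \<in> Dc q"
      unfolding e Dc_uminus by (rule D)
    then have "(- x, - 1 / (of_int (- a) * lam q + - y)) \<in> Dc q"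
      using False a x by (intro *) auto
    then show ?thesis
      unfolding e Dc_uminus .
  qed
qed


section \<open>Backward steps inside the domain\<close>

lemma negD_backward_even:
  assumes q: "3 \<le> q" "even q" and a: "1 \<le> a" and D: "(x, - 1 / (of_int a * lam q + y)) \<in> Dc q"
    and y: "Rc q - lam q \<le> y" "y < Rc q"
  shows "(- 1 / (of_int a * lam q + x), y) \<in> negD q"
proof -
  note l = lam_ge_1[OF q(1)]
  have R: "Rc q = 1" using q by (simp add: Rc_def)
  define K where "K = kappa q"
  have K1: "1 \<le> K" using kappa_ge_1[OF q(1)] by (simp add: K_def)
  have x: "\<bar>x\<bar> \<le> lam q / 2" using Dc_bounds(1)[OF q(1) D] .
  have al: "lam q \<le> of_int a * lam q" using mult_lam_ge[OF q(1) a] by simp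
  have pos: "0 < of_int a * lam q + x" "0 < of_int a * lam q + y"
    using al x l R y by linarith+
  have x0: "- 1 / (of_int a * lam q + x) \<le> 0" using pos by simp
  \<comment> \<open>A denominator of at least lam puts the new first coordinate at or above -1/lam =
    phi_(K-1), and over the last interval every y from Rc - lam up to Rc is allowed.\<close>
  have last: ?thesis if "lam q \<le> of_int a * lam q + x"
  proof (rule negDI[of K])
    have "phi q (K - 1) = - 1 / lam q"
      using phi_rec_even[OF q, of "K - 1"] K1 phi_kappa[OF q(1)] by (simp add: K_def)
    then show "phi q (K - 1) \<le> - 1 / (of_int a * lam q + x)"
      using that l pos by (simp only:) (subst neg_inverse_le_iff, auto)
    show "psc q (kappa q - K + 1) \<le> y"
      using y psc_1[OF q(1)] by (simp add: K_def)
  qed (use K1 x0 y phi_kappa[OF q(1)] in \<open>auto simp: K_def\<close>)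
  consider "2 \<le> a" | "a = 1" "0 \<le> x" | "a = 1" "x < 0" using a by linarith
  then show ?thesis
  proof cases
    case 1
    have "lam q \<le> of_int a * lam q + x"
      using mult_lam_ge[OF q(1) 1] x l by (simp only: of_int_numeral)
    then show ?thesis by (rule last)
  next
    case 2
    then show ?thesis by (intro last) simp
  next
    case 3
    obtain i where i: "1 \<le> i" "i \<le> K" "phi q (i - 1) \<le> x" "x \<le> phi q i"
        "psc q (K - i + 1) \<le> - 1 / (of_int a * lam q + y)"
      using Dc_negD[OF q(1) D] 3 unfolding K_def by (auto elim: negDE)
    \<comment> \<open>The first fibre starts at -1/(lam + Rc), so with the digit 1 it would force y
      \<ge> Rc; this is where the strict bound on y enters.\<close>
    have "i \<noteq> 1"
    proof
      assume "i = 1"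
      then have "- 1 / (lam q + 1) \<le> - 1 / (lam q + y)"
        using i 3 K1 psc_even_kappa[OF q] by (simp add: K_def)
      then show False
        using l y R pos 3 by (subst (asm) neg_inverse_le_iff) auto
    qed
    then have i2: "2 \<le> i" using i by simp
    have "- 1 / (lam q + psc q (K - i + 2)) \<le> - 1 / (lam q + y)"
      using i i2 3 psc_rec_even[OF q, of "K - i + 1"] by (simp add: K_def)
    then have "psc q (K - i + 2) \<le> y"
      using lam_psc_pos[OF q(1), of "K - i + 2"] pos i i2 3
      by (subst (asm) neg_inverse_le_iff) (auto simp: K_def)
    moreover have "- 1 / (lam q + phi q (i - 1)) \<le> - 1 / (lam q + x)"
      using lam_phi_pos[OF q(1), of "i - 1"] pos i 3
      by (subst neg_inverse_le_iff) (auto simp: K_def)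
    moreover have "phi q (i - 1 - 1) = - 1 / (lam q + phi q (i - 1))"
      using phi_rec_even[OF q, of "i - 2"] i i2 by (simp add: K_def numeral_2_eq_2 Suc_diff_Suc)
    moreover have "- 1 / (lam q + x) \<le> - 1 / (lam q + phi q i)"
      using lam_phi_pos[OF q(1), of i] pos i 3
      by (subst neg_inverse_le_iff) (auto simp: K_def)
    moreover have "phi q (i - 1) = - 1 / (lam q + phi q i)"
      using phi_rec_even[OF q, of "i - 1"] i i2 by (simp add: K_def)
    moreover have "K - (i - 1) + 1 = K - i + 2" using i i2 by simp
    ultimately show ?thesis
      using i i2 y 3 by (intro negDI[of "i - 1"]) (auto simp: K_def)
  qed
qed

text \<open>The denominator 2 lam + phi_1 separates the last interval from the one before it. The
  latter also demands y \<ge> \<open>psc q 2\<close>; for a = 2 and x < phi_1 this comes from the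
  lower end \<open>psc q K\<close>, for a = 1 and x \<ge> 0 from the lower end -Rc.\<close>

lemma negD_backward_odd:
  assumes q: "3 \<le> q" "odd q" and a: "1 \<le> a" and D: "(x, - 1 / (of_int a * lam q + y)) \<in> Dc q"
    and y: "Rc q - lam q \<le> y" "y < Rc q"
  shows "(- 1 / (of_int a * lam q + x), y) \<in> negD q"
proof -
  note l = lam_ge_1[OF q(1)] lam_less_2[OF q(1)]
  note R = Rc_bounds[OF q(1)] Rc_inverse[OF q(1)]
  define K where "K = kappa q"
  have K1: "1 \<le> K" and K3: "K = 1 \<or> 3 \<le> K" using odd_hq[OF q] by (auto simp: K_def)
  note xy = Dc_bounds[OF q(1) D]
  note x = xy(1)
  have al: "lam q \<le> of_int a * lam q" using mult_lam_ge[OF q(1) a] by simp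
  have pos: "0 < of_int a * lam q + x" "0 < of_int a * lam q + y"
    using al x l R y by linarith+
  have x0: "- 1 / (of_int a * lam q + x) \<le> 0" using pos by simp
  have phi1: "phi q 1 = 1 - lam q" using phi_odd_1[OF q] .
  have pen: "phi q (K - 1) = - 1 / (2 * lam q + phi q 1)"
    unfolding K_def by (rule phi_odd_penultimate[OF q])
  have last: ?thesis if "2 * lam q + phi q 1 \<le> of_int a * lam q + x"
  proof (rule negDI[of K])
    show "phi q (K - 1) \<le> - 1 / (of_int a * lam q + x)"
      unfolding pen using that l pos phi1 by (subst neg_inverse_le_iff) auto
    show "psc q (kappa q - K + 1) \<le> y"
      using y psc_1[OF q(1)] by (simp add: K_def)
  qed (use K1 x0 y phi_kappa[OF q(1)] in \<open>auto simp: K_def\<close>)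
  have pre_last: ?thesis
    if "3 \<le> K" "lam q \<le> of_int a * lam q + x" "of_int a * lam q + x \<le> 2 * lam q + phi q 1"
      "1 / Rc q - lam q \<le> y"
  proof (rule negDI[of "K - 1"])
    have "phi q (K - 1 - 1) = - 1 / lam q"
      using phi_rec_odd[OF q, of "K - 2"] that(1) phi_kappa[OF q(1)]
      by (simp add: K_def numeral_2_eq_2 Suc_diff_Suc)
    then show "phi q (K - 1 - 1) \<le> - 1 / (of_int a * lam q + x)"
      using that l pos by (simp only:) (subst neg_inverse_le_iff, auto)
    show "- 1 / (of_int a * lam q + x) \<le> phi q (K - 1)"
      unfolding pen using that l pos phi1 by (subst neg_inverse_le_iff) auto
    have "kappa q - (K - 1) + 1 = 2" using that(1) by (simp add: K_def)
    moreover have "psc q 2 \<le> y" using psc_2_odd[OF q] that by (simp add: K_def)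
    ultimately show "psc q (kappa q - (K - 1) + 1) \<le> y" by (simp only:)
  qed (use that y in \<open>auto simp: K_def\<close>)
  have psc_max: "1 / Rc q + lam q \<le> of_int a * lam q + y" if "psc q K \<le> - 1 / (of_int a * lam q + y)"
  proof -
    have "- 1 / (lam q + 1 / Rc q) \<le> - 1 / (of_int a * lam q + y)"
      using that psc_odd_kappa[OF q] by (simp add: K_def)
    moreover have "0 < lam q + 1 / Rc q" using l R by (intro add_pos_pos) auto
    ultimately show ?thesis
      using pos by (subst (asm) neg_inverse_le_iff) auto
  qed
  have yR: "1 / Rc q \<le> of_int a * lam q + y"
  proof -
    have "- Rc q \<le> - 1 / (of_int a * lam q + y)" using xy(2) by linarith
    then have "- 1 / (1 / Rc q) \<le> - 1 / (of_int a * lam q + y)" by simp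
    then show ?thesis
      using R pos by (subst (asm) neg_inverse_le_iff) auto
  qed
  have first: "psc q K \<le> - 1 / (of_int a * lam q + y)" if "x < phi q 1"
  proof -
    have "x < 0" using that phi_bounds(2)[OF q(1), of 1] K1 by (simp add: K_def)
    then obtain i where i: "1 \<le> i" "i \<le> K" "phi q (i - 1) \<le> x"
        "psc q (K - i + 1) \<le> - 1 / (of_int a * lam q + y)"
      using Dc_negD[OF q(1) D] unfolding K_def by (auto elim: negDE)
    have "i = 1"
    proof (rule ccontr)
      assume "i \<noteq> 1"
      then have "phi q 1 \<le> phi q (i - 1)" using i by (intro phi_le q) (auto simp: K_def)
      then show False using i that by simp
    qed
    then show ?thesis using i by simp
  qed
  consider "3 \<le> a" | "a = 2" "phi q 1 \<le> x" | "a = 2" "x < phi q 1"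
    | "a = 1" "0 \<le> x" | "a = 1" "x < 0" using a by linarith
  then show ?thesis
  proof cases
    case 1
    have "2 * lam q + phi q 1 \<le> of_int a * lam q + x"
      using mult_lam_ge[OF q(1) 1, unfolded of_int_numeral] x l phi1 by linarith
    then show ?thesis by (rule last)
  next
    case 2
    then show ?thesis by (intro last) simp
  next
    case 3
    have m: "1 / Rc q + lam q \<le> 2 * lam q + y"
      using psc_max[OF first] 3 by simp
    \<comment> \<open>For q = 3 the relation 1/Rc = 1 + Rc would turn \<open>m\<close> into y \<ge>
      Rc.\<close>
    have "3 \<le> K"
    proof (rule ccontr)
      assume "\<not> 3 \<le> K"
      then have "1 / Rc q = 1 + Rc q" "lam q = 1" using odd_h0[OF q] by (auto simp: K_def)
      then show False using m y by simp
    qed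
    then show ?thesis using m 3 x l by (intro pre_last) auto
  next
    case 4
    have "3 \<le> K"
    proof (rule ccontr)
      assume "\<not> 3 \<le> K"
      then have "1 / Rc q = 1 + Rc q" "lam q = 1" using odd_h0[OF q] by (auto simp: K_def)
      then show False using yR y 4 by simp
    qed
    then show ?thesis using yR 4 x l phi1 by (intro pre_last) auto
  next
    case 5
    obtain i where i: "1 \<le> i" "i \<le> K" "phi q (i - 1) \<le> x" "x \<le> phi q i"
        "psc q (K - i + 1) \<le> - 1 / (of_int a * lam q + y)"
      using Dc_negD[OF q(1) D] 5 unfolding K_def by (auto elim: negDE)
    have "i \<noteq> 1"
    proof
      assume "i = 1"
      then have "1 / Rc q + lam q \<le> lam q + y"
        using psc_max i K1 5 by simp
      then show False
        using l y R by simp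
    qed
    \<comment> \<open>The intervals 1 and 2 have no interval two places to their left. Their lower
      ends -1/(lam + 1/Rc) and -1/(lam + Rc) would force y \<ge> 1/Rc or y \<ge> Rc.\<close>
    moreover have "i \<noteq> 2"
    proof
      assume "i = 2"
      then have "- 1 / (lam q + Rc q) \<le> - 1 / (lam q + y)"
        using i 5 psc_odd_penultimate[OF q] by (simp add: K_def numeral_2_eq_2 Suc_diff_Suc)
      then show False
        using l y R pos 5 by (subst (asm) neg_inverse_le_iff) auto
    qed
    ultimately have i3: "3 \<le> i" using i by simp
    have "- 1 / (lam q + psc q (K - i + 3)) \<le> - 1 / (lam q + y)"
      using i i3 5 psc_rec_odd[OF q, of "K - i + 1"] by (simp add: K_def numeral_3_eq_3)
    then have f1: "psc q (K - i + 3) \<le> y"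
      using lam_psc_pos[OF q(1), of "K - i + 3"] pos i i3 5
      by (subst (asm) neg_inverse_le_iff) (auto simp: K_def)
    have f2: "- 1 / (lam q + phi q (i - 1)) \<le> - 1 / (lam q + x)"
      using lam_phi_pos[OF q(1), of "i - 1"] pos i 5
      by (subst neg_inverse_le_iff) (auto simp: K_def)
    have f3: "- 1 / (lam q + x) \<le> - 1 / (lam q + phi q i)"
      using lam_phi_pos[OF q(1), of i] pos i 5
      by (subst neg_inverse_le_iff) (auto simp: K_def)
    have j: "i - 3 + 2 = i - 1" "i - 2 - 1 = i - 3" "i - 2 + 2 = i" "kappa q - (i - 2) + 1 = K - i + 3"
      using i i3 by (auto simp: K_def)
    show ?thesis
    proof (rule negDI[of "i - 2"])
      show "phi q (i - 2 - 1) \<le> - 1 / (of_int a * lam q + x)"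
        using phi_rec_odd[OF q, of "i - 3"] i j f2 5 by (simp add: K_def)
      show "- 1 / (of_int a * lam q + x) \<le> phi q (i - 2)"
        using phi_rec_odd[OF q, of "i - 2"] i j f3 5 by (simp add: K_def)
      show "psc q (kappa q - (i - 2) + 1) \<le> y"
        unfolding j by (rule f1)
      show "1 \<le> i - 2" "i - 2 \<le> kappa q" "y \<le> Rc q"
        using i i3 y unfolding K_def by linarith+
    qed
  qed
qed

text \<open>The floor picks the digit for which the rest of -1/y falls into the half-open interval
  [Rc - lam, Rc) of length lam; the digit is positive because -1/y \<ge> 1 \<ge> Rc.\<close>

lemma Dc_backward_neg:
  assumes q: "3 \<le> q" and D: "(x, y) \<in> Dc q" and y: "y < 0"
  obtains a z where "1 \<le> a" "y = - 1 / (of_int a * lam q + z)"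
    "(- 1 / (of_int a * lam q + x), z) \<in> negD q"
proof -
  note l = lam_ge_1[OF q]
  note R = Rc_bounds[OF q] Rc_inverse[OF q]
  define w where "w = - 1 / y"
  define a where "a = \<lfloor>(w - Rc q + lam q) / lam q\<rfloor>"
  define z where "z = w - of_int a * lam q"
  have y2: "- Rc q \<le> y" using Dc_bounds(2)[OF q D] by simp
  have "- 1 / w = y" using y by (simp add: w_def)
  have w0: "0 < w" using y by (simp add: w_def divide_neg_neg)
  have "1 \<le> w"
    using y y2 R by (simp add: w_def divide_simps)
  then have "1 \<le> (w - Rc q + lam q) / lam q" using R l by simp
  then have a: "1 \<le> a" by (simp add: a_def le_floor_iff)
  have "of_int a \<le> (w - Rc q + lam q) / lam q" "(w - Rc q + lam q) / lam q < of_int a + 1"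
    unfolding a_def by linarith+
  then have "of_int a * lam q \<le> w - Rc q + lam q" "w - Rc q + lam q < of_int a * lam q + lam q"
    using l by (auto simp: field_simps)
  then have z: "Rc q - lam q \<le> z" "z < Rc q" by (auto simp: z_def)
  have yz: "y = - 1 / (of_int a * lam q + z)"
    using \<open>- 1 / w = y\<close> by (simp add: z_def)
  have "(- 1 / (of_int a * lam q + x), z) \<in> negD q"
    using negD_backward_even[OF q _ a _ z] negD_backward_odd[OF q _ a _ z] D[unfolded yz] by blast
  then show thesis using that a yz by blast
qed

lemma Dc_backward:
  assumes q: "3 \<le> q" and D: "(x, y) \<in> Dc q" and y: "y \<noteq> 0"
  obtains a z where "a \<noteq> 0" "y = - 1 / (of_int a * lam q + z)"
    "(- 1 / (of_int a * lam q + x), z) \<in> Dc q"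
proof (cases "y < 0")
  case True
  then show thesis using Dc_backward_neg[OF q D] that negD_Dc by (metis not_one_le_zero)
next
  case False
  have "(- x, - y) \<in> Dc q" using D by (simp add: Dc_uminus)
  then obtain a z where a: "1 \<le> a" "- y = - 1 / (of_int a * lam q + z)"
      "(- 1 / (of_int a * lam q + - x), z) \<in> negD q"
    using Dc_backward_neg[OF q] False y by (metis neg_less_0_iff_less linorder_neqE)
  have e: "- 1 / (of_int (- a) * lam q + - z) = - (- 1 / (of_int a * lam q + z))" for z :: real
    using divide_minus_right[of 1 "of_int a * lam q + z"] by simp
  show thesis
  proof (rule that)
    show "- a \<noteq> 0" using a by simp
    show "y = - 1 / (of_int (- a) * lam q + - z)" unfolding e using a(2) by simp
    show "(- 1 / (of_int (- a) * lam q + x), - z) \<in> Dc q"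
      unfolding e[of "- x", simplified minus_minus] Dc_uminus by (rule negD_Dc[OF a(3)])
  qed
qed

section \<open>Regular words\<close>

fun cft :: "nat \<Rightarrow> int list \<Rightarrow> real \<Rightarrow> real" where
  "cft q [] t = t"
| "cft q (d # ds) t = - 1 / (of_int d * lam q + cft q ds t)"

fun chain :: "nat \<Rightarrow> int list \<Rightarrow> real \<Rightarrow> bool" where
  "chain q [] t \<longleftrightarrow> \<bar>t\<bar> \<le> lam q / 2"
| "chain q (d # ds) t \<longleftrightarrow> chain q ds t \<and> d \<noteq> 0 \<and> \<bar>cft q (d # ds) t\<bar> \<le> lam q / 2"

lemma cf_list_cft: "cf_list q ds = cft q ds 0"
  by (induction ds) auto

lemma cft_append: "cft q (u @ v) t = cft q u (cft q v t)"
  by (induction u) auto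

lemma neg_inverse_uminus:
  "- 1 / (of_int (- d) * l + - z) = - (- 1 / (of_int d * l + z))" for z :: real
  using divide_minus_right[of 1 "of_int d * l + z"] by simp

lemma cft_uminus: "cft q (map uminus ds) (- t) = - cft q ds t"
proof (induction ds)
  case (Cons d ds)
  then have "cft q (map uminus (d # ds)) (- t) = - 1 / (of_int (- d) * lam q + - cft q ds t)"
    by simp
  also have "\<dots> = - cft q (d # ds) t"
    unfolding neg_inverse_uminus by simp
  finally show ?case .
qed simp

lemma cf_list_uminus: "cf_list q (map uminus ds) = - cf_list q ds"
  using cft_uminus[of q ds 0] by (simp add: cf_list_cft)

lemma chain_bound: "chain q ds t \<Longrightarrow> \<bar>cft q ds t\<bar> \<le> lam q / 2"
  by (cases ds) auto

lemma chain_append: "chain q (u @ v) t \<longleftrightarrow> chain q v t \<and> chain q u (cft q v t)"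
  by (induction u) (auto simp: cft_append dest: chain_bound)

lemma chain_uminus: "chain q (map uminus ds) (- t) \<longleftrightarrow> chain q ds t"
proof (induction ds)
  case (Cons d ds)
  have "cft q (map uminus (d # ds)) (- t) = - cft q (d # ds) t" by (rule cft_uminus)
  then show ?case using Cons by simp
qed simp

text \<open>For even q the block of h + 1 ones is the member m = 1 of the family, and q = 3 is the
  odd case with h = 0, so both special clauses disappear.\<close>

definition pos_forbidden :: "nat \<Rightarrow> int list set" where
  "pos_forbidden q = (if even q then {replicate (hq q) 1 @ [m] |m. 1 \<le> m}
     else insert (replicate (hq q) 1 @ [1]) {replicate (hq q) 1 @ 2 # replicate (hq q) 1 @ [m] |m. 1 \<le> m})"

lemma forbidden_eq: "forbidden q = pos_forbidden q \<union> map uminus ` pos_forbidden q" (is "_ = ?R")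
proof -
  have rs: "replicate (n + 1) s = map ((*) s) (replicate n 1 @ [1])" for n and s :: int
    by (simp add: map_replicate replicate_append_same)
  have "forbidden q = {map ((*) s) v |s v. s \<in> {1, -1} \<and> v \<in> pos_forbidden q}"
  proof -
    consider "q = 3" | "q \<noteq> 3" "even q" | "q \<noteq> 3" "odd q" by blast
    then show ?thesis
    proof cases
      case 1
      then have "forbidden q = {map ((*) s) [1] |s. s \<in> {1, -1}} \<union>
          {map ((*) s) [2, m] |s m. s \<in> {1, -1} \<and> 1 \<le> m}"
        by (auto simp: forbidden_def)
      also have "\<dots> = {map ((*) s) v |s v. s \<in> {1, -1} \<and> v \<in> {[1]} \<union> {[2, m] |m. 1 \<le> m}}"
        by blast
      also have "{[1]} \<union> {[2, m] |m. 1 \<le> m} = pos_forbidden q"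
        using 1 by (simp add: pos_forbidden_def hq_def)
      finally show ?thesis .
    next
      case 2
      then have "forbidden q = {map ((*) s) (replicate (hq q) 1 @ [1]) |s. s \<in> {1, -1}} \<union>
          {map ((*) s) (replicate (hq q) 1 @ [m]) |s m. s \<in> {1, -1} \<and> 1 \<le> m}"
        unfolding forbidden_def rs by (simp add: map_replicate)
      also have "\<dots> = {map ((*) s) v |s v. s \<in> {1, -1} \<and> v \<in> {replicate (hq q) 1 @ [m] |m. 1 \<le> m}}"
        by blast
      finally show ?thesis using 2 by (simp add: pos_forbidden_def)
    next
      case 3
      then have "forbidden q = {map ((*) s) (replicate (hq q) 1 @ [1]) |s. s \<in> {1, -1}} \<union>
          {map ((*) s) (replicate (hq q) 1 @ 2 # replicate (hq q) 1 @ [m]) |s m. s \<in> {1, -1} \<and> 1 \<le> m}"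
        unfolding forbidden_def rs by (simp add: map_replicate mult.commute)
      also have "\<dots> = {map ((*) s) v |s v. s \<in> {1, -1} \<and> v \<in> insert (replicate (hq q) 1 @ [1])
          {replicate (hq q) 1 @ 2 # replicate (hq q) 1 @ [m] |m. 1 \<le> m}}"
        by blast
      finally show ?thesis using 3 by (simp add: pos_forbidden_def)
    qed
  qed
  also have "\<dots> = map ((*) 1) ` pos_forbidden q \<union> map ((*) (- 1)) ` pos_forbidden q"
    by blast
  also have "(*) (1 :: int) = id" by auto
  also have "(*) (- 1 :: int) = uminus" by auto
  finally show ?thesis by simp
qed

lemma forbidden_uminus: "map uminus v \<in> forbidden q \<longleftrightarrow> v \<in> forbidden q"
proof -
  have *: "map uminus (map uminus w) = w" for w :: "int list" by (simp add: map_idI)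
  show ?thesis unfolding forbidden_eq by (force simp: * image_iff simp del: map_map)
qed

lemma chain_one_even:
  assumes q: "3 \<le> q" "even q" and j: "j < kappa q" and t: "\<bar>t\<bar> \<le> lam q / 2"
    and le: "phi q j \<le> - 1 / (lam q + t)"
  shows "phi q (j + 1) \<le> t"
proof -
  have "- 1 / (lam q + phi q (j + 1)) \<le> - 1 / (lam q + t)"
    using le phi_rec_even[OF q j] by simp
  moreover have "0 < lam q + t" using lam_ge_1[OF q(1)] t by linarith
  ultimately show ?thesis
    using lam_phi_pos[OF q(1), of "j + 1"] j by (subst (asm) neg_inverse_le_iff) auto
qed

lemma chain_one_odd:
  assumes q: "3 \<le> q" "odd q" and j: "j + 2 \<le> kappa q" and t: "\<bar>t\<bar> \<le> lam q / 2"
    and le: "phi q j \<le> - 1 / (lam q + t)"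
  shows "phi q (j + 2) \<le> t"
proof -
  have "- 1 / (lam q + phi q (j + 2)) \<le> - 1 / (lam q + t)"
    using le phi_rec_odd[OF q j] by simp
  moreover have "0 < lam q + t" using lam_ge_1[OF q(1)] t by linarith
  ultimately show ?thesis
    using lam_phi_pos[OF q(1), of "j + 2"] j by (subst (asm) neg_inverse_le_iff) auto
qed

lemma chain_ones_even:
  assumes q: "3 \<le> q" "even q"
  shows "\<lbrakk>chain q (replicate n 1 @ v) t; phi q j \<le> cft q (replicate n 1 @ v) t; j + n \<le> kappa q\<rbrakk>
    \<Longrightarrow> phi q (j + n) \<le> cft q v t"
proof (induction n arbitrary: j)
  case (Suc n)
  have "phi q (j + 1) \<le> cft q (replicate n 1 @ v) t"
    using Suc.prems chain_bound[of q "replicate n 1 @ v" t] by (intro chain_one_even[OF q]) auto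
  then show ?case using Suc.IH[of "j + 1"] Suc.prems by simp
qed simp

lemma chain_ones_odd:
  assumes q: "3 \<le> q" "odd q"
  shows "\<lbrakk>chain q (replicate n 1 @ v) t; phi q j \<le> cft q (replicate n 1 @ v) t; j + 2 * n \<le> kappa q\<rbrakk>
    \<Longrightarrow> phi q (j + 2 * n) \<le> cft q v t"
proof (induction n arbitrary: j)
  case (Suc n)
  have "phi q (j + 2) \<le> cft q (replicate n 1 @ v) t"
    using Suc.prems chain_bound[of q "replicate n 1 @ v" t] by (intro chain_one_odd[OF q]) auto
  then show ?case using Suc.IH[of "j + 2"] Suc.prems by simp
qed simp

lemma pos_digit_neg:
  assumes "3 \<le> q" "1 \<le> m" "\<bar>t\<bar> \<le> lam q / 2"
  shows "- 1 / (of_int m * lam q + t) < 0"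
proof -
  have "0 < of_int m * lam q + t"
    using mult_lam_ge[OF assms(1,2)] lam_ge_1[OF assms(1)] assms(3) by linarith
  then show ?thesis by simp
qed

text \<open>The bound phi_0 = -lam/2 for the value of the block is pushed along the points
  \<open>phi\<close> by each digit 1, and for odd q from phi_(kappa-1) to phi_1 by the digit 2
  between the ones. A block ending in an arbitrary m pushes it to phi_kappa = 0, although a value
  with positive first digit is negative; h + 1 ones with q odd would need a tail of at least
  1.\<close>

lemma chain_not_pos_forbidden:
  assumes q: "3 \<le> q" and c: "chain q v t"
  shows "v \<notin> pos_forbidden q"
proof
  assume v: "v \<in> pos_forbidden q"
  have v0: "phi q 0 \<le> cft q v t" using chain_bound[OF c] phi_0[OF q] by linarith
  consider (ev) m where "even q" "v = replicate (hq q) 1 @ [m]" "1 \<le> m"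
    | (od1) "odd q" "v = replicate (hq q) 1 @ [1]"
    | (od2) m where "odd q" "v = replicate (hq q) 1 @ 2 # replicate (hq q) 1 @ [m]" "1 \<le> m"
    using v by (auto simp: pos_forbidden_def split: if_splits)
  then show False
  proof cases
    case ev
    have "phi q (0 + hq q) \<le> cft q [m] t"
      using c v0 even_hq[OF q ev(1)] unfolding ev(2) by (intro chain_ones_even[OF q ev(1)]) auto
    moreover have "\<bar>t\<bar> \<le> lam q / 2" using c ev by (simp add: chain_append)
    ultimately show False
      using pos_digit_neg[OF q ev(3), of t] even_hq[OF q ev(1)] phi_kappa[OF q] by simp
  next
    case od1
    note h = odd_hq[OF q od1(1)]
    have "phi q (0 + 2 * hq q) \<le> cft q [1] t"
      using c v0 h unfolding od1(2) by (intro chain_ones_odd[OF q od1(1)]) auto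
    then have le: "- 1 / (2 * lam q + phi q 1) \<le> - 1 / (lam q + t)"
      using phi_odd_penultimate[OF q od1(1)] h by simp
    have t: "\<bar>t\<bar> \<le> lam q / 2" using c od1 by (simp add: chain_append)
    then have "0 < lam q + t" using lam_ge_1[OF q] by linarith
    then have "2 * lam q + phi q 1 \<le> lam q + t"
      using le phi_odd_1[OF q od1(1)] lam_ge_1[OF q] by (subst (asm) neg_inverse_le_iff) auto
    then show False
      using phi_odd_1[OF q od1(1)] lam_less_2[OF q] t by simp
  next
    case od2
    note h = odd_hq[OF q od2(1)]
    define w where "w = replicate (hq q) 1 @ [m]"
    have cw: "chain q w t" using c od2 by (simp add: w_def chain_append)
    have "phi q (0 + 2 * hq q) \<le> cft q (2 # w) t"
      using c v0 h unfolding od2(2) w_def by (intro chain_ones_odd[OF q od2(1)]) auto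
    then have le: "- 1 / (2 * lam q + phi q 1) \<le> - 1 / (2 * lam q + cft q w t)"
      using phi_odd_penultimate[OF q od2(1)] h by simp
    have "0 < 2 * lam q + cft q w t" using chain_bound[OF cw] lam_ge_1[OF q] by linarith
    then have "phi q 1 \<le> cft q w t"
      using le phi_odd_1[OF q od2(1)] lam_ge_1[OF q] by (subst (asm) neg_inverse_le_iff) auto
    then have "phi q (1 + 2 * hq q) \<le> cft q [m] t"
      using cw h unfolding w_def by (intro chain_ones_odd[OF q od2(1)]) auto
    moreover have "\<bar>t\<bar> \<le> lam q / 2" using cw by (simp add: w_def chain_append)
    ultimately show False
      using pos_digit_neg[OF q od2(3), of t] h phi_kappa[OF q] by simp
  qed
qed

lemma chain_not_forbidden:
  assumes q: "3 \<le> q" and c: "chain q v t"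
  shows "v \<notin> forbidden q"
proof
  assume "v \<in> forbidden q"
  then consider "v \<in> pos_forbidden q" | w where "w \<in> pos_forbidden q" "v = map uminus w"
    unfolding forbidden_eq by auto
  then show False
  proof cases
    case 2
    have "chain q (map uminus w) (- (- t))" using c 2 by simp
    then show False using chain_not_pos_forbidden[OF q, of w "- t"] 2 unfolding chain_uminus by blast
  qed (use chain_not_pos_forbidden[OF q c] in blast)
qed

section \<open>Values of finite regular words\<close>

definition reglist :: "nat \<Rightarrow> int list \<Rightarrow> bool" where
  "reglist q ds \<longleftrightarrow> 0 \<notin> set ds \<and> (\<forall>u v w. ds = u @ v @ w \<longrightarrow> v \<notin> forbidden q)"

lemma reglist_infix: "reglist q (u @ v @ w) \<Longrightarrow> reglist q v"
  unfolding reglist_def by (auto, metis append.assoc)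

lemma reglist_append: "reglist q (u @ v) \<Longrightarrow> reglist q u \<and> reglist q v"
  using reglist_infix[of q "[]" u v] reglist_infix[of q u v "[]"] by simp

lemma reglist_no_pos_forbidden: "reglist q (u @ v @ w) \<Longrightarrow> v \<notin> pos_forbidden q"
  unfolding reglist_def forbidden_eq by blast

lemma reglist_uminus: "reglist q ds \<Longrightarrow> reglist q (map uminus ds)"
proof -
  assume r: "reglist q ds"
  have *: "map uminus (map uminus w) = w" for w :: "int list" by (simp add: map_idI)
  have "v \<notin> forbidden q" if "map uminus ds = u @ v @ w" for u v w
  proof -
    have "ds = map uminus (u @ v @ w)" using that * by metis
    then have "reglist q (map uminus u @ map uminus v @ map uminus w)" using r by simp
    then have "map uminus v \<notin> forbidden q" unfolding reglist_def by blast
    then show ?thesis by (simp add: forbidden_uminus)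
  qed
  then show ?thesis using r by (auto simp: reglist_def)
qed

lemma chain_reglist:
  assumes q: "3 \<le> q" and c: "chain q ds t"
  shows "reglist q ds"
proof -
  have "0 \<notin> set ds" using c by (induction ds) auto
  moreover have "v \<notin> forbidden q" if "ds = u @ v @ w" for u v w
    using c chain_not_forbidden[OF q] unfolding that chain_append by blast
  ultimately show ?thesis by (simp add: reglist_def)
qed

lemma cf_list_bound_aux:
  assumes "\<And>ds. reglist q ds \<Longrightarrow> length ds < n \<Longrightarrow> - lam q / 2 \<le> cf_list q ds"
    and "reglist q ds" "length ds < n"
  shows "\<bar>cf_list q ds\<bar> \<le> lam q / 2"
  using assms(1)[of ds] assms(1)[of "map uminus ds"] assms(2,3) reglist_uminus[of q ds]
  by (simp add: cf_list_uminus abs_le_iff)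

lemma large_digit:
  assumes "3 \<le> q" "2 \<le> d" "\<bar>t\<bar> \<le> lam q / 2"
  shows "- 1 / lam q \<le> - 1 / (of_int d * lam q + t)"
proof -
  have "lam q \<le> of_int d * lam q + t"
    using mult_lam_ge[OF assms(1,2), unfolded of_int_numeral] lam_ge_1[OF assms(1)] assms(3) by linarith
  then show ?thesis
    using lam_ge_1[OF assms(1)] by (subst neg_inverse_le_iff) auto
qed

lemma neg_digit:
  assumes "3 \<le> q" "d < 0" "\<bar>t\<bar> \<le> lam q / 2"
  shows "0 < - 1 / (of_int d * lam q + t)"
proof -
  have "of_int d * lam q \<le> (- 1) * lam q"
    using assms(2) lam_ge_1[OF assms(1)] by (intro mult_right_mono) auto
  then have "of_int d * lam q + t < 0"
    using lam_ge_1[OF assms(1)] assms(3) by linarith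
  then show ?thesis by (simp add: divide_neg_neg)
qed

text \<open>The index j counts how much of a forbidden block has been read. A further 1 is handled
  by the recursion of \<open>phi\<close>, a digit of at least 2 gives at least -1/lam =
  phi_(kappa-1), a negative digit gives a positive value, and at j = kappa no positive digit may
  follow.\<close>

lemma phi_le_cf_list_even:
  assumes q: "3 \<le> q" "even q"
  shows "reglist q (replicate j 1 @ ds) \<Longrightarrow> j \<le> kappa q \<Longrightarrow> phi q j \<le> cf_list q ds"
proof (induction "length ds" arbitrary: ds j rule: less_induct)
  case less
  note h = even_hq[OF q]
  show ?case
  proof (cases ds)
    case Nil
    then show ?thesis using phi_bounds(2)[OF q(1) less.prems(2)] by simp
  next
    case (Cons d ds')
    have rd: "reglist q (d # ds')" using reglist_append less.prems(1) Cons by blast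
    then have r': "reglist q ds'" using reglist_append[of q "[d]" ds'] by simp
    \<comment> \<open>The case j = 0 for shorter words, applied to \<open>ds'\<close> and to its
      negative, bounds the tail from both sides.\<close>
    have "- lam q / 2 \<le> cf_list q es" if "reglist q es" "length es < length ds" for es
      using less.hyps[of es 0] that phi_0[OF q(1)] by simp
    then have b: "\<bar>cf_list q ds'\<bar> \<le> lam q / 2"
      using cf_list_bound_aux r' Cons by fastforce
    have nf: "j \<noteq> kappa q" if "1 \<le> d"
      using reglist_no_pos_forbidden[of q "[]" "replicate j 1 @ [d]" ds'] less.prems(1) that q(2) h
      unfolding Cons by (auto simp: pos_forbidden_def)
    have "d \<noteq> 0" using rd by (auto simp: reglist_def)
    then consider "d < 0" | "d = 1" | "2 \<le> d" by linarith
    then show ?thesis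
    proof cases
      case 1
      have "0 < cf_list q ds"
        unfolding Cons cf_list.simps by (rule neg_digit[OF q(1) 1 b])
      then show ?thesis
        using phi_bounds(2)[OF q(1) less.prems(2)] by simp
    next
      case 2
      have j: "j < kappa q" using nf less.prems(2) 2 by simp
      have "replicate (j + 1) 1 @ ds' = replicate j 1 @ ds"
        using Cons 2 by (simp add: replicate_app_Cons_same)
      then have "phi q (j + 1) \<le> cf_list q ds'"
        using less.hyps[of ds' "j + 1"] less.prems(1) j Cons by simp
      then have "- 1 / (lam q + phi q (j + 1)) \<le> - 1 / (lam q + cf_list q ds')"
        using lam_phi_pos[OF q(1), of "j + 1"] j by (subst neg_inverse_le_iff) auto
      then show ?thesis using phi_rec_even[OF q j] Cons 2 by simp
    next
      case 3
      have j: "j < kappa q" using nf less.prems(2) 3 by simp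
      have "phi q j \<le> phi q (kappa q - 1)" using j by (intro phi_le q) auto
      also have "\<dots> = - 1 / lam q"
        using phi_rec_even[OF q, of "kappa q - 1"] j phi_kappa[OF q(1)] by simp
      also have "\<dots> \<le> cf_list q ds"
        using large_digit[OF q(1) 3 b] Cons by simp
      finally show ?thesis .
    qed
  qed
qed

text \<open>A prefix \<open>1\<^sup>j\<close> or \<open>1\<^sup>h 2 1\<^sup>j\<close> with \<open>h = hq q\<close> is the part of a forbidden block already read.\<close>

lemma phi_le_cf_list_odd:
  assumes q: "3 \<le> q" "odd q"
  shows "\<lbrakk>reglist q (replicate j 1 @ ds); j \<le> hq q\<rbrakk> \<Longrightarrow> phi q (2 * j) \<le> cf_list q ds"
    and "\<lbrakk>reglist q (replicate (hq q) 1 @ 2 # replicate j 1 @ ds); j \<le> hq q\<rbrakk>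
      \<Longrightarrow> phi q (2 * j + 1) \<le> cf_list q ds"
proof (induction "length ds" arbitrary: ds j rule: less_induct)
  case less
  note h = odd_hq[OF q]
  \<comment> \<open>The flag \<open>s\<close> tells which of the two prefixes has been read. The
    weaker bound holds for both, since the longer prefix ends in 1^j.\<close>
  have main: "phi q (2 * j) \<le> cf_list q ds \<and> (s \<longrightarrow> phi q (2 * j + 1) \<le> cf_list q ds)"
    if r: "reglist q ((if s then replicate (hq q) 1 @ 2 # replicate j 1 else replicate j 1) @ ds)"
      and jh: "j \<le> hq q" for j s
  proof -
    have jk: "2 * j + 1 \<le> kappa q" using h jh by simp
    have p01: "phi q (2 * j) \<le> phi q (2 * j + 1)" using jk by (intro phi_le q) auto
    have r1: "reglist q (replicate j 1 @ ds)"
      using r reglist_append[of q "replicate (hq q) 1 @ [2]" "replicate j 1 @ ds"] by (cases s) auto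
    show ?thesis
    proof (cases ds)
      case Nil
      then show ?thesis
        using phi_bounds(2)[OF q(1) jk] p01 by simp
    next
      case (Cons d ds')
      have rd: "reglist q (d # ds')" using reglist_append r1 Cons by blast
      then have r': "reglist q ds'" using reglist_append[of q "[d]" ds'] by simp
      have "- lam q / 2 \<le> cf_list q es" if "reglist q es" "length es < length ds" for es
        using less.hyps(1)[of es 0] that phi_0[OF q(1)] by simp
      then have b: "\<bar>cf_list q ds'\<bar> \<le> lam q / 2"
        using cf_list_bound_aux r' Cons by fastforce
      have nf1: "j \<noteq> hq q" if "d = 1"
        using reglist_no_pos_forbidden[of q "[]" "replicate j 1 @ [d]" ds'] r1 that q(2)
        unfolding Cons by (auto simp: pos_forbidden_def)
      have nf2: "j \<noteq> hq q" if "1 \<le> d" s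
        using reglist_no_pos_forbidden[of q "[]" "replicate (hq q) 1 @ 2 # replicate j 1 @ [d]" ds']
          r that q(2) unfolding Cons by (auto simp: pos_forbidden_def)
      have large: "2 * j + 1 \<le> kappa q - 2 \<Longrightarrow> 2 \<le> d \<Longrightarrow> phi q (2 * j + 1) \<le> cf_list q ds"
      proof -
        assume j: "2 * j + 1 \<le> kappa q - 2" and d: "2 \<le> d"
        have e: "kappa q - 2 + 2 = kappa q" using j jk by simp
        have "phi q (2 * j + 1) \<le> phi q (kappa q - 2)" using j by (intro phi_le q) auto
        also have "\<dots> = - 1 / lam q"
          using e phi_rec_odd[OF q, of "kappa q - 2"] j phi_kappa[OF q(1)] by simp
        also have "\<dots> \<le> cf_list q ds"
          using large_digit[OF q(1) d b] Cons by simp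
        finally show ?thesis .
      qed
      have "d \<noteq> 0" using rd by (auto simp: reglist_def)
      then consider "d < 0" | "d = 1" | "2 \<le> d" "j < hq q" | "2 \<le> d" "j = hq q" using jh by linarith
      then show ?thesis
      proof cases
        case 1
        have "0 < cf_list q ds"
          unfolding Cons cf_list.simps by (rule neg_digit[OF q(1) 1 b])
        then show ?thesis
          using phi_bounds(2)[OF q(1) jk] p01 by auto
      next
        case 2
        have j: "j + 1 \<le> hq q" "2 * j + 3 \<le> kappa q" using nf1 jh 2 h by auto
        have e: "replicate (j + 1) 1 @ ds' = replicate j 1 @ ds"
          using Cons 2 by (simp add: replicate_app_Cons_same)
        have step: "phi q k \<le> cf_list q ds" if "phi q (k + 2) \<le> cf_list q ds'" "k + 2 \<le> kappa q" for k
        proof -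
          have "- 1 / (lam q + phi q (k + 2)) \<le> - 1 / (lam q + cf_list q ds')"
            using lam_phi_pos[OF q(1), of "k + 2"] that by (subst neg_inverse_le_iff) auto
          then show ?thesis using phi_rec_odd[OF q, of k] that Cons 2 by simp
        qed
        have "phi q (2 * (j + 1)) \<le> cf_list q ds'"
          using less.hyps(1)[of ds' "j + 1"] r1 j Cons unfolding e by simp
        moreover have "phi q (2 * (j + 1) + 1) \<le> cf_list q ds'" if s
          using less.hyps(2)[of ds' "j + 1"] r that j Cons unfolding e by simp
        ultimately show ?thesis
          using step[of "2 * j"] step[of "2 * j + 1"] j by (auto simp: algebra_simps)
      next
        case 3
        then have "2 * j + 1 \<le> kappa q - 2" using h by simp
        then show ?thesis using large 3 p01 by fastforce
      next
        case 4
        have ns: "\<not> s" using nf2 4 by auto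
        have "2 * lam q + phi q 1 \<le> of_int d * lam q + cf_list q ds'"
        \<comment> \<open>A digit 2 after 1^h opens the longer prefix with no ones behind it, so the
          second claim at index 0 supplies phi_1 as a bound for the tail. A digit of at least 3 is
          large enough by itself.\<close>
        proof (cases "d = 2")
          case True
          then have "phi q (2 * 0 + 1) \<le> cf_list q ds'"
            using r1 4 Cons by (intro less.hyps(2)) auto
          then show ?thesis using True by simp
        next
          case False
          then have "3 \<le> d" using 4 by simp
          then show ?thesis
            using mult_lam_ge[OF q(1) \<open>3 \<le> d\<close>, unfolded of_int_numeral] b lam_ge_1[OF q(1)] lam_less_2[OF q(1)]
              phi_bounds(2)[OF q(1) kappa_ge_1[OF q(1)]]
            by linarith
        qed
        then have "- 1 / (2 * lam q + phi q 1) \<le> - 1 / (of_int d * lam q + cf_list q ds')"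
          using phi_odd_1[OF q] lam_ge_1[OF q(1)] by (subst neg_inverse_le_iff) auto
        then have "phi q (2 * j) \<le> cf_list q ds"
          using phi_odd_penultimate[OF q] h 4 Cons by simp
        then show ?thesis using ns by simp
      qed
    qed
  qed
  { case 1 then show ?case using main[where s = False] by simp }
  { case 2 then show ?case using main[where s = True] by simp }
qed

lemma cf_list_bound:
  assumes q: "3 \<le> q" and r: "reglist q ds"
  shows "\<bar>cf_list q ds\<bar> \<le> lam q / 2"
proof -
  have "- lam q / 2 \<le> cf_list q ds" if "reglist q ds" for ds
    using phi_le_cf_list_even[OF q, of 0 ds] phi_le_cf_list_odd(1)[OF q, of 0 ds] that phi_0[OF q]
    by (cases "even q") auto
  then show ?thesis using cf_list_bound_aux[of q "Suc (length ds)" ds] r by blast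
qed

lemma reglist_Dc:
  assumes q: "3 \<le> q"
  shows "reglist q (rev es @ ds) \<Longrightarrow> (cf_list q ds, cf_list q es) \<in> Dc q"
proof (induction es arbitrary: ds)
  case Nil
  then show ?case using Dc_zero[OF q] cf_list_bound[OF q] by simp
next
  case (Cons e es)
  have "reglist q (rev es @ e # ds)" using Cons.prems by simp
  then have "(cf_list q (e # ds), cf_list q es) \<in> Dc q" by (rule Cons.IH)
  moreover have "e \<noteq> 0" using Cons.prems by (auto simp: reglist_def)
  moreover have "reglist q ds"
    using reglist_append[of q "rev (e # es)" ds] Cons.prems by blast
  ultimately show ?case
    using Dc_forward[OF q, of e "cf_list q ds" "cf_list q es"] cf_list_bound[OF q, of ds] by simp
qed

section \<open>Convergence and the endpoints \<open>\<psi>\<close>\<close>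

lemma abs_digit_lam: "3 \<le> q \<Longrightarrow> a \<noteq> 0 \<Longrightarrow> lam q \<le> \<bar>of_int a * lam q\<bar>"
  using mult_right_mono[of 1 "\<bar>real_of_int a\<bar>" "lam q"] lam_ge_1[of q] by (simp add: abs_mult)

lemma digit_denominator_nonzero:
  assumes "3 \<le> q" "a \<noteq> 0" "\<bar>t\<bar> \<le> Rc q"
  shows "of_int a * lam q + t \<noteq> 0"
  using abs_digit_lam[OF assms(1,2)] Rc_bounds(4)[OF assms(1)] assms(3) by linarith

text \<open>A step multiplies the difference of two tails by a product of values, which for Rc = 1
  may be as large as 1. Two consecutive values have the product |t|/|w| with w = a lam + t and |w|
  \<ge> 1: either |w| \<ge> lam and |t| \<le> 1, or |a| = 1 and |t| = lam - |w| \<le> lam - 1. This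
  explains both entries of the maximum.\<close>

lemma two_step_contraction:
  assumes q: "3 \<le> q"
  obtains \<rho> where "0 \<le> \<rho>" "\<rho> < 1"
    "\<And>a t. \<lbrakk>a \<noteq> 0; \<bar>t\<bar> \<le> Rc q; \<bar>1 / (of_int a * lam q + t)\<bar> \<le> Rc q\<rbrakk>
      \<Longrightarrow> \<bar>t\<bar> * \<bar>1 / (of_int a * lam q + t)\<bar> \<le> \<rho>"
proof (cases "even q")
  case False
  have "Rc q * Rc q < 1 * 1"
    using Rc_bounds(3)[OF q False] Rc_inverse(1)[OF q] by (intro mult_strict_mono) auto
  then show thesis
  proof (intro that[of "Rc q * Rc q"])
    fix a :: int and t :: real
    assume "\<bar>t\<bar> \<le> Rc q" "\<bar>1 / (of_int a * lam q + t)\<bar> \<le> Rc q"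
    then show "\<bar>t\<bar> * \<bar>1 / (of_int a * lam q + t)\<bar> \<le> Rc q * Rc q"
      using Rc_inverse(1)[OF q] by (intro mult_mono) auto
  qed auto
next
  case True
  then have R: "Rc q = 1" by (simp add: Rc_def)
  have l1: "1 < lam q" using Rc_bounds(4)[OF q] R by simp
  note l = l1 lam_less_2[OF q]
  define \<rho> where "\<rho> = max (lam q - 1) (1 / lam q)"
  show thesis
  proof (rule that[of \<rho>])
    show "0 \<le> \<rho>" "\<rho> < 1" using l by (auto simp: \<rho>_def)
    fix a :: int and t :: real
    assume a: "a \<noteq> 0" and t: "\<bar>t\<bar> \<le> Rc q" and b: "\<bar>1 / (of_int a * lam q + t)\<bar> \<le> Rc q"
    define w where "w = of_int a * lam q + t"
    have w0: "w \<noteq> 0" unfolding w_def by (rule digit_denominator_nonzero[OF q a t])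
    have "1 / \<bar>w\<bar> \<le> 1" using b unfolding w_def[symmetric] abs_divide R by simp
    then have w1: "1 \<le> \<bar>w\<bar>" using w0 by (simp add: field_simps)
    have t1: "\<bar>t\<bar> \<le> 1" using t R by simp
    have "\<bar>t\<bar> \<le> \<rho> * \<bar>w\<bar>"
    proof (cases "lam q \<le> \<bar>w\<bar>")
      case True
      have "lam q * \<bar>t\<bar> \<le> lam q * 1" using t1 l by (intro mult_left_mono) auto
      then have "lam q * \<bar>t\<bar> \<le> \<bar>w\<bar>" using True by linarith
      then have "\<bar>t\<bar> \<le> 1 / lam q * \<bar>w\<bar>" using l by (simp add: field_simps)
      also have "\<dots> \<le> \<rho> * \<bar>w\<bar>" by (intro mult_right_mono) (auto simp: \<rho>_def)
      finally show ?thesis .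
    next
      case False
      have "\<bar>a\<bar> = 1"
      proof (rule ccontr)
        assume "\<bar>a\<bar> \<noteq> 1"
        then have "2 \<le> \<bar>a\<bar>" using a by linarith
        then have "2 * lam q \<le> real_of_int \<bar>a\<bar> * lam q"
          using l by (intro mult_right_mono) auto
        also have "\<dots> = \<bar>of_int a * lam q\<bar>" using l by (simp add: abs_mult)
        finally show False using t1 False l unfolding w_def by linarith
      qed
      then have "\<bar>of_int a * lam q\<bar> = lam q" using l by (simp add: abs_mult flip: of_int_abs)
      then have "\<bar>t\<bar> \<le> lam q - 1"
        using w1 False t1 l unfolding w_def by linarith
      also have "\<dots> \<le> (lam q - 1) * \<bar>w\<bar>" using w1 l by simp
      also have "\<dots> \<le> \<rho> * \<bar>w\<bar>" by (intro mult_right_mono) (auto simp: \<rho>_def)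
      finally show ?thesis .
    qed
    then show "\<bar>t\<bar> * \<bar>1 / (of_int a * lam q + t)\<bar> \<le> \<rho>"
      using w0 unfolding w_def[symmetric] by (simp add: abs_divide divide_le_eq)
  qed
qed

lemma neg_inverse_diff:
  fixes u v s t w :: real
  assumes "u = - 1 / (w + s)" "v = - 1 / (w + t)" "w + s \<noteq> 0" "w + t \<noteq> 0"
  shows "\<bar>u - v\<bar> = \<bar>u\<bar> * \<bar>v\<bar> * \<bar>s - t\<bar>"
proof -
  have "u - v = u * v * (s - t)"
    using assms(3,4) unfolding assms(1,2) by (simp add: divide_simps)
  then show ?thesis by (simp add: abs_mult)
qed

text \<open>Serves to compare two truncations as well as a truncation with a given sequence of
  tails. Two steps gain \<rho> from the values u, while the values v contribute at most Rc^2 \<le>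
  1; the remaining gap is at most 2 Rc \<le> 2.\<close>

lemma tails_close:
  assumes q: "3 \<le> q" and \<rho>: "0 \<le> \<rho>"
    "\<And>a t. \<lbrakk>a \<noteq> 0; \<bar>t\<bar> \<le> Rc q; \<bar>1 / (of_int a * lam q + t)\<bar> \<le> Rc q\<rbrakk>
      \<Longrightarrow> \<bar>t\<bar> * \<bar>1 / (of_int a * lam q + t)\<bar> \<le> \<rho>"
  shows "\<lbrakk>\<And>k. k < n \<Longrightarrow> d k \<noteq> 0; \<And>k. k < n \<Longrightarrow> u k = - 1 / (of_int (d k) * lam q + u (Suc k));
      \<And>k. k < n \<Longrightarrow> v k = - 1 / (of_int (d k) * lam q + v (Suc k));
      \<And>k. k \<le> n \<Longrightarrow> \<bar>u k\<bar> \<le> Rc q; \<And>k. k \<le> n \<Longrightarrow> \<bar>v k\<bar> \<le> Rc q\<rbrakk>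
    \<Longrightarrow> \<bar>u 0 - v 0\<bar> \<le> \<rho> ^ (n div 2) * 2"
proof (induction n arbitrary: d u v rule: less_induct)
  case (less n)
  note R = Rc_bounds(2)[OF q]
  show ?case
  proof (cases "n < 2")
    case True
    then show ?thesis using less.prems(4,5)[of 0] R by simp
  next
    case False
    then obtain m where n: "n = Suc (Suc m)" by (metis less_2_cases_iff not0_implies_Suc One_nat_def)
    have IH: "\<bar>u 2 - v 2\<bar> \<le> \<rho> ^ (m div 2) * 2"
      using less.IH[of m "\<lambda>k. d (Suc (Suc k))" "\<lambda>k. u (Suc (Suc k))" "\<lambda>k. v (Suc (Suc k))"] less.prems n
      by (simp add: numeral_2_eq_2)
    have nz: "of_int (d k) * lam q + u (Suc k) \<noteq> 0" "of_int (d k) * lam q + v (Suc k) \<noteq> 0" if "k < n" for k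
      using digit_denominator_nonzero[OF q less.prems(1)[OF that]]
        less.prems(4)[of "Suc k"] less.prems(5)[of "Suc k"] that by simp_all
    have e: "\<bar>u k - v k\<bar> = \<bar>u k\<bar> * \<bar>v k\<bar> * \<bar>u (Suc k) - v (Suc k)\<bar>" if "k < n" for k
      using less.prems(2,3)[OF that] nz[OF that] by (rule neg_inverse_diff)
    have "\<bar>u 1\<bar> * \<bar>u 0\<bar> \<le> \<rho>"
      using \<rho>(2)[of "d 0" "u 1"] less.prems(1,2,4)[of 0] less.prems(4)[of 1] n by simp
    moreover have "\<bar>v 0\<bar> * \<bar>v 1\<bar> \<le> 1"
      using less.prems(5)[of 0] less.prems(5)[of 1] R n mult_mono[of "\<bar>v 0\<bar>" 1 "\<bar>v 1\<bar>" 1] by simp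
    ultimately have "(\<bar>u 1\<bar> * \<bar>u 0\<bar>) * (\<bar>v 0\<bar> * \<bar>v 1\<bar>) * \<bar>u 2 - v 2\<bar> \<le> \<rho> * 1 * (\<rho> ^ (m div 2) * 2)"
      using IH \<rho>(1) by (intro mult_mono) auto
    moreover have "\<bar>u 0 - v 0\<bar> = (\<bar>u 1\<bar> * \<bar>u 0\<bar>) * (\<bar>v 0\<bar> * \<bar>v 1\<bar>) * \<bar>u 2 - v 2\<bar>"
      using e[of 0] e[of 1] n by (simp add: numeral_2_eq_2)
    ultimately show ?thesis using n by simp
  qed
qed

text \<open>The common ground of regular and dual regular expansions, on which convergence and the
  recursion for infinite expansions rest.\<close>

definition bounded_digits :: "nat \<Rightarrow> (nat \<Rightarrow> int) \<Rightarrow> bool" where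
  "bounded_digits q d \<longleftrightarrow> (\<forall>n. d n \<noteq> 0) \<and> (\<forall>m n. \<bar>cf_list q (map d [m..<n])\<bar> \<le> Rc q)"

lemma cf_list_upt:
  "k < n \<Longrightarrow> cf_list q (map d [k..<n]) = - 1 / (of_int (d k) * lam q + cf_list q (map d [Suc k..<n]))"
  by (simp add: upt_conv_Cons)

lemma power_div_2_tendsto_0:
  fixes \<rho> :: real
  assumes "0 \<le> \<rho>" "\<rho> < 1"
  shows "(\<lambda>n. \<rho> ^ (n div 2) * 2) \<longlonglongrightarrow> 0"
proof -
  have "filterlim (\<lambda>n::nat. n div 2) at_top at_top"
    unfolding filterlim_at_top
  proof
    show "\<forall>\<^sub>F n in sequentially. Z \<le> n div 2" for Z
      by (rule eventually_at_top_linorderI[of "2 * Z"]) auto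
  qed
  then have "(\<lambda>n. \<rho> ^ (n div 2)) \<longlonglongrightarrow> 0"
    using LIMSEQ_realpow_zero[OF assms] by (rule filterlim_compose[rotated])
  from tendsto_mult_right[OF this, of 2] show ?thesis by simp
qed

lemma cf_list_tendsto_tail:
  assumes q: "3 \<le> q" and d: "bounded_digits q d"
    and t: "\<And>n. t n = - 1 / (of_int (d n) * lam q + t (Suc n))" "\<And>n. \<bar>t n\<bar> \<le> Rc q"
  shows "(\<lambda>n. cf_list q (map d [0..<n])) \<longlonglongrightarrow> t 0"
proof -
  obtain \<rho> where \<rho>: "0 \<le> \<rho>" "\<rho> < 1"
    "\<And>a t. \<lbrakk>a \<noteq> 0; \<bar>t\<bar> \<le> Rc q; \<bar>1 / (of_int a * lam q + t)\<bar> \<le> Rc q\<rbrakk>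
      \<Longrightarrow> \<bar>t\<bar> * \<bar>1 / (of_int a * lam q + t)\<bar> \<le> \<rho>"
    using two_step_contraction[OF q] by blast
  have "\<bar>cf_list q (map d [0..<n]) - t 0\<bar> \<le> \<rho> ^ (n div 2) * 2" for n
  proof (rule tails_close[OF q \<rho>(1,3), where u = "\<lambda>k. cf_list q (map d [k..<n])" and v = t and d = d])
    show "t k = - 1 / (of_int (d k) * lam q + t (Suc k))" for k by (rule t(1))
  qed (use d t(2) in \<open>auto simp: bounded_digits_def cf_list_upt\<close>)
  then have "(\<lambda>n. cf_list q (map d [0..<n]) - t 0) \<longlonglongrightarrow> 0"
    by (intro Lim_null_comparison[OF _ power_div_2_tendsto_0[OF \<rho>(1,2)]]) auto
  then show ?thesis by (simp add: LIM_zero_iff)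
qed

text \<open>Lets limits be evaluated by guessing: a bounded sequence that obeys the tail recursion
  must be the sequence of tails.\<close>

lemma cf_inf_eq_tail:
  assumes "3 \<le> q" "bounded_digits q d"
    and "\<And>n. t n = - 1 / (of_int (d n) * lam q + t (Suc n))" "\<And>n. \<bar>t n\<bar> \<le> Rc q"
  shows "cf_inf q d = t 0"
  unfolding cf_inf_def by (rule limI, rule cf_list_tendsto_tail) (use assms in blast)+

lemma cf_list_tendsto_cf_inf:
  assumes q: "3 \<le> q" and d: "bounded_digits q d"
  shows "(\<lambda>n. cf_list q (map d [0..<n])) \<longlonglongrightarrow> cf_inf q d"
proof -
  obtain \<rho> where \<rho>: "0 \<le> \<rho>" "\<rho> < 1"
    "\<And>a t. \<lbrakk>a \<noteq> 0; \<bar>t\<bar> \<le> Rc q; \<bar>1 / (of_int a * lam q + t)\<bar> \<le> Rc q\<rbrakk>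
      \<Longrightarrow> \<bar>t\<bar> * \<bar>1 / (of_int a * lam q + t)\<bar> \<le> \<rho>"
    using two_step_contraction[OF q] by blast
  define c where "c n = cf_list q (map d [0..<n])" for n
  have close: "\<bar>c m - c n\<bar> \<le> \<rho> ^ (k div 2) * 2" if "k \<le> m" "k \<le> n" for k m n
    unfolding c_def using d that
    by (intro tails_close[OF q \<rho>(1,3), where u = "\<lambda>k. cf_list q (map d [k..<m])"
          and v = "\<lambda>k. cf_list q (map d [k..<n])" and d = d])
      (auto simp: bounded_digits_def cf_list_upt)
  have "Cauchy c"
  proof (rule metric_CauchyI)
    fix e :: real assume "0 < e"
    then obtain k where "\<rho> ^ (k div 2) * 2 < e"
      using order_tendstoD(2)[OF power_div_2_tendsto_0[OF \<rho>(1,2)]]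
      by (meson eventually_at_top_linorder order_refl)
    then show "\<exists>M. \<forall>m\<ge>M. \<forall>n\<ge>M. dist (c m) (c n) < e"
      using close[of k] by (auto simp: dist_real_def intro!: exI[of _ k] intro: le_less_trans)
  qed
  then have "convergent c" by (rule Cauchy_convergent)
  then show ?thesis unfolding cf_inf_def c_def by (simp add: convergent_LIMSEQ_iff)
qed

lemma bounded_digits_Suc: "bounded_digits q d \<Longrightarrow> bounded_digits q (\<lambda>n. d (Suc n))"
proof -
  have "map (\<lambda>n. d (Suc n)) [m..<n] = map d [Suc m..<Suc n]" for m n
    by (rule nth_equalityI) (auto simp del: upt_Suc)
  then show "bounded_digits q d \<Longrightarrow> ?thesis" by (simp add: bounded_digits_def del: upt_Suc)
qed

lemma abs_cf_inf_le:
  assumes "3 \<le> q" "bounded_digits q d" "\<And>n. \<bar>cf_list q (map d [0..<n])\<bar> \<le> B"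
  shows "\<bar>cf_inf q d\<bar> \<le> B"
  using tendsto_rabs[OF cf_list_tendsto_cf_inf[OF assms(1,2)]] assms(3)
  by (intro LIMSEQ_le_const2) auto

lemma abs_cf_inf_le_Rc: "3 \<le> q \<Longrightarrow> bounded_digits q d \<Longrightarrow> \<bar>cf_inf q d\<bar> \<le> Rc q"
  by (rule abs_cf_inf_le) (auto simp: bounded_digits_def)

lemma cf_inf_rec:
  assumes q: "3 \<le> q" and d: "bounded_digits q d"
  shows "cf_inf q d = - 1 / (of_int (d 0) * lam q + cf_inf q (\<lambda>n. d (Suc n)))"
proof -
  note d' = bounded_digits_Suc[OF d]
  have "(\<lambda>n. cf_list q (map d [0..<Suc n])) \<longlonglongrightarrow> cf_inf q d"
    using cf_list_tendsto_cf_inf[OF q d] by (rule LIMSEQ_Suc)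
  moreover have "cf_list q (map d [0..<Suc n])
      = - 1 / (of_int (d 0) * lam q + cf_list q (map (\<lambda>n. d (Suc n)) [0..<n]))" for n
  proof -
    have "map (\<lambda>n. d (Suc n)) [0..<n] = map d [Suc 0..<Suc n]"
      by (rule nth_equalityI) (auto simp del: upt_Suc)
    then show ?thesis by (simp only: cf_list_upt[OF zero_less_Suc])
  qed
  moreover have "(\<lambda>n. - 1 / (of_int (d 0) * lam q + cf_list q (map (\<lambda>n. d (Suc n)) [0..<n])))
      \<longlonglongrightarrow> - 1 / (of_int (d 0) * lam q + cf_inf q (\<lambda>n. d (Suc n)))"
    using digit_denominator_nonzero[OF q _ abs_cf_inf_le_Rc[OF q d']] d
    by (intro tendsto_intros cf_list_tendsto_cf_inf[OF q d']) (auto simp: bounded_digits_def)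
  ultimately show ?thesis using LIMSEQ_unique by (simp only:) blast
qed

lemma cf_inf_nonzero: "3 \<le> q \<Longrightarrow> bounded_digits q d \<Longrightarrow> cf_inf q d \<noteq> 0"
  using cf_inf_rec[of q d] digit_denominator_nonzero[OF _ _ abs_cf_inf_le_Rc[OF _ bounded_digits_Suc]]
  by (simp add: bounded_digits_def)

text \<open>The word leads from the tail r behind it to the value s in front of it, and all values
  on the way stay in [-Rc, 0]. Such words can be joined end to end, which is how the periods are
  assembled.\<close>

fun pos_path :: "nat \<Rightarrow> int list \<Rightarrow> real \<Rightarrow> real \<Rightarrow> bool" where
  "pos_path q [] r s \<longleftrightarrow> - Rc q \<le> r \<and> r \<le> 0 \<and> s = r"
| "pos_path q (d # ds) r s \<longleftrightarrow> 1 \<le> d \<and> - Rc q \<le> s \<and> s \<le> 0 \<and>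
     (\<exists>t. pos_path q ds r t \<and> s = - 1 / (of_int d * lam q + t))"

lemma pos_path_cft: "pos_path q ds r s \<Longrightarrow> cft q ds r = s"
  by (induction ds arbitrary: s) auto

lemma pos_path_bounds: "pos_path q ds r s \<Longrightarrow> - Rc q \<le> s \<and> s \<le> 0"
  by (cases ds) auto

lemma pos_path_append:
  "pos_path q u s t \<Longrightarrow> pos_path q v r s \<Longrightarrow> pos_path q (u @ v) r t"
  by (induction u arbitrary: t) (auto dest: pos_path_bounds)

lemma pos_path_drop: "pos_path q ds r s \<Longrightarrow> \<exists>t. pos_path q (drop k ds) r t"
proof (induction ds arbitrary: s k)
  case (Cons d ds)
  then show ?case by (cases k) auto
qed auto

lemma pos_path_digit: "pos_path q ds r s \<Longrightarrow> n < length ds \<Longrightarrow> 1 \<le> ds ! n"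
proof (induction ds arbitrary: s n)
  case (Cons d ds)
  then show ?case by (cases n) auto
qed simp

text \<open>Each step is increasing in the tail, so replacing the true tail at the end by 0 only
  raises the values: truncations are caught between t and 0. Boundedness of the digits is thus
  obtained from the closed forms themselves.\<close>

lemma cf_inf_pos_digits:
  assumes q: "3 \<le> q" and d: "\<And>n. 1 \<le> d n"
    and t: "\<And>n. t n = - 1 / (of_int (d n) * lam q + t (Suc n))" "\<And>n. - Rc q \<le> t n" "\<And>n. t n \<le> 0"
  shows "cf_inf q d = t 0"
proof (rule cf_inf_eq_tail[OF q])
  have b: "t m \<le> cf_list q (map d [m..<n]) \<and> cf_list q (map d [m..<n]) \<le> 0" for m n
  proof (cases "m \<le> n")
    case True
    then show ?thesis
    proof (induction m rule: inc_induct)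
      case base
      then show ?case using t(3) by simp
    next
      case (step m)
      have "0 < of_int (d m) * lam q + t (Suc m)"
        using mult_lam_ge[OF q d, of m] t(2)[of "Suc m"] Rc_bounds(4)[OF q] by simp
      moreover from this have "0 < of_int (d m) * lam q + cf_list q (map d [Suc m..<n])"
        using step.IH by linarith
      ultimately have "- 1 / (of_int (d m) * lam q + t (Suc m))
          \<le> - 1 / (of_int (d m) * lam q + cf_list q (map d [Suc m..<n]))"
        and "0 < of_int (d m) * lam q + cf_list q (map d [Suc m..<n])"
        using step.IH by (simp_all only: neg_inverse_le_iff add_le_cancel_left)
      then show ?case
        using t(1)[of m] cf_list_upt[OF step.hyps(2), of q d] by simp
    qed
  next
    case False
    then show ?thesis using t(3) by simp
  qed
  have "\<bar>cf_list q (map d [m..<n])\<bar> \<le> Rc q" for m n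
    using b[of m n] t(2)[of m] by linarith
  moreover have "d n \<noteq> 0" for n using d[of n] by linarith
  ultimately show "bounded_digits q d" by (auto simp: bounded_digits_def)
  show "\<bar>t n\<bar> \<le> Rc q" for n using t(2,3)[of n] by linarith
qed (rule t(1))

lemma cf_per_eq:
  assumes q: "3 \<le> q" and p: "pos_path q p r r" "p \<noteq> []" and w: "pos_path q w r s"
  shows "cf_per q w p = s"
proof -
  \<comment> \<open>The candidate for the tail at n is what remains of the current word, evaluated
    at r, the value at the start of every period.\<close>
  define t where "t n = (if n < length w then cft q (drop n w) r
     else cft q (drop ((n - length w) mod length p) p) r)" for n
  have l: "0 < length p" using p by simp
  have r: "cft q p r = r" using pos_path_cft[OF p(1)] .
  have "cf_per q w p = t 0"
    unfolding cf_per_def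
  proof (rule cf_inf_pos_digits[OF q])
    show "1 \<le> ev_periodic w p n" for n
      using pos_path_digit[OF w] pos_path_digit[OF p(1)] l by (simp add: ev_periodic_def)
    show "- Rc q \<le> t n" "t n \<le> 0" for n
      using pos_path_drop[OF w] pos_path_drop[OF p(1)] pos_path_bounds pos_path_cft
      unfolding t_def by metis+
    show "t n = - 1 / (of_int (ev_periodic w p n) * lam q + t (Suc n))" for n
    proof (cases "n < length w")
      case True
      have "cft q (drop (Suc n) w) r = t (Suc n)"
        using True r by (cases "Suc n < length w") (auto simp: t_def not_less)
      then show ?thesis
        using True by (simp add: t_def ev_periodic_def Cons_nth_drop_Suc[symmetric])
    next
      case False
      define m where "m = (n - length w) mod length p"
      have m: "m < length p" using l by (simp add: m_def)
      have "Suc n - length w = Suc (n - length w)" using False by simp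
      then have "(Suc n - length w) mod length p = (if Suc m = length p then 0 else Suc m)"
        by (simp add: m_def mod_Suc)
      then have "cft q (drop (Suc m) p) r = t (Suc n)"
        using False r m by (auto simp: t_def not_less)
      then show ?thesis
        using False m by (simp add: t_def ev_periodic_def m_def[symmetric] Cons_nth_drop_Suc[symmetric])
    qed
  qed
  also have "t 0 = s"
    using pos_path_cft[OF w] r w by (cases w) (auto simp: t_def)
  finally show ?thesis .
qed

lemmas [simp del] = pos_path.simps

lemma pos_path_single:
  assumes "3 \<le> q" "1 \<le> d" "i \<le> kappa q" "j \<le> kappa q" "psc q i = - 1 / (of_int d * lam q + psc q j)"
  shows "pos_path q [d] (psc q j) (psc q i)"
  using assms psc_ge[of q i] psc_ge[of q j] psc_neg[of q i] psc_neg[of q j]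
  by (auto simp: pos_path.simps)

lemma pos_path_Nil: "3 \<le> q \<Longrightarrow> i \<le> kappa q \<Longrightarrow> pos_path q [] (psc q i) (psc q i)"
  using psc_ge[of q i] psc_neg[of q i] by (auto simp: pos_path.simps)

lemma pos_path_Cons:
  assumes "pos_path q [d] s t" "pos_path q ds r s" shows "pos_path q (d # ds) r t"
  using pos_path_append[OF assms] by simp

lemma pos_path_ones_even:
  assumes "3 \<le> q" "even q"
  shows "j + n \<le> kappa q \<Longrightarrow> pos_path q (replicate n 1) (psc q (j + n)) (psc q j)"
proof (induction n arbitrary: j)
  case (Suc n)
  have "pos_path q [1] (psc q (j + 1)) (psc q j)"
    using Suc.prems psc_rec_even[OF assms, of j] by (intro pos_path_single assms) auto
  moreover have "pos_path q (replicate n 1) (psc q (j + 1 + n)) (psc q (j + 1))"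
    using Suc.prems by (intro Suc.IH) simp
  ultimately show ?case using pos_path_Cons by fastforce
qed (use pos_path_Nil[OF assms(1)] in auto)

lemma pos_path_ones_odd:
  assumes "3 \<le> q" "odd q"
  shows "j + 2 * n \<le> kappa q \<Longrightarrow> pos_path q (replicate n 1) (psc q (j + 2 * n)) (psc q j)"
proof (induction n arbitrary: j)
  case (Suc n)
  have "pos_path q [1] (psc q (j + 2)) (psc q j)"
    using Suc.prems psc_rec_odd[OF assms, of j] by (intro pos_path_single assms) auto
  moreover have "pos_path q (replicate n 1) (psc q (j + 2 + 2 * n)) (psc q (j + 2))"
    using Suc.prems by (intro Suc.IH) simp
  ultimately show ?case using pos_path_Cons by fastforce
qed (use pos_path_Nil[OF assms(1)] in auto)

lemma pos_path_two_even:
  assumes "3 \<le> q" "even q"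
  shows "pos_path q [2] (psc q 1) (psc q (kappa q))"
  using kappa_ge_1[OF assms(1)] psc_even_kappa[OF assms] psc_1[OF assms(1)] assms(2)
  by (intro pos_path_single assms) (auto simp: Rc_def)

lemma pos_path_two_odd:
  assumes q: "3 \<le> q" "odd q"
  shows "pos_path q [2] (psc q 1) (psc q (kappa q - 1))"
    and "2 \<le> kappa q \<Longrightarrow> pos_path q [2] (psc q 2) (psc q (kappa q))"
proof -
  show "pos_path q [2] (psc q 1) (psc q (kappa q - 1))"
    using kappa_ge_1[OF q(1)] psc_odd_penultimate[OF q] psc_1[OF q(1)]
    by (intro pos_path_single q) auto
  assume "2 \<le> kappa q"
  then show "pos_path q [2] (psc q 2) (psc q (kappa q))"
    using psc_odd_kappa[OF q] psc_2_odd[OF q] by (intro pos_path_single q) auto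
qed

lemma psi_even:
  assumes q: "3 \<le> q" "even q"
  shows "j \<le> kappa q \<Longrightarrow> psi q j = psc q j" and "rq q = psc q 1"
proof -
  note h = even_hq[OF q]
  have o: "pos_path q (replicate (hq q - 1) 1) (psc q (kappa q)) (psc q 1)"
    using pos_path_ones_even[OF q, of 1 "hq q - 1"] h by simp
  have "pos_path q ([2] @ replicate (hq q - 1) 1) (psc q (kappa q)) (psc q (kappa q))"
    using pos_path_append[OF pos_path_two_even[OF q] o] .
  moreover have "pos_path q (replicate (hq q - j) 1) (psc q (kappa q)) (psc q j)" if "j \<le> kappa q"
    using pos_path_ones_even[OF q, of j "hq q - j"] h that by simp
  ultimately show "psi q j = psc q j" if "j \<le> kappa q"
    using that q by (auto simp: psi_def intro!: cf_per_eq)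
  have "pos_path q (replicate (hq q - 1) 1 @ [2]) (psc q 1) (psc q 1)"
    using pos_path_append[OF o pos_path_two_even[OF q]] .
  then show "rq q = psc q 1"
    using q pos_path_Nil[OF q(1) kappa_ge_1[OF q(1)]] by (auto simp: rq_def intro!: cf_per_eq)
qed

text \<open>The two strings of ones and the two digits 2 form a single cycle through the indices 1,
  kappa, 2, kappa - 1. The three periods in the definitions are this cycle read from different
  points.\<close>

lemma psi_odd:
  assumes q: "5 \<le> q" "odd q"
  shows "j \<le> kappa q \<Longrightarrow> psi q j = psc q j" and "rq q = psc q 1"
proof -
  have q3: "3 \<le> q" using q by simp
  note h = odd_hq[OF q3 q(2)]
  define k where "k = hq q"
  have k: "1 \<le> k" "kappa q = 2 * k + 1" using h q by (auto simp: k_def)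
  have e: "1 + 2 * k = kappa q" "2 + 2 * (k - 1) = 2 * k" "kappa q - 1 = 2 * k" using k by auto
  have o1: "pos_path q (replicate k 1) (psc q (kappa q)) (psc q 1)"
    using pos_path_ones_odd[OF q3 q(2), of 1 k] e by simp
  have o2: "pos_path q (replicate (k - 1) 1) (psc q (2 * k)) (psc q 2)"
    using pos_path_ones_odd[OF q3 q(2), of 2 "k - 1"] e k by simp
  have t1: "pos_path q [2] (psc q 1) (psc q (2 * k))" and t2: "pos_path q [2] (psc q 2) (psc q (kappa q))"
    using pos_path_two_odd[OF q3 q(2)] e k by simp_all
  note A = pos_path_append
  have p1: "pos_path q ([2] @ replicate k 1 @ [2] @ replicate (k - 1) 1) (psc q (2 * k)) (psc q (2 * k))"
    using A[OF t1 A[OF o1 A[OF t2 o2]]] .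
  have p2: "pos_path q ([2] @ replicate (k - 1) 1 @ [2] @ replicate k 1) (psc q (kappa q)) (psc q (kappa q))"
    using A[OF t2 A[OF o2 A[OF t1 o1]]] .
  have p3: "pos_path q (replicate k 1 @ [2] @ replicate (k - 1) 1 @ [2]) (psc q 1) (psc q 1)"
    using A[OF o1 A[OF t2 A[OF o2 t1]]] .
  show "rq q = psc q 1"
    using q p3 pos_path_Nil[OF q3 kappa_ge_1[OF q3]]
    by (auto simp: rq_def k_def intro!: cf_per_eq[OF q3])
  assume j: "j \<le> kappa q"
  show "psi q j = psc q j"
  proof (cases "even j")
    case True
    have "j + 2 * (k - j div 2) = 2 * k" using True j k by auto
    then have "pos_path q (replicate (k - j div 2) 1) (psc q (2 * k)) (psc q j)"
      using pos_path_ones_odd[OF q3 q(2), of j "k - j div 2"] k by simp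
    then show ?thesis
      using True q p1 by (auto simp: psi_def k_def intro!: cf_per_eq[OF q3])
  next
    case False
    have "j + 2 * (k - j div 2) = kappa q" using False j k by presburger
    then have "pos_path q (replicate (k - j div 2) 1) (psc q (kappa q)) (psc q j)"
      using pos_path_ones_odd[OF q3 q(2), of j "k - j div 2"] k by simp
    then show ?thesis
      using False q p2 by (auto simp: psi_def k_def intro!: cf_per_eq[OF q3])
  qed
qed

lemma psi_3: "rq 3 = psc 3 1" "psi 3 1 = psc 3 1"
proof -
  have k: "kappa 3 = 1" by (simp add: kappa_def hq_def)
  have R: "1 / Rc 3 = 1 + Rc 3" using odd_h0[of 3] k by simp
  \<comment> \<open>The closing relation at kappa = 1 reads -1/(2 + Rc), and 2 + Rc = 3 lam +
    \<open>psc 3 1\<close> because lam = 1.\<close>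
  have "psc 3 1 = - 1 / (of_int 3 * lam 3 + psc 3 1)"
    using psc_odd_kappa[of 3] psc_1[of 3] k R by (simp add: lam_3)
  then have "pos_path 3 [3] (psc 3 1) (psc 3 1)" using k by (intro pos_path_single) auto
  then show "rq 3 = psc 3 1"
    using pos_path_Nil[of 3 1] k by (auto simp: rq_def intro!: cf_per_eq)
  then show "psi 3 1 = psc 3 1" by (simp add: psi_def)
qed

lemma rq_eq: "3 \<le> q \<Longrightarrow> rq q = psc q 1"
proof -
  assume "3 \<le> q"
  then have "even q \<or> q = 3 \<or> odd q \<and> 5 \<le> q" by presburger
  then consider "even q" | "q = 3" | "odd q" "5 \<le> q" by blast
  then show ?thesis using \<open>3 \<le> q\<close> psi_even psi_odd psi_3 by cases auto
qed

text \<open>The range starts at 1 because the rectangles only use the indices kappa - i + 1 \<ge>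
  1.\<close>

lemma psi_eq: "3 \<le> q \<Longrightarrow> 1 \<le> j \<Longrightarrow> j \<le> kappa q \<Longrightarrow> psi q j = psc q j"
proof -
  assume a: "3 \<le> q" "1 \<le> j" "j \<le> kappa q"
  then consider "even q" | "q = 3" "j = 1" | "odd q" "5 \<le> q"
  proof -
    have "even q \<or> q = 3 \<or> odd q \<and> 5 \<le> q" using a(1) by presburger
    moreover have "j = 1" if "q = 3" using a that by (simp add: kappa_def hq_def)
    ultimately show ?thesis using that by blast
  qed
  then show ?thesis using a psi_even psi_odd psi_3 by cases auto
qed

lemma Rq_eq: "3 \<le> q \<Longrightarrow> Rq q = Rc q"
  by (simp add: Rq_def rq_eq psc_1[simplified])

section \<open>Two-sided sequences\<close>

lemma forbidden_Nil: "[] \<notin> forbidden q"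
  by (auto simp: forbidden_def)

lemma map_upt_split:
  assumes "m \<le> n" shows "map d [0..<n] = map d [0..<m] @ map d [m..<n]"
proof -
  have "[0..<n] = [0..<m] @ [m..<n]"
    using upt_add_eq_append[of 0 m "n - m"] assms by simp
  then show ?thesis by (metis map_append)
qed

lemma reglist_infixD: "reglist q ds \<Longrightarrow> ds = u @ v @ w \<Longrightarrow> v \<notin> forbidden q"
  unfolding reglist_def by blast

lemma map_upt_infix:
  assumes "map d [0..<n] = u @ v @ w"
  shows "v = map d [length u..<length u + length v]" "length u + length v \<le> n"
proof -
  have len: "n = length u + length v + length w"
    using arg_cong[OF assms, of length] by simp
  then show "length u + length v \<le> n" by simp
  show "v = map d [length u..<length u + length v]"
  proof (rule nth_equalityI)
    fix i assume i: "i < length v"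
    have "(u @ v @ w) ! (length u + i) = v ! i" using i by (simp add: nth_append)
    moreover have "map d [0..<n] ! (length u + i) = d (length u + i)" using i len by simp
    ultimately show "v ! i = map d [length u..<length u + length v] ! i"
      using i assms by simp
  qed simp
qed

text \<open>Passing from index ranges to prefixes makes the lemmas on finite words applicable to
  finite and infinite expansions alike.\<close>

lemma regular_iff:
  "regular q N d \<longleftrightarrow> (\<forall>n. enat n \<le> N \<longrightarrow> reglist q (map d [0..<n]))"
proof
  assume r: "regular q N d"
  show "\<forall>n. enat n \<le> N \<longrightarrow> reglist q (map d [0..<n])"
  proof (intro allI impI)
    fix n assume n: "enat n \<le> N"
    have "0 \<notin> set (map d [0..<n])"
    proof
      assume "0 \<in> set (map d [0..<n])"
      then obtain i where "i < n" "d i = 0" by auto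
      moreover from this have "enat i < N" using n less_le_trans[of "enat i" "enat n" N] by simp
      ultimately show False using r unfolding regular_def by blast
    qed
    \<comment> \<open>The blocks in the definition have k + 1 digits, so the empty infix needs a
      separate argument.\<close>
    moreover have "v \<notin> forbidden q" if e: "map d [0..<n] = u @ v @ w" for u v w
    proof (cases v rule: rev_cases)
      case Nil
      then show ?thesis by (simp add: forbidden_Nil)
    next
      case (snoc v' z)
      have "enat (length u + length v') < enat n" using map_upt_infix(2)[OF e] snoc by simp
      then have "enat (length u + length v') < N" using n by (rule less_le_trans)
      then have "map d [length u..<length u + length v' + 1] \<notin> forbidden q"
        using r unfolding regular_def by blast
      then show ?thesis using map_upt_infix(1)[OF e] snoc by simp
    qed
    ultimately show "reglist q (map d [0..<n])" by (simp add: reglist_def)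
  qed
next
  assume r: "\<forall>n. enat n \<le> N \<longrightarrow> reglist q (map d [0..<n])"
  have pre: "reglist q (map d [0..<Suc i])" if "enat i < N" for i
    using r that Suc_ile_eq[of i N] by blast
  have "d i \<noteq> 0" if "enat i < N" for i
    using pre[OF that] by (auto simp: reglist_def)
  moreover have "map d [l..<l + k + 1] \<notin> forbidden q" if "enat (l + k) < N" for l k
  proof -
    have "map d [0..<Suc (l + k)] = map d [0..<l] @ map d [l..<l + k + 1] @ []"
      using map_upt_split[of l "l + k + 1" d] by (simp del: upt_Suc)
    then show ?thesis by (rule reglist_infixD[OF pre[OF that]])
  qed
  ultimately show "regular q N d" by (simp add: regular_def)
qed

lemma dual_regular_iff:
  "dual_regular q N d \<longleftrightarrow> (\<forall>n. enat n \<le> N \<longrightarrow> reglist q (rev (map d [0..<n])))"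
proof
  assume r: "dual_regular q N d"
  show "\<forall>n. enat n \<le> N \<longrightarrow> reglist q (rev (map d [0..<n]))"
  proof (intro allI impI)
    fix n assume n: "enat n \<le> N"
    have "0 \<notin> set (rev (map d [0..<n]))"
    proof
      assume "0 \<in> set (rev (map d [0..<n]))"
      then obtain i where "i < n" "d i = 0" by auto
      moreover from this have "enat i < N" using n less_le_trans[of "enat i" "enat n" N] by simp
      ultimately show False using r unfolding dual_regular_def by blast
    qed
    moreover have "v \<notin> forbidden q" if e: "rev (map d [0..<n]) = u @ v @ w" for u v w
    proof (cases "rev v" rule: rev_cases)
      case Nil
      then show ?thesis by (simp add: forbidden_Nil)
    next
      case (snoc v' z)
      have "rev (rev (map d [0..<n])) = rev (u @ v @ w)" unfolding e ..
      then have e': "map d [0..<n] = rev w @ rev v @ rev u" by simp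
      have lv: "length v = length v' + 1" using arg_cong[OF snoc, of length] by simp
      have "enat (length w + length v') < enat n" using map_upt_infix(2)[OF e'] lv by simp
      then have "enat (length w + length v') < N" using n by (rule less_le_trans)
      then have "rev (map d [length w..<length w + length v' + 1]) \<notin> forbidden q"
        using r unfolding dual_regular_def by blast
      moreover have "rev v = map d [length w..<length w + length v' + 1]"
        using map_upt_infix(1)[OF e'] lv by simp
      ultimately show ?thesis by (metis rev_rev_ident)
    qed
    ultimately show "reglist q (rev (map d [0..<n]))" unfolding reglist_def by blast
  qed
next
  assume r: "\<forall>n. enat n \<le> N \<longrightarrow> reglist q (rev (map d [0..<n]))"
  have pre: "reglist q (rev (map d [0..<Suc i]))" if "enat i < N" for i
    using r that Suc_ile_eq[of i N] by blast
  have "d i \<noteq> 0" if "enat i < N" for i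
    using pre[OF that] by (auto simp: reglist_def)
  moreover have "rev (map d [l..<l + k + 1]) \<notin> forbidden q" if "enat (l + k) < N" for l k
  proof -
    have "map d [0..<Suc (l + k)] = map d [0..<l] @ map d [l..<l + k + 1]"
      using map_upt_split[of l "l + k + 1" d] by (simp del: upt_Suc)
    then have "rev (map d [0..<Suc (l + k)]) = [] @ rev (map d [l..<l + k + 1]) @ rev (map d [0..<l])"
      by (simp only: rev_append append_Nil)
    then show ?thesis by (rule reglist_infixD[OF pre[OF that]])
  qed
  ultimately show "dual_regular q N d" by (simp add: dual_regular_def)
qed

lemma lam_half_le_Rc: "3 \<le> q \<Longrightarrow> lam q / 2 \<le> Rc q"
  using Rc_bounds(1)[of q] by simp

lemma reglist_upt:
  assumes "reglist q (map d [0..<n])" shows "reglist q (map d [m..<n])"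
proof (cases "m \<le> n")
  case True
  then have "map d [0..<n] = map d [0..<m] @ map d [m..<n]"
    by (rule map_upt_split)
  then show ?thesis using assms reglist_append[of q "map d [0..<m]" "map d [m..<n]"] by simp
next
  case False
  then show ?thesis by (simp add: reglist_def forbidden_Nil)
qed

text \<open>With an empty right word the pair is (0, y), so the bound for reversed words is read off
  from the domain.\<close>

lemma cf_list_rev_bound:
  assumes "3 \<le> q" "reglist q (rev es)" shows "\<bar>cf_list q es\<bar> \<le> Rc q"
  using reglist_Dc[OF assms(1), of es "[]"] assms(2) Dc_bounds(2)[OF assms(1)] by simp

lemma regular_bounded_digits:
  assumes q: "3 \<le> q" and r: "regular q \<infinity> d"
  shows "bounded_digits q d"
proof -
  have "reglist q (map d [m..<n])" for m n
    by (rule reglist_upt) (use r in \<open>simp add: regular_iff\<close>)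
  then have "\<bar>cf_list q (map d [m..<n])\<bar> \<le> Rc q" for m n
    using cf_list_bound[OF q] lam_half_le_Rc[OF q] order_trans by blast
  then show ?thesis using r by (simp add: bounded_digits_def regular_def)
qed

lemma dual_regular_bounded_digits:
  assumes q: "3 \<le> q" and r: "dual_regular q \<infinity> d"
  shows "bounded_digits q d"
proof -
  have "reglist q (rev (map d [m..<n]))" for m n
  proof (cases "m \<le> n")
    case True
    then have "map d [0..<n] = map d [0..<m] @ map d [m..<n]"
      by (rule map_upt_split)
    then have e: "rev (map d [0..<n]) = rev (map d [m..<n]) @ rev (map d [0..<m])"
      by (simp only: rev_append)
    have "reglist q (rev (map d [0..<n]))" using r by (simp add: dual_regular_iff)
    then show ?thesis unfolding e using reglist_append by blast
  qed (simp add: reglist_def forbidden_Nil)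
  then have "\<bar>cf_list q (map d [m..<n])\<bar> \<le> Rc q" for m n
    by (rule cf_list_rev_bound[OF q])
  then show ?thesis using r by (simp add: bounded_digits_def dual_regular_def)
qed

lemma regular_cf_inf_bound:
  assumes "3 \<le> q" "regular q \<infinity> d" shows "\<bar>cf_inf q d\<bar> \<le> lam q / 2"
  using assms cf_list_bound[OF assms(1)]
  by (intro abs_cf_inf_le regular_bounded_digits) (auto simp: regular_iff)

lemma map_Suc_shift: "map (\<lambda>n. d (Suc n)) [m..<n] = map d [Suc m..<Suc n]"
  by (rule nth_equalityI) (auto simp del: upt_Suc)

lemma regular_Suc: "regular q \<infinity> d \<Longrightarrow> regular q \<infinity> (\<lambda>n. d (Suc n))"
proof -
  assume "regular q \<infinity> d"
  then have "reglist q (map d [Suc 0..<Suc n])" for n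
    by (intro reglist_upt[where m = "Suc 0" and n = "Suc n"]) (simp add: regular_iff del: upt_Suc)
  then show ?thesis unfolding regular_iff map_Suc_shift by blast
qed

lemma dual_regular_Suc: "dual_regular q \<infinity> d \<Longrightarrow> dual_regular q \<infinity> (\<lambda>n. d (Suc n))"
proof -
  assume d: "dual_regular q \<infinity> d"
  have "reglist q (rev (map d [Suc 0..<Suc n]))" for n
  proof -
    have "reglist q (rev (map d [0..<Suc n]))" using d unfolding dual_regular_iff by (simp del: upt_Suc)
    moreover have e: "rev (map d [0..<Suc n]) = rev (map d [Suc 0..<Suc n]) @ [d 0]"
      by (simp add: upt_conv_Cons del: upt_Suc)
    ultimately show ?thesis unfolding e using reglist_append by blast
  qed
  then show ?thesis unfolding dual_regular_iff map_Suc_shift by simp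
qed

lemma uminus_digits: "map (\<lambda>n. - d n) [m..<n] = map uminus (map d [m..<n])" for d :: "nat \<Rightarrow> int"
  by simp

lemma regular_uminus: "regular q \<infinity> d \<Longrightarrow> regular q \<infinity> (\<lambda>n. - d n)"
  unfolding regular_iff uminus_digits using reglist_uminus by blast

lemma dual_regular_uminus: "dual_regular q \<infinity> d \<Longrightarrow> dual_regular q \<infinity> (\<lambda>n. - d n)"
  unfolding dual_regular_iff uminus_digits rev_map[of uminus] using reglist_uminus by blast

lemma cf_inf_uminus:
  assumes "3 \<le> q" "bounded_digits q d"
  shows "cf_inf q (\<lambda>n. - d n) = - cf_inf q d"
  unfolding cf_inf_def[of q "\<lambda>n. - d n"] uminus_digits cf_list_uminus
  by (intro limI tendsto_minus cf_list_tendsto_cf_inf assms)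

text \<open>Constant in n for a finite expansion. Truncations then converge in either case, and
  closedness of the domain treats all four combinations of finite and infinite sides at
  once.\<close>

definition trunc :: "enat \<Rightarrow> nat \<Rightarrow> nat" where
  "trunc N n = (case N of enat k \<Rightarrow> k | \<infinity> \<Rightarrow> n)"

lemma trunc_le: "enat (trunc N n) \<le> N"
  by (cases N) (auto simp: trunc_def)

lemma cf_list_tendsto_cf:
  assumes "3 \<le> q" "N = \<infinity> \<Longrightarrow> bounded_digits q d"
  shows "(\<lambda>n. cf_list q (map d [0..<trunc N n])) \<longlonglongrightarrow> cf q N d"
  using assms cf_list_tendsto_cf_inf[OF assms(1)] by (cases N) (auto simp: trunc_def cf_def)

lemma Dc_eq: "Dc q = (\<Union>i\<in>{1..kappa q}.
    ({phi q (i - 1)..phi q i} \<times> {psc q (kappa q - i + 1)..Rc q}) \<union>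
    ({- phi q i..- phi q (i - 1)} \<times> {- Rc q..- psc q (kappa q - i + 1)}))"
  by (auto simp: Dc_def negD_def minus_le_iff le_minus_iff)

lemma closed_Dc: "closed (Dc q)"
  unfolding Dc_eq by (intro closed_UN ballI closed_Un closed_Times) auto

text \<open>The left digits start at position 0 and run downwards, so m of them occupy the positions
  1 - m to 0.\<close>

lemma digits_window:
  "rev (map (left_digits a) [0..<m]) @ map (right_digits a) [0..<n] = map a [1 - int m..int n]"
proof (rule nth_equalityI)
  fix i assume "i < length (rev (map (left_digits a) [0..<m]) @ map (right_digits a) [0..<n])"
  then have i: "i < m + n" by simp
  have "nat (int n - (1 - int m) + 1) = m + n" by simp
  then have "map a [1 - int m..int n] ! i = a (1 - int m + int i)"
    using i by (simp add: nth_map nth_upto)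
  moreover have "(rev (map (left_digits a) [0..<m]) @ map (right_digits a) [0..<n]) ! i
      = a (1 - int m + int i)"
  proof (cases "i < m")
    case True
    then show ?thesis
      by (simp add: nth_append rev_nth left_digits_def of_nat_diff algebra_simps)
  next
    case False
    then show ?thesis using i by (simp add: nth_append right_digits_def of_nat_diff algebra_simps)
  qed
  ultimately show "(rev (map (left_digits a) [0..<m]) @ map (right_digits a) [0..<n]) ! i
      = map a [1 - int m..int n] ! i" by simp
qed simp

lemma upto_infix:
  assumes "[l..r] = u @ v @ w"
  shows "v = [l + int (length u)..l + int (length u) + int (length v) - 1]"
    "length v \<noteq> 0 \<Longrightarrow> l + int (length u) + int (length v) - 1 \<le> r"
proof -
  have len: "nat (r - l + 1) = length u + length v + length w"
    using arg_cong[OF assms, of length] by simp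
  then show "length v \<noteq> 0 \<Longrightarrow> l + int (length u) + int (length v) - 1 \<le> r" by linarith
  show "v = [l + int (length u)..l + int (length u) + int (length v) - 1]"
  proof (rule nth_equalityI)
    fix i assume i: "i < length v"
    have "(u @ v @ w) ! (length u + i) = v ! i" using i by (simp add: nth_append)
    moreover have "[l..r] ! (length u + i) = l + int (length u + i)"
      using i len by (intro nth_upto) linarith
    moreover have "[l + int (length u)..l + int (length u) + int (length v) - 1] ! i
        = l + int (length u) + int i"
      using i by (intro nth_upto) linarith
    ultimately show "v ! i = [l + int (length u)..l + int (length u) + int (length v) - 1] ! i"
      using assms by simp
  qed simp
qed

lemma positions_window:
  assumes "enat m \<le> M" "enat n \<le> N"
  shows "{1 - int m..int n} \<subseteq> positions M N"
proof
  fix i assume i: "i \<in> {1 - int m..int n}"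
  show "i \<in> positions M N"
  proof (cases "i \<le> 0")
    case True
    then have "enat (nat (- i)) < enat m" using i by auto
    then have "enat (nat (- i)) < M" using assms(1) by (rule less_le_trans)
    then show ?thesis using True by (simp add: positions_def)
  next
    case False
    then have "enat (nat (i - 1)) < enat n" using i by auto
    then have "enat (nat (i - 1)) < N" using assms(2) by (rule less_le_trans)
    then show ?thesis using False by (simp add: positions_def)
  qed
qed

text \<open>Windows around the gap between the positions 0 and 1 exhaust all admissible blocks,
  which reduces two-sided sequences to finite words.\<close>

lemma Aq_term_iff:
  "a \<in> Aq_term q M N \<longleftrightarrow> (\<forall>m n. enat m \<le> M \<longrightarrow> enat n \<le> N \<longrightarrow>
     reglist q (rev (map (left_digits a) [0..<m]) @ map (right_digits a) [0..<n]))"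
proof
  assume a: "a \<in> Aq_term q M N"
  show "\<forall>m n. enat m \<le> M \<longrightarrow> enat n \<le> N \<longrightarrow>
     reglist q (rev (map (left_digits a) [0..<m]) @ map (right_digits a) [0..<n])"
    unfolding digits_window
  proof (intro allI impI)
    fix m n assume mn: "enat m \<le> M" "enat n \<le> N"
    note sub = positions_window[OF mn]
    have "0 \<notin> set (map a [1 - int m..int n])"
      using a sub by (auto simp: Aq_term_def)
    moreover have "v \<notin> forbidden q" if e: "map a [1 - int m..int n] = u @ v @ w" for u v w
    proof (cases "v = []")
      case True
      then show ?thesis by (simp add: forbidden_Nil)
    next
      case False
      obtain u' v' w' where e': "[1 - int m..int n] = u' @ v' @ w'" "v = map a v'"
        using e by (auto simp: map_eq_append_conv append_eq_map_conv)
      define l where "l = 1 - int m + int (length u')"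
      define k where "k = length v' - 1"
      have k: "int (length v') = int k + 1" using False e' by (cases v') (auto simp: k_def)
      then have v': "v' = [l..l + int k]" and r: "l + int k \<le> int n"
        using upto_infix[OF e'(1)] by (auto simp: l_def algebra_simps)
      have "{l..l + int k} \<subseteq> positions M N"
        using sub r by (auto simp: l_def intro!: subsetD[OF sub])
      then show ?thesis using a e' v' unfolding Aq_term_def by blast
    qed
    ultimately show "reglist q (map a [1 - int m..int n])" unfolding reglist_def by blast
  qed
next
  assume r: "\<forall>m n. enat m \<le> M \<longrightarrow> enat n \<le> N \<longrightarrow>
     reglist q (rev (map (left_digits a) [0..<m]) @ map (right_digits a) [0..<n])"
  have block: "reglist q (map a [l..l + int k])" if p: "{l..l + int k} \<subseteq> positions M N" for l and k :: nat
  proof -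
    \<comment> \<open>The smallest window that contains the block and touches the gap; if the block
      lies on one side only, m or n is 0.\<close>
    define m where "m = nat (1 - l)"
    define n where "n = nat (l + int k)"
    have "l \<in> positions M N" "l + int k \<in> positions M N" using p by auto
    note pos = this
    have m: "enat m \<le> M"
    proof (cases "l \<le> 0")
      case True
      then have "enat (nat (- l)) < M" "m = Suc (nat (- l))"
        using pos(1) by (auto simp: positions_def m_def)
      then show ?thesis by (simp add: Suc_ile_eq)
    qed (simp add: m_def zero_enat_def[symmetric])
    have n: "enat n \<le> N"
    proof (cases "1 \<le> l + int k")
      case True
      then have "enat (nat (l + int k - 1)) < N" "n = Suc (nat (l + int k - 1))"
        using pos(2) by (auto simp: positions_def n_def)
      then show ?thesis by (simp add: Suc_ile_eq)
    qed (simp add: n_def zero_enat_def[symmetric])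
    have "[1 - int m..int n] = [1 - int m..l - 1] @ [l..int n]"
      by (rule upto_split1) (auto simp: m_def n_def)
    also have "[l..int n] = [l..l + int k] @ [l + int k + 1..int n]"
      by (rule upto_split2) (auto simp: n_def)
    finally have "map a [1 - int m..int n]
        = map a [1 - int m..l - 1] @ map a [l..l + int k] @ map a [l + int k + 1..int n]" by simp
    moreover have "reglist q (map a [1 - int m..int n])"
      using r m n unfolding digits_window by blast
    ultimately show ?thesis using reglist_infix by simp
  qed
  have "a i \<noteq> 0" if "i \<in> positions M N" for i
    using block[of i 0] that by (simp add: reglist_def)
  moreover have "map a [l..l + int k] \<notin> forbidden q" if "{l..l + int k} \<subseteq> positions M N" for l and k :: nat
    by (rule reglist_infixD[OF block[OF that], of "[]" _ "[]"]) simp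
  ultimately show "a \<in> Aq_term q M N" by (simp add: Aq_term_def)
qed

lemma Aq_eq: "Aq q = Aq_term q \<infinity> \<infinity>"
proof -
  have "positions \<infinity> \<infinity> = UNIV" by (auto simp: positions_def)
  then show ?thesis by (simp add: Aq_def Aq_term_def)
qed

lemma Aq_term_regular:
  assumes "a \<in> Aq_term q M N"
  shows "regular q N (right_digits a)" "dual_regular q M (left_digits a)"
proof -
  have "reglist q (rev (map (left_digits a) [0..<m]) @ map (right_digits a) [0..<n])"
    if "enat m \<le> M" "enat n \<le> N" for m n
    using assms that unfolding Aq_term_iff by blast
  from this[of 0] this[of _ 0] show "regular q N (right_digits a)" "dual_regular q M (left_digits a)"
    by (auto simp: regular_iff dual_regular_iff zero_enat_def[symmetric])
qed

lemma Aq_term_Dc: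
  assumes q: "3 \<le> q" and a: "a \<in> Aq_term q M N"
  shows "(cf q N (right_digits a), cf q M (left_digits a)) \<in> Dc q"
proof (rule closed_sequentially[OF closed_Dc])
  note reg = Aq_term_regular[OF a]
  show "(\<lambda>n. (cf_list q (map (right_digits a) [0..<trunc N n]),
       cf_list q (map (left_digits a) [0..<trunc M n])))
    \<longlonglongrightarrow> (cf q N (right_digits a), cf q M (left_digits a))"
    using reg regular_bounded_digits[OF q] dual_regular_bounded_digits[OF q]
    by (intro tendsto_Pair cf_list_tendsto_cf[OF q]) auto
  show "(cf_list q (map (right_digits a) [0..<trunc N n]),
       cf_list q (map (left_digits a) [0..<trunc M n])) \<in> Dc q" for n
    using a trunc_le by (intro reglist_Dc[OF q]) (auto simp: Aq_term_iff)
qed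

section \<open>Uniqueness and the converse inclusion\<close>

text \<open>The map \<open>x \<mapsto> - 1 / x - a lam\<close> leads from every \<open>phi q j\<close> to \<open>0\<close>; for odd \<open>q\<close> it runs first
  through the even and then through the odd indices.\<close>

definition rank :: "nat \<Rightarrow> nat \<Rightarrow> nat" where
  "rank q j = (if even q \<or> odd j then kappa q - j else 2 * kappa q - j)"

text \<open>That the successor has index at least 1 matters: it lies strictly to the right of
  -lam/2, and this strictness will determine the digit.\<close>

lemma phi_successor:
  assumes q: "3 \<le> q" and j: "j < kappa q"
  obtains a i where "1 \<le> a" "1 \<le> i" "i \<le> kappa q" "rank q i < rank q j"
    "phi q j = - 1 / (of_int a * lam q + phi q i)"
proof (cases "even q")
  case True
  show thesis
    using j phi_rec_even[OF q True j] True by (intro that[of 1 "j + 1"]) (auto simp: rank_def)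
next
  case False
  note h = odd_hq[OF q False]
  show thesis
  proof (cases "j + 2 \<le> kappa q")
    case True
    then show thesis
      using phi_rec_odd[OF q False True] False by (intro that[of 1 "j + 2"]) (auto simp: rank_def)
  next
    case f: False
    then have "j = kappa q - 1" using j by simp
    then show thesis
      using phi_odd_penultimate[OF q False] h False by (intro that[of 2 1]) (auto simp: rank_def)
  qed
qed

text \<open>Collects the recursions and closing relations. Unlike the walk through the points
  \<open>phi\<close>, this one never ends, so its use is an induction over a finite word and not
  over a rank.\<close>

lemma psc_successor:
  assumes q: "3 \<le> q" and j: "j \<le> kappa q"
  obtains a i where "1 \<le> a" "1 \<le> i" "i \<le> kappa q" "psc q j = - 1 / (of_int a * lam q + psc q i)"
proof (cases "even q")
  case True
  show thesis
  proof (cases "j < kappa q")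
    case j: True
    then show thesis using psc_rec_even[OF q True j] by (intro that[of 1 "j + 1"]) auto
  next
    case False
    then have "j = kappa q" using j by simp
    then show thesis
      using psc_even_kappa[OF q True] psc_1[OF q] True kappa_ge_1[OF q]
      by (intro that[of 2 1]) (auto simp: Rc_def)
  qed
next
  case False
  note h = odd_hq[OF q False]
  consider "j + 2 \<le> kappa q" | "j = kappa q - 1" | "j = kappa q" "3 \<le> kappa q" | "j = kappa q" "kappa q < 3"
    using j by linarith
  then show thesis
  proof cases
    case 1
    then show thesis using psc_rec_odd[OF q False 1] by (intro that[of 1 "j + 2"]) auto
  next
    case 2
    then show thesis
      using psc_odd_penultimate[OF q False] psc_1[OF q] kappa_ge_1[OF q] by (intro that[of 2 1]) auto
  next
    case 3
    then show thesis
      using psc_odd_kappa[OF q False] psc_2_odd[OF q False] by (intro that[of 2 2]) auto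
  next
    case 4
    then show thesis
      using psc_odd_kappa[OF q False] psc_1[OF q] odd_h0[OF q False] by (intro that[of 3 1]) auto
  qed
qed

lemma neg_inverse_inject: "- 1 / u = - 1 / v \<Longrightarrow> u \<noteq> 0 \<Longrightarrow> v \<noteq> 0 \<Longrightarrow> u = (v :: real)"
  by simp

lemma int_lam_diff:
  assumes "3 \<le> q" "of_int a * lam q + s = of_int b * lam q + t" "\<bar>s - t\<bar> < lam q"
  shows "a = b \<and> s = t"
proof -
  have "s - t = of_int (b - a) * lam q" using assms(2) by (simp add: algebra_simps)
  then have "b - a = 0"
    using abs_digit_lam[OF assms(1), of "b - a"] assms(3) by (cases "b - a = 0") auto
  then show ?thesis using assms(2) by simp
qed

text \<open>A tail in [-lam/2, lam/2] and a point phi_i > -lam/2 of the left half differ by less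
  than lam, so the digits leading from phi_j to 0 are forced; but an infinite expansion never has
  the value 0.\<close>

lemma regular_ne_phi:
  assumes q: "3 \<le> q"
  shows "regular q \<infinity> d \<Longrightarrow> j \<le> kappa q \<Longrightarrow> cf_inf q d \<noteq> phi q j"
proof (induction "rank q j" arbitrary: d j rule: less_induct)
  case less
  note b = regular_bounded_digits[OF q less.prems(1)]
  show ?case
  proof (cases "j = kappa q")
    case True
    then show ?thesis using phi_kappa[OF q] cf_inf_nonzero[OF q b] by simp
  next
    case False
    then have "j < kappa q" using less.prems(2) by simp
    then obtain a i where i: "1 \<le> a" "1 \<le> i" "i \<le> kappa q" "rank q i < rank q j"
      "phi q j = - 1 / (of_int a * lam q + phi q i)" by (rule phi_successor[OF q])
    define x where "x = cf_inf q (\<lambda>n. d (Suc n))"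
    note r' = regular_Suc[OF less.prems(1)]
    have x: "\<bar>x\<bar> \<le> lam q / 2" unfolding x_def by (rule regular_cf_inf_bound[OF q r'])
    have phi: "- lam q / 2 < phi q i" "phi q i \<le> 0"
      using phi_less[OF q, of 0 i] phi_bounds(2)[OF q i(3)] i phi_0[OF q] by auto
    show ?thesis
    proof
      assume "cf_inf q d = phi q j"
      then have "- 1 / (of_int (d 0) * lam q + x) = - 1 / (of_int a * lam q + phi q i)"
        using cf_inf_rec[OF q b] i(5) by (simp add: x_def)
      moreover have "of_int (d 0) * lam q + x \<noteq> 0" "of_int a * lam q + phi q i \<noteq> 0"
        using digit_denominator_nonzero[OF q, of "d 0" x] digit_denominator_nonzero[OF q, of a "phi q i"]
          x phi lam_half_le_Rc[OF q] b i(1) by (auto simp: bounded_digits_def)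
      ultimately have "of_int (d 0) * lam q + x = of_int a * lam q + phi q i"
        by (rule neg_inverse_inject)
      moreover have "\<bar>x - phi q i\<bar> < lam q" using x phi lam_ge_1[OF q] by linarith
      ultimately have "x = phi q i" using int_lam_diff[OF q] by blast
      then show False
        using less.hyps[OF i(4) r' i(3)] by (simp add: x_def)
    qed
  qed
qed

lemma regular_ne_uminus_phi:
  assumes q: "3 \<le> q" and "regular q \<infinity> d" "j \<le> kappa q"
  shows "cf_inf q d \<noteq> - phi q j"
  using regular_ne_phi[OF q regular_uminus[OF assms(2)] assms(3)]
    cf_inf_uminus[OF q regular_bounded_digits[OF q assms(2)]] by simp

text \<open>Two tails in the closed interval can differ by lam only at its opposite ends. The
  infinite expansion avoids both ends, which are phi_0 and -phi_0, so the first digits agree and can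
  be stripped.\<close>

lemma regular_ne_finite:
  assumes q: "3 \<le> q"
  shows "regular q \<infinity> d \<Longrightarrow> reglist q ds \<Longrightarrow> cf_inf q d \<noteq> cf_list q ds"
proof (induction ds arbitrary: d)
  case Nil
  then show ?case using cf_inf_nonzero[OF q regular_bounded_digits[OF q]] by simp
next
  case (Cons e ds)
  note b = regular_bounded_digits[OF q Cons.prems(1)]
  define x where "x = cf_inf q (\<lambda>n. d (Suc n))"
  define y where "y = cf_list q ds"
  note r' = regular_Suc[OF Cons.prems(1)]
  have rl: "reglist q ds" using reglist_append[of q "[e]" ds] Cons.prems(2) by simp
  have x: "\<bar>x\<bar> \<le> lam q / 2" unfolding x_def by (rule regular_cf_inf_bound[OF q r'])
  have y: "\<bar>y\<bar> \<le> lam q / 2" unfolding y_def by (rule cf_list_bound[OF q rl])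
  have x': "\<bar>x\<bar> \<noteq> lam q / 2"
    using regular_ne_phi[OF q r', of 0] regular_ne_uminus_phi[OF q r', of 0] phi_0[OF q]
    by (auto simp: x_def abs_if)
  have e: "e \<noteq> 0" using Cons.prems(2) by (auto simp: reglist_def)
  show ?case
  proof
    assume "cf_inf q d = cf_list q (e # ds)"
    then have "- 1 / (of_int (d 0) * lam q + x) = - 1 / (of_int e * lam q + y)"
      using cf_inf_rec[OF q b] by (simp add: x_def y_def)
    moreover have "of_int (d 0) * lam q + x \<noteq> 0" "of_int e * lam q + y \<noteq> 0"
      using digit_denominator_nonzero[OF q, of "d 0" x] digit_denominator_nonzero[OF q e, of y]
        x y lam_half_le_Rc[OF q] b by (auto simp: bounded_digits_def)
    ultimately have "of_int (d 0) * lam q + x = of_int e * lam q + y"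
      by (rule neg_inverse_inject)
    moreover have "\<bar>x - y\<bar> < lam q" using x x' y by linarith
    ultimately have "x = y" using int_lam_diff[OF q] by blast
    then show False using Cons.IH[OF r' rl] by (simp add: x_def y_def)
  qed
qed

text \<open>The digit e alone, taken as the right word, has a negative value, and over x < 0 no
  fibre goes below Rc - lam.\<close>

lemma dual_tail_lower:
  assumes q: "3 \<le> q" and r: "reglist q (rev (e # es))" and e: "1 \<le> e"
  shows "Rc q - lam q \<le> cf_list q es"
proof -
  have "(cf_list q [e], cf_list q es) \<in> Dc q"
    using reglist_Dc[OF q, of es "[e]"] r by simp
  moreover have "cf_list q [e] < 0"
    using pos_digit_neg[OF q e, of 0] lam_ge_1[OF q] by simp
  ultimately show ?thesis
    using negD_bounds(3)[OF q] Dc_negD[OF q] by blast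
qed

lemma rev_reglist_tail: "reglist q (rev (e # es)) \<Longrightarrow> reglist q (rev es)"
  using reglist_append[of q "rev es" "[e]"] by simp

lemma pos_digit_iff:
  assumes "3 \<le> q" "a \<noteq> 0" "\<bar>t\<bar> \<le> Rc q"
  shows "- 1 / (of_int a * lam q + t) < 0 \<longleftrightarrow> 1 \<le> a"
proof (cases "1 \<le> a")
  case True
  have "0 < of_int a * lam q + t"
    using mult_lam_ge[OF assms(1) True] Rc_bounds(4)[OF assms(1)] assms(3) by simp
  then show ?thesis using True by simp
next
  case False
  then have "of_int a * lam q \<le> of_int (- 1) * lam q"
    using assms(2) by (intro mult_lam_ge assms) simp
  then have "of_int a * lam q + t < 0"
    using Rc_bounds(4)[OF assms(1)] assms(3) by simp
  then show ?thesis using False by (simp add: zero_le_divide_iff)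
qed

text \<open>Both tails lie in [Rc - lam, Rc], so the first digits agree unless y = Rc and the other
  tail is Rc - lam. In that case the negated tail has the value -Rc = \<open>psc q 0\<close>, and
  the induction applies to it; hence the induction on the length with arbitrary j.\<close>

lemma finite_dual_ne_psc:
  assumes q: "3 \<le> q"
  shows "reglist q (rev es) \<Longrightarrow> j \<le> kappa q \<Longrightarrow> cf_list q es \<noteq> psc q j"
proof (induction "length es" arbitrary: es j rule: less_induct)
  case less
  show ?case
  proof (cases es)
    case Nil
    then show ?thesis using psc_neg[OF q less.prems(2)] by simp
  next
    case (Cons e es')
    define y where "y = cf_list q es'"
    have r: "reglist q (rev (e # es'))" using less.prems(1) Cons by simp
    note r' = rev_reglist_tail[OF r]
    have e: "e \<noteq> 0" using r by (auto simp: reglist_def)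
    have y: "\<bar>y\<bar> \<le> Rc q" unfolding y_def by (rule cf_list_rev_bound[OF q r'])
    obtain a i where i: "1 \<le> a" "1 \<le> i" "i \<le> kappa q" "psc q j = - 1 / (of_int a * lam q + psc q i)"
      using less.prems(2) by (rule psc_successor[OF q])
    have psc: "Rc q - lam q \<le> psc q i" "psc q i < 0" "\<bar>psc q i\<bar> \<le> Rc q"
      using psc_le[OF q i(2,3)] psc_neg[OF q i(3)] psc_ge[OF q i(3)] psc_1[OF q] by auto
    show ?thesis
    proof
      assume eq: "cf_list q es = psc q j"
      have "- 1 / (of_int e * lam q + y) < 0"
        using eq psc_neg[OF q less.prems(2)] Cons by (simp add: y_def)
      then have e1: "1 \<le> e" using pos_digit_iff[OF q e y] by blast
      have yl: "Rc q - lam q \<le> y"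
        unfolding y_def by (rule dual_tail_lower[OF q r e1])
      have "- 1 / (of_int e * lam q + y) = - 1 / (of_int a * lam q + psc q i)"
        using eq i(4) Cons by (simp add: y_def)
      moreover have "of_int e * lam q + y \<noteq> 0" "of_int a * lam q + psc q i \<noteq> 0"
        using digit_denominator_nonzero[OF q e y] digit_denominator_nonzero[OF q _ psc(3), of a] i(1)
        by auto
      ultimately have eq2: "of_int e * lam q + y = of_int a * lam q + psc q i"
        by (rule neg_inverse_inject)
      show False
      proof (cases "\<bar>y - psc q i\<bar> < lam q")
        case True
        then have "y = psc q i" using int_lam_diff[OF q eq2] by blast
        then show False using less.hyps[of es' i] r' i Cons by (simp add: y_def)
      next
        case False
        then have "y = Rc q"
          using y yl psc Rc_bounds(4)[OF q] by linarith
        then have "cf_list q (map uminus es') = psc q 0"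
          by (simp add: cf_list_uminus psc_0[OF q] y_def)
        moreover have "reglist q (rev (map uminus es'))"
          using reglist_uminus[OF r'] by (simp add: rev_map)
        ultimately show False using less.hyps[of "map uminus es'" 0] Cons by simp
      qed
    qed
  qed
qed

lemma dual_tail_lower_inf:
  assumes q: "3 \<le> q" and r: "dual_regular q \<infinity> d" and e: "1 \<le> d 0"
  shows "Rc q - lam q \<le> cf_inf q (\<lambda>n. d (Suc n))"
proof (rule LIMSEQ_le_const)
  show "(\<lambda>n. cf_list q (map (\<lambda>n. d (Suc n)) [0..<n])) \<longlonglongrightarrow> cf_inf q (\<lambda>n. d (Suc n))"
    by (intro cf_list_tendsto_cf_inf q bounded_digits_Suc dual_regular_bounded_digits r)
  have "Rc q - lam q \<le> cf_list q (map (\<lambda>n. d (Suc n)) [0..<n])" for n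
  proof (rule dual_tail_lower[OF q _ e])
    have "d 0 # map (\<lambda>n. d (Suc n)) [0..<n] = map d [0..<Suc n]"
      unfolding map_Suc_shift by (simp add: upt_conv_Cons del: upt_Suc)
    then show "reglist q (rev (d 0 # map (\<lambda>n. d (Suc n)) [0..<n]))"
      using r unfolding dual_regular_iff by (simp del: upt_Suc)
  qed
  then show "\<exists>N. \<forall>n\<ge>N. Rc q - lam q \<le> cf_list q (map (\<lambda>n. d (Suc n)) [0..<n])" by blast
qed

text \<open>After a change of sign the finite word begins with a positive digit, and then both tails
  lie in [Rc - lam, Rc]. A gap of exactly lam would put the finite tail at Rc or at
  \<open>psc q 1\<close>, and finite words take neither value.\<close>

lemma dual_regular_ne_finite:
  assumes q: "3 \<le> q"
  shows "dual_regular q \<infinity> d \<Longrightarrow> reglist q (rev es) \<Longrightarrow> cf_inf q d \<noteq> cf_list q es"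
proof (induction "length es" arbitrary: d es)
  case 0
  then show ?case using cf_inf_nonzero[OF q dual_regular_bounded_digits[OF q]] by simp
next
  case (Suc k)
  have main: False
    if d: "dual_regular q \<infinity> d" and r: "reglist q (rev (e # es))" and k: "length es = k"
      and eq: "cf_inf q d = cf_list q (e # es)" and e1: "1 \<le> e" for d e es
  proof -
    note b = dual_regular_bounded_digits[OF q d]
    note r' = rev_reglist_tail[OF r] and d' = dual_regular_Suc[OF d]
    define x where "x = cf_inf q (\<lambda>n. d (Suc n))"
    define y where "y = cf_list q es"
    have x: "\<bar>x\<bar> \<le> Rc q"
      unfolding x_def by (intro abs_cf_inf_le_Rc q bounded_digits_Suc b)
    have y: "\<bar>y\<bar> \<le> Rc q" unfolding y_def by (rule cf_list_rev_bound[OF q r'])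
    have d0: "d 0 \<noteq> 0" using b by (simp add: bounded_digits_def)
    have e: "e \<noteq> 0" using e1 by simp
    have eq1: "- 1 / (of_int (d 0) * lam q + x) = - 1 / (of_int e * lam q + y)"
      using cf_inf_rec[OF q b] eq by (simp add: x_def y_def)
    then have d1: "1 \<le> d 0"
      using pos_digit_iff[OF q e y] pos_digit_iff[OF q d0 x] e1 by simp
    have xl: "Rc q - lam q \<le> x"
      unfolding x_def by (rule dual_tail_lower_inf[OF q d d1])
    have yl: "Rc q - lam q \<le> y"
      unfolding y_def by (rule dual_tail_lower[OF q r e1])
    have eq2: "of_int (d 0) * lam q + x = of_int e * lam q + y"
      using eq1 digit_denominator_nonzero[OF q d0 x] digit_denominator_nonzero[OF q e y]
      by (rule neg_inverse_inject)
    show False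
    proof (cases "\<bar>x - y\<bar> < lam q")
      case True
      then have "x = y" using int_lam_diff[OF q eq2] by blast
      then show False using Suc.hyps(1)[OF k[symmetric] d' r'] by (simp add: x_def y_def)
    next
      case False
      then have "y = Rc q \<or> y = psc q 1"
        using x y xl yl psc_1[OF q] by linarith
      then show False
      proof
        assume "y = Rc q"
        then have "cf_list q (map uminus es) = psc q 0"
          by (simp add: cf_list_uminus psc_0[OF q] y_def)
        moreover have "reglist q (rev (map uminus es))"
          using reglist_uminus[OF r'] by (simp add: rev_map)
        ultimately show False using finite_dual_ne_psc[OF q, of "map uminus es" 0] by simp
      next
        assume "y = psc q 1"
        then show False
          using finite_dual_ne_psc[OF q r', of 1] kappa_ge_1[OF q] by (simp add: y_def)
      qed
    qed
  qed
  obtain e es' where es: "es = e # es'" "length es' = k"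
    using Suc.hyps(2) by (cases es) auto
  have e0: "e \<noteq> 0" using Suc.prems(2) es by (auto simp: reglist_def)
  show ?case
  proof
    assume eq: "cf_inf q d = cf_list q es"
    show False
    proof (cases "1 \<le> e")
      case True
      then show False using main Suc.prems eq es by blast
    next
      case False
      have "cf_inf q (\<lambda>n. - d n) = cf_list q (map uminus es)"
        using cf_inf_uminus[OF q dual_regular_bounded_digits[OF q Suc.prems(1)]] eq
        by (simp add: cf_list_uminus)
      moreover have "reglist q (rev (map uminus es))"
        using reglist_uminus[OF Suc.prems(2)] by (simp add: rev_map)
      ultimately show False
        using main[of "\<lambda>n. - d n" "- e" "map uminus es'"] dual_regular_uminus[OF Suc.prems(1)] es False e0
        by simp
    qed
  qed
qed

section \<open>Realization of the points of the domain\<close>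

lemma nearest_digit:
  assumes q: "3 \<le> q" and x: "\<bar>x\<bar> \<le> lam q / 2" "x \<noteq> 0"
  obtains a t where "a \<noteq> 0" "\<bar>t\<bar> \<le> lam q / 2" "x = - 1 / (of_int a * lam q + t)"
proof -
  note l = lam_ge_1[OF q] lam_less_2[OF q]
  define w where "w = - 1 / x"
  \<comment> \<open>The nearest multiple of lam leaves a rest of at most lam/2, and the digit is
    nonzero because |w| > 1 > lam/2.\<close>
  define a where "a = round (w / lam q)"
  define t where "t = w - of_int a * lam q"
  have "\<bar>of_int a - w / lam q\<bar> \<le> 1 / 2"
    unfolding a_def by (rule of_int_round_abs_le)
  then have "\<bar>of_int a - w / lam q\<bar> * lam q \<le> 1 / 2 * lam q"
    using l by (intro mult_right_mono) auto
  also have "\<bar>of_int a - w / lam q\<bar> * lam q = \<bar>(of_int a - w / lam q) * lam q\<bar>"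
    using l by (simp add: abs_mult)
  also have "(of_int a - w / lam q) * lam q = - t"
    using l by (simp add: t_def algebra_simps)
  finally have t: "\<bar>t\<bar> \<le> lam q / 2" by simp
  have "\<bar>x\<bar> < 1" using x l by linarith
  then have "1 < \<bar>w\<bar>" using x(2) by (simp add: w_def abs_divide field_simps)
  then have "a \<noteq> 0" using t l by (auto simp: t_def)
  moreover have "x = - 1 / (of_int a * lam q + t)" by (simp add: t_def w_def)
  ultimately show thesis using that t by blast
qed

text \<open>Supplies the length of an expansion: it stops at the first tail that is 0 and is
  infinite if there is none.\<close>

lemma zero_stopping_time:
  fixes f :: "nat \<Rightarrow> real"
  obtains N :: enat where "\<And>n. enat n < N \<Longrightarrow> f n \<noteq> 0" "\<And>n. N = enat n \<Longrightarrow> f n = 0"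
proof (cases "\<exists>n. f n = 0")
  case True
  define k where "k = (LEAST n. f n = 0)"
  have "f k = 0" unfolding k_def by (rule LeastI_ex[OF True])
  moreover have "f n \<noteq> 0" if "n < k" for n
    using that unfolding k_def by (rule not_less_Least)
  ultimately show thesis by (intro that[of "enat k"]) auto
next
  case False
  then show thesis using that[of \<infinity>] by simp
qed

lemma forward_orbit:
  assumes q: "3 \<le> q" and x: "\<bar>x\<bar> \<le> lam q / 2"
  obtains t :: "nat \<Rightarrow> real" and d :: "nat \<Rightarrow> int" where "t 0 = x" "\<And>n. \<bar>t n\<bar> \<le> lam q / 2"
    "\<And>n. t n \<noteq> 0 \<Longrightarrow> d n \<noteq> 0 \<and> t n = - 1 / (of_int (d n) * lam q + t (Suc n))"
proof -
  have "\<exists>t. \<forall>n. (\<bar>t n\<bar> \<le> lam q / 2 \<and> (n = 0 \<longrightarrow> t n = x)) \<and>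
      (t n \<noteq> 0 \<longrightarrow> (\<exists>a. a \<noteq> 0 \<and> t n = - 1 / (of_int a * lam q + t (Suc n))))"
  proof (rule dependent_nat_choice)
    show "\<exists>t. \<bar>t\<bar> \<le> lam q / 2 \<and> ((0::nat) = 0 \<longrightarrow> t = x)" using x by blast
    fix s :: real and n :: nat
    assume s: "\<bar>s\<bar> \<le> lam q / 2 \<and> (n = 0 \<longrightarrow> s = x)"
    show "\<exists>t. (\<bar>t\<bar> \<le> lam q / 2 \<and> (Suc n = 0 \<longrightarrow> t = x)) \<and>
        (s \<noteq> 0 \<longrightarrow> (\<exists>a. a \<noteq> 0 \<and> s = - 1 / (of_int a * lam q + t)))"
    proof (cases "s = 0")
      case True
      \<comment> \<open>Once 0 is reached it is repeated as a default; the expansion has already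
        ended there.\<close>
      then show ?thesis using s by (intro exI[of _ s]) simp
    next
      case False
      have sb: "\<bar>s\<bar> \<le> lam q / 2" using s by simp
      obtain a t where "a \<noteq> 0" "\<bar>t\<bar> \<le> lam q / 2" "s = - 1 / (of_int a * lam q + t)"
        by (rule nearest_digit[OF q sb False])
      then show ?thesis by (intro exI[of _ t]) auto
    qed
  qed
  then obtain t where T: "\<forall>n. (\<bar>t n\<bar> \<le> lam q / 2 \<and> (n = 0 \<longrightarrow> t n = x)) \<and>
      (t n \<noteq> 0 \<longrightarrow> (\<exists>a. a \<noteq> 0 \<and> t n = - 1 / (of_int a * lam q + t (Suc n))))" ..
  have "\<exists>a. t n \<noteq> 0 \<longrightarrow> a \<noteq> 0 \<and> t n = - 1 / (of_int a * lam q + t (Suc n))" for n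
    using spec[OF T, of n] by (cases "t n = 0") simp_all
  then have "\<forall>n. \<exists>a. t n \<noteq> 0 \<longrightarrow> a \<noteq> 0 \<and> t n = - 1 / (of_int a * lam q + t (Suc n))" ..
  from choice[OF this] obtain d where
    d: "\<forall>n. t n \<noteq> 0 \<longrightarrow> d n \<noteq> 0 \<and> t n = - 1 / (of_int (d n) * lam q + t (Suc n))" ..
  show thesis
  proof (rule that)
    show "t 0 = x" using spec[OF T, of 0] by simp
    show "\<bar>t n\<bar> \<le> lam q / 2" for n using spec[OF T, of n] by simp
    show "d n \<noteq> 0 \<and> t n = - 1 / (of_int (d n) * lam q + t (Suc n))" if "t n \<noteq> 0" for n
      using spec[OF d, of n] that by blast
  qed
qed

text \<open>Besides the tails t of y, the sequence s records the values of x with the chosen digits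
  put in front. Keeping the pair in the domain is what bounds these values.\<close>

lemma backward_orbit:
  assumes q: "3 \<le> q" and xy: "(x, y) \<in> Dc q"
  obtains s t :: "nat \<Rightarrow> real" and d :: "nat \<Rightarrow> int" where "s 0 = x" "t 0 = y" "\<And>n. (s n, t n) \<in> Dc q"
    "\<And>n. t n \<noteq> 0 \<Longrightarrow> d n \<noteq> 0 \<and> t n = - 1 / (of_int (d n) * lam q + t (Suc n)) \<and>
       s (Suc n) = - 1 / (of_int (d n) * lam q + s n)"
proof -
  have "\<exists>p. \<forall>n. (p n \<in> Dc q \<and> (n = 0 \<longrightarrow> p n = (x, y))) \<and>
      (snd (p n) \<noteq> 0 \<longrightarrow> (\<exists>a. a \<noteq> 0 \<and> snd (p n) = - 1 / (of_int a * lam q + snd (p (Suc n))) \<and>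
        fst (p (Suc n)) = - 1 / (of_int a * lam q + fst (p n))))"
  proof (rule dependent_nat_choice)
    show "\<exists>p. p \<in> Dc q \<and> ((0::nat) = 0 \<longrightarrow> p = (x, y))" using xy by blast
    fix p :: "real \<times> real" and n :: nat
    assume p: "p \<in> Dc q \<and> (n = 0 \<longrightarrow> p = (x, y))"
    show "\<exists>p'. (p' \<in> Dc q \<and> (Suc n = 0 \<longrightarrow> p' = (x, y))) \<and>
        (snd p \<noteq> 0 \<longrightarrow> (\<exists>a. a \<noteq> 0 \<and> snd p = - 1 / (of_int a * lam q + snd p') \<and>
          fst p' = - 1 / (of_int a * lam q + fst p)))"
    proof (cases "snd p = 0")
      case True
      then show ?thesis using p by (intro exI[of _ p]) simp
    next
      case False
      have "(fst p, snd p) \<in> Dc q" using p by simp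
      from Dc_backward[OF q this False] obtain a z where "a \<noteq> 0" "snd p = - 1 / (of_int a * lam q + z)"
          "(- 1 / (of_int a * lam q + fst p), z) \<in> Dc q" .
      then show ?thesis by (intro exI[of _ "(- 1 / (of_int a * lam q + fst p), z)"]) auto
    qed
  qed
  then obtain p where P: "\<forall>n. (p n \<in> Dc q \<and> (n = 0 \<longrightarrow> p n = (x, y))) \<and>
      (snd (p n) \<noteq> 0 \<longrightarrow> (\<exists>a. a \<noteq> 0 \<and> snd (p n) = - 1 / (of_int a * lam q + snd (p (Suc n))) \<and>
        fst (p (Suc n)) = - 1 / (of_int a * lam q + fst (p n))))" ..
  have "\<exists>a. snd (p n) \<noteq> 0 \<longrightarrow> a \<noteq> 0 \<and>
      snd (p n) = - 1 / (of_int a * lam q + snd (p (Suc n))) \<and>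
      fst (p (Suc n)) = - 1 / (of_int a * lam q + fst (p n))" for n
    using spec[OF P, of n] by (cases "snd (p n) = 0") simp_all
  then have "\<forall>n. \<exists>a. snd (p n) \<noteq> 0 \<longrightarrow> a \<noteq> 0 \<and>
      snd (p n) = - 1 / (of_int a * lam q + snd (p (Suc n))) \<and>
      fst (p (Suc n)) = - 1 / (of_int a * lam q + fst (p n))" ..
  from choice[OF this] obtain d where d: "\<forall>n. snd (p n) \<noteq> 0 \<longrightarrow> d n \<noteq> 0 \<and>
      snd (p n) = - 1 / (of_int (d n) * lam q + snd (p (Suc n))) \<and>
      fst (p (Suc n)) = - 1 / (of_int (d n) * lam q + fst (p n))" ..
  show thesis
  proof (rule that[of "\<lambda>n. fst (p n)" "\<lambda>n. snd (p n)" d])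
    show "fst (p 0) = x" "snd (p 0) = y" using spec[OF P, of 0] by simp_all
    show "(fst (p n), snd (p n)) \<in> Dc q" for n using spec[OF P, of n] by simp
    show "d n \<noteq> 0 \<and> snd (p n) = - 1 / (of_int (d n) * lam q + snd (p (Suc n))) \<and>
       fst (p (Suc n)) = - 1 / (of_int (d n) * lam q + fst (p n))" if "snd (p n) \<noteq> 0" for n
      using spec[OF d, of n] that by blast
  qed
qed

lemma chain_upt:
  assumes "\<And>k. k \<le> n \<Longrightarrow> \<bar>t k\<bar> \<le> lam q / 2"
    "\<And>k. k < n \<Longrightarrow> d k \<noteq> 0 \<and> t k = - 1 / (of_int (d k) * lam q + t (Suc k))"
  shows "m \<le> n \<Longrightarrow> chain q (map d [m..<n]) (t n) \<and> cft q (map d [m..<n]) (t n) = t m"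
proof (induction m rule: inc_induct)
  case base
  then show ?case using assms(1)[of n] by simp
next
  case (step m)
  then show ?case
    using assms(1)[of m] assms(2)[of m] by (simp add: upt_conv_Cons)
qed

lemma chain_rev_upt:
  assumes "\<And>k. k \<le> m \<Longrightarrow> \<bar>s k\<bar> \<le> lam q / 2"
    "\<And>k. k < m \<Longrightarrow> e k \<noteq> 0 \<and> s (Suc k) = - 1 / (of_int (e k) * lam q + s k)"
  shows "chain q (rev (map e [0..<m])) (s 0) \<and> cft q (rev (map e [0..<m])) (s 0) = s m"
  using assms
proof (induction m)
  case (Suc m)
  then have "chain q (rev (map e [0..<m])) (s 0) \<and> cft q (rev (map e [0..<m])) (s 0) = s m" by simp
  then show ?case using Suc.prems(1)[of "Suc m"] Suc.prems(2)[of m] by simp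
qed simp

lemma cft_upt:
  assumes "\<And>k. k < n \<Longrightarrow> t k = - 1 / (of_int (d k) * lam q + t (Suc k))"
  shows "m \<le> n \<Longrightarrow> cft q (map d [m..<n]) (t n) = t m"
proof (induction m rule: inc_induct)
  case (step m)
  then show ?case using assms[of m] by (simp add: upt_conv_Cons)
qed simp

lemma cf_eq_tail:
  assumes q: "3 \<le> q" and b: "N = \<infinity> \<Longrightarrow> bounded_digits q d"
    and t: "\<And>n. enat n < N \<Longrightarrow> t n = - 1 / (of_int (d n) * lam q + t (Suc n))"
      "\<And>n. \<bar>t n\<bar> \<le> Rc q" "\<And>n. N = enat n \<Longrightarrow> t n = 0"
  shows "cf q N d = t 0"
proof (cases N)
  case (enat n)
  have "cft q (map d [0..<n]) (t n) = t 0"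
    using t(1) enat by (intro cft_upt) auto
  then show ?thesis using t(3)[OF enat] enat by (simp add: cf_def cf_list_cft)
next
  case infinity
  then show ?thesis
    using cf_inf_eq_tail[OF q b[OF infinity] t(1,2)] by (simp add: cf_def)
qed

lemma Dc_realize:
  assumes q: "3 \<le> q" and xy: "(x, y) \<in> Dc q"
  obtains M N a where "a \<in> Aq_term q M N" "x = cf q N (right_digits a)" "y = cf q M (left_digits a)"
proof -
  obtain t d where t: "t 0 = x" "\<And>n. \<bar>t n\<bar> \<le> lam q / 2"
    "\<And>n. t n \<noteq> 0 \<Longrightarrow> d n \<noteq> 0 \<and> t n = - 1 / (of_int (d n) * lam q + t (Suc n))"
    using forward_orbit[OF q Dc_bounds(1)[OF q xy]] by blast
  obtain s u e where s: "s 0 = x" "u 0 = y" "\<And>n. (s n, u n) \<in> Dc q"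
    "\<And>n. u n \<noteq> 0 \<Longrightarrow> e n \<noteq> 0 \<and> u n = - 1 / (of_int (e n) * lam q + u (Suc n)) \<and>
       s (Suc n) = - 1 / (of_int (e n) * lam q + s n)"
    using backward_orbit[OF q xy] by blast
  obtain N where N: "\<And>n. enat n < N \<Longrightarrow> t n \<noteq> 0" "\<And>n. N = enat n \<Longrightarrow> t n = 0"
    using zero_stopping_time by blast
  obtain M where M: "\<And>n. enat n < M \<Longrightarrow> u n \<noteq> 0" "\<And>n. M = enat n \<Longrightarrow> u n = 0"
    using zero_stopping_time by blast
  \<comment> \<open>Digits from the stopping times on are whatever the choice has supplied; they lie
    outside \<open>positions M N\<close>.\<close>
  define a where "a i = (if 1 \<le> i then d (nat (i - 1)) else e (nat (- i)))" for i
  have rd: "right_digits a = d" and ld: "left_digits a = e"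
    by (auto simp: right_digits_def left_digits_def a_def)
  have a: "a \<in> Aq_term q M N"
    unfolding Aq_term_iff rd ld
  proof (intro allI impI)
    fix m n assume mn: "enat m \<le> M" "enat n \<le> N"
    have "enat k < N" if "k < n" for k
      using that mn(2) less_le_trans[of "enat k" "enat n" N] by simp
    then have 1: "chain q (map d [0..<n]) (t n) \<and> cft q (map d [0..<n]) (t n) = t 0"
      using t N(1) by (intro chain_upt) auto
    have "enat k < M" if "k < m" for k
      using that mn(1) less_le_trans[of "enat k" "enat m" M] by simp
    \<comment> \<open>The tails inside the left part are the numbers s k, which as first coordinates
      of points of the domain stay in [-lam/2, lam/2]; both chains meet at x.\<close>
    then have "chain q (rev (map e [0..<m])) (s 0) \<and> cft q (rev (map e [0..<m])) (s 0) = s m"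
      using s(3,4) M(1) Dc_bounds(1)[OF q] by (intro chain_rev_upt) blast+
    then have "chain q (rev (map e [0..<m]) @ map d [0..<n]) (t n)"
      using 1 t(1) s(1) by (simp add: chain_append)
    then show "reglist q (rev (map e [0..<m]) @ map d [0..<n])"
      by (rule chain_reglist[OF q])
  qed
  note reg = Aq_term_regular[OF a, unfolded rd ld]
  have "cf q N d = t 0"
    using t N reg(1) regular_bounded_digits[OF q] lam_half_le_Rc[OF q] order_trans
    by (intro cf_eq_tail[OF q]) blast+
  moreover have "cf q M e = u 0"
    using s M reg(2) dual_regular_bounded_digits[OF q] Dc_bounds(2)[OF q]
    by (intro cf_eq_tail[OF q]) blast+
  ultimately show thesis using that[OF a] t(1) s(2) unfolding rd ld by simp
qed

lemma Omega_full_eq_Dc: "3 \<le> q \<Longrightarrow> Omega_full q = Dc q"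
proof (rule set_eqI, clarify)
  fix x y assume q: "3 \<le> q"
  show "(x, y) \<in> Omega_full q \<longleftrightarrow> (x, y) \<in> Dc q"
  proof
    assume "(x, y) \<in> Omega_full q"
    then show "(x, y) \<in> Dc q"
      unfolding Omega_full_def using Aq_term_Dc[OF q] by blast
  next
    assume "(x, y) \<in> Dc q"
    then obtain M N a where "a \<in> Aq_term q M N" "x = cf q N (right_digits a)" "y = cf q M (left_digits a)"
      using Dc_realize[OF q] by blast
    then show "(x, y) \<in> Omega_full q"
      unfolding Omega_full_def using Aq_term_regular by blast
  qed
qed

text \<open>The realization of a point may stop on either side. If both coordinates also have
  infinite expansions, stopping would give a finite and an infinite expansion the same
  value.\<close>

lemma Omega_eq:
  assumes q: "3 \<le> q"
  shows "Omega q = Dc q \<inter> (reg_inf_values q \<times> dual_inf_values q)"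
proof (intro set_eqI iffI; clarify)
  fix x y assume "(x, y) \<in> Omega q"
  then obtain a where a: "a \<in> Aq q" "regular q \<infinity> (right_digits a)" "x = cf q \<infinity> (right_digits a)"
     "dual_regular q \<infinity> (left_digits a)" "y = cf q \<infinity> (left_digits a)"
    unfolding Omega_def by blast
  then show "(x, y) \<in> Dc q \<inter> (reg_inf_values q \<times> dual_inf_values q)"
    using Aq_term_Dc[OF q, of a \<infinity> \<infinity>] unfolding Aq_eq reg_inf_values_def dual_inf_values_def by blast
next
  fix x y
  assume xy: "(x, y) \<in> Dc q" and x: "x \<in> reg_inf_values q" and y: "y \<in> dual_inf_values q"
  obtain M N a where a: "a \<in> Aq_term q M N" "x = cf q N (right_digits a)" "y = cf q M (left_digits a)"
    using Dc_realize[OF q xy] by blast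
  note reg = Aq_term_regular[OF a(1)]
  have "N = \<infinity>"
  proof (rule ccontr)
    assume "N \<noteq> \<infinity>"
    then obtain n where n: "N = enat n" by blast
    obtain d where d: "regular q \<infinity> d" "x = cf_inf q d"
      using x by (auto simp: reg_inf_values_def cf_def)
    have "reglist q (map (right_digits a) [0..<n])" using reg(1) n by (simp add: regular_iff)
    then have "cf_inf q d \<noteq> cf_list q (map (right_digits a) [0..<n])"
      by (rule regular_ne_finite[OF q d(1)])
    then show False using d(2) a(2) n by (simp add: cf_def)
  qed
  moreover have "M = \<infinity>"
  proof (rule ccontr)
    assume "M \<noteq> \<infinity>"
    then obtain n where n: "M = enat n" by blast
    obtain d where d: "dual_regular q \<infinity> d" "y = cf_inf q d"
      using y by (auto simp: dual_inf_values_def cf_def)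
    have "reglist q (rev (map (left_digits a) [0..<n]))" using reg(2) n by (simp add: dual_regular_iff)
    then have "cf_inf q d \<noteq> cf_list q (map (left_digits a) [0..<n])"
      by (rule dual_regular_ne_finite[OF q d(1)])
    then show False using d(2) a(3) n by (simp add: cf_def)
  qed
  ultimately show "(x, y) \<in> Omega q"
    using a reg unfolding Omega_def Aq_eq by blast
qed

text \<open>Strict inequalities single out one rectangle; on a common boundary the larger fibre of
  the right neighbour would be possible too.\<close>

lemma Dc_section:
  assumes q: "3 \<le> q" and D: "(x, y) \<in> Dc q" and i: "1 \<le> i" "i \<le> kappa q"
    and x: "phi q (i - 1) < x" "x < phi q i"
  shows "psc q (kappa q - i + 1) \<le> y \<and> y \<le> Rc q"
proof -
  have "x < 0" using x phi_bounds(2)[OF q i(2)] by simp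
  then obtain j where j: "1 \<le> j" "j \<le> kappa q" "phi q (j - 1) \<le> x" "x \<le> phi q j"
      "psc q (kappa q - j + 1) \<le> y" "y \<le> Rc q"
    using Dc_negD[OF q D] by (auto elim: negDE)
  have "\<not> j < i"
    using phi_le[OF q, of j "i - 1"] i j x by fastforce
  moreover have "\<not> i < j"
    using phi_le[OF q, of i "j - 1"] i j x by fastforce
  ultimately have "i = j" by simp
  then show ?thesis using j by simp
qed

theorem lemma4p5p2:
  fixes q :: nat
  assumes "3 \<le> q"
  shows "(\<forall>a \<in> Aq q. \<forall>i \<in> {1..kappa q}.
            (Pi1 q a \<in> {phi q (i - 1)..phi q i} \<longrightarrow>
               Pi2 q a \<in> {psi q (kappa q - i + 1)..Rq q}) \<and>
            (Pi1 q a \<in> uminus ` {phi q (i - 1)..phi q i} \<longrightarrow>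
               Pi2 q a \<in> uminus ` {psi q (kappa q - i + 1)..Rq q})) \<and>
         (let D = (\<Union>i \<in> {1..kappa q}.
                     ({phi q (i - 1)..phi q i} \<times> {psi q (kappa q - i + 1)..Rq q}) \<union>
                     ({- phi q i..- phi q (i - 1)} \<times> {- Rq q..- psi q (kappa q - i + 1)}))
          in Omega_full q \<subseteq> Iq q \<times> IRq q \<and>
             Omega_full q = D \<and>
             Omega q = D \<inter> (reg_inf_values q \<times> dual_inf_values q))"
proof -
  note q = assms
  have psi: "psi q (kappa q - i + 1) = psc q (kappa q - i + 1)" if "i \<in> {1..kappa q}" for i
    using that by (intro psi_eq q) auto
  have D: "(\<Union>i \<in> {1..kappa q}.
       ({phi q (i - 1)..phi q i} \<times> {psi q (kappa q - i + 1)..Rq q}) \<union>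
       ({- phi q i..- phi q (i - 1)} \<times> {- Rq q..- psi q (kappa q - i + 1)})) = Dc q"
    unfolding Dc_eq Rq_eq[OF q] by (intro SUP_cong refl) (simp only: psi)
  have "Dc q \<subseteq> Iq q \<times> IRq q"
    using Dc_bounds[OF q] by (force simp: Iq_def IRq_def Rq_eq[OF q] abs_le_iff)
  moreover have "(Pi1 q a \<in> {phi q (i - 1)..phi q i} \<longrightarrow>
               Pi2 q a \<in> {psi q (kappa q - i + 1)..Rq q}) \<and>
            (Pi1 q a \<in> uminus ` {phi q (i - 1)..phi q i} \<longrightarrow>
               Pi2 q a \<in> uminus ` {psi q (kappa q - i + 1)..Rq q})"
    if a: "a \<in> Aq q" and i: "i \<in> {1..kappa q}" for a i
  proof -
    have Da: "(Pi1 q a, Pi2 q a) \<in> Dc q"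
      using Aq_term_Dc[OF q, of a \<infinity> \<infinity>] a by (simp add: Aq_eq Pi1_def Pi2_def cf_def)
    have reg: "regular q \<infinity> (right_digits a)"
      using Aq_term_regular(1) a unfolding Aq_eq by blast
    \<comment> \<open>Turns membership in the closed intervals into the strict inequalities that
      select one fibre.\<close>
    have ne: "Pi1 q a \<noteq> phi q j" "Pi1 q a \<noteq> - phi q j" if "j \<le> kappa q" for j
      using regular_ne_phi[OF q reg that] regular_ne_uminus_phi[OF q reg that] by (auto simp: Pi1_def)
    have i': "i - 1 \<le> kappa q" "i \<le> kappa q" "1 \<le> i" using i by auto
    have "psc q (kappa q - i + 1) \<le> Pi2 q a \<and> Pi2 q a \<le> Rc q"
      if "Pi1 q a \<in> {phi q (i - 1)..phi q i}"
      using that ne[OF i'(1)] ne[OF i'(2)] by (intro Dc_section[OF q Da i'(3,2)]) auto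
    moreover have "psc q (kappa q - i + 1) \<le> - Pi2 q a \<and> - Pi2 q a \<le> Rc q"
      if "Pi1 q a \<in> uminus ` {phi q (i - 1)..phi q i}"
    proof (rule Dc_section[OF q _ i'(3,2)])
      show "(- Pi1 q a, - Pi2 q a) \<in> Dc q" using Da by (simp add: Dc_uminus)
      show "phi q (i - 1) < - Pi1 q a" "- Pi1 q a < phi q i"
        using that ne[OF i'(1)] ne[OF i'(2)] by force+
    qed
    ultimately show ?thesis
      unfolding psi[OF i] Rq_eq[OF q] by (force simp: image_iff intro: bexI[of _ "- Pi2 q a"])
  qed
  ultimately show ?thesis
    unfolding Let_def D Omega_full_eq_Dc[OF q] Omega_eq[OF q] by blast
qed

end
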